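(* Let $Q$ be an open subset of $\mathbb{R}^N$, $A$ an $H$-supralgebra on $\mathbb{R}^N_y$, $E$ a fundamental sequence, and let $1<p,q<\infty$, $r\ge1$ with $1/r=1/p+1/q\le1$. Assume $(u_\varepsilon)_{\varepsilon\in E}\subset L^q(Q\times\Omega)$ weakly stochastically $\Sigma$-converges in $L^q(Q\times\Omega)$ to $u_0\in L^q(Q\times\Omega;\mathcal{B}^q_A)$, and $(v_\varepsilon)_{\varepsilon\in E}\subset L^p(Q\times\Omega)$ strongly stochastically $\Sigma$-converges in $L^p(Q\times\Omega)$ to $v_0\in L^p(Q\times\Omega;\mathcal{B}^p_A)$. Then $(u_\varepsilon v_\varepsilon)_{\varepsilon\in E}$ weakly stochastically $\Sigma$-converges in $L^r(Q\times\Omega)$ to $u_0v_0$.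
   Context: $(\Omega,\mathcal{M},\mu)$ is a probability space with an $N$-dimensional dynamical system $\{T(x)\}$ (invertible measurable $\mu$-preserving maps, $T(0)=\mathrm{id}$, $T(x+y)=T(x)\circ T(y)$, jointly measurable). $\mathcal{C}^\infty(\Omega)$ is the set of $f\in L^\infty(\Omega)$ all of whose iterated stochastic derivatives (generators in directions $e_i$ of $f\mapsto f\circ T(x)$ on $L^\infty$) exist in $L^\infty(\Omega)$. A bounded continuous $u$ has mean value $M(u)$ if $u(\cdot/t)\to M(u)$ weakly-* in $L^\infty$ as $t\to0^+$; an $H$-supralgebra is a sup-norm closed subalgebra $A$ of bounded continuous complex functions containing constants, closed under conjugation, with mean values. $\Delta(A)$ spectrum, $\mathcal{G}$ Gelfand transformation, $\beta$ the probability measure with $M(u)=\int\mathcal{G}(u)d\beta$. For $1\le p<\infty$, $B^p_A$ is the closure of $A$ for $\|u\|_p=(\lim_r|B_r|^{-1}\int_{B_r}|u|^p)^{1/p}$; $\mathcal{B}^p_A=B^p_A/\ker\mathcal{G}$ with induced isometric isomorphism $\mathcal{G}_1:\mathcal{B}^p_A\to L^p(\Delta(A))$; multiplication extends to $\mathcal{B}^p_A\times\mathcal{B}^q_A\to\mathcal{B}^r_A$ (so $\mathcal{G}_1(u_0v_0)=\mathcal{G}_1(u_0)\mathcal{G}_1(v_0)$). A fundamental sequence is $(\varepsilon_n)$, $0<\varepsilon_n\le1$, $\varepsilon_n\to0$. $\varepsilon_1,\varepsilon_2>0$ functions of $\varepsilon$ with $\varepsilon_1,\varepsilon_2,\varepsilon_2/\varepsilon_1\to0$;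 $f^\varepsilon(x,\omega)=f(x,T(x/\varepsilon_1)\omega,x/\varepsilon_2)$, $\widehat{f}=\mathcal{G}(f(x,\omega,\cdot))$. A bounded $(u_\varepsilon)$ in $L^p(Q\times\Omega)$ weakly stochastically $\Sigma$-converges to $u_0\in L^p(Q\times\Omega;\mathcal{B}^p_A)$ if $\int u_\varepsilon f^\varepsilon dxd\mu\to\iiint(\mathcal{G}_1\circ u_0)\widehat{f}dxd\mu d\beta$ for all $f\in\mathcal{C}^\infty_0(Q)\otimes\mathcal{C}^\infty(\Omega)\otimes A$; it strongly stochastically $\Sigma$-converges if in addition $\|u_\varepsilon\|_{L^p(Q\times\Omega)}\to\|\mathcal{G}_1\circ u_0\|_{L^p(Q\times\Omega\times\Delta(A))}$. *)

theory Defs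
  imports "HOL-Analysis.Analysis" "HOL-Probability.Probability"
begin

definition dynamical_system :: "'w measure \<Rightarrow> (real^'n \<Rightarrow> 'w \<Rightarrow> 'w) \<Rightarrow> bool" where
  "dynamical_system M T \<longleftrightarrow>
     prob_space M \<and>
     (\<forall>x. T x \<in> M \<rightarrow>\<^sub>M M \<and> bij_betw (T x) (space M) (space M)
          \<and> (\<lambda>\<omega>. inv_into (space M) (T x) \<omega>) \<in> M \<rightarrow>\<^sub>M M
          \<and> distr M M (T x) = M) \<and>
     (\<forall>\<omega>\<in>space M. T 0 \<omega> = \<omega>) \<and>
     (\<forall>x y. \<forall>\<omega>\<in>space M. T (x + y) \<omega> = T x (T y \<omega>)) \<and>
     (\<lambda>(x, \<omega>). T x \<omega>) \<in> (lborel \<Otimes>\<^sub>M M) \<rightarrow>\<^sub>M M"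

definition Linf :: "'w measure \<Rightarrow> ('w \<Rightarrow> complex) \<Rightarrow> bool" where
  "Linf M f \<longleftrightarrow> f \<in> borel_measurable M \<and> (\<exists>C. AE \<omega> in M. cmod (f \<omega>) \<le> C)"

text \<open>g is the stochastic derivative of f in direction e_i: the generator of
  f \<mapsto> f \<circ> T(x) on L^infinity in direction e_i, i.e. the difference quotients converge
  to g in the L^infinity norm.\<close>
definition stoch_deriv :: "'w measure \<Rightarrow> (real^'n \<Rightarrow> 'w \<Rightarrow> 'w) \<Rightarrow> 'n \<Rightarrow> ('w \<Rightarrow> complex)
    \<Rightarrow> ('w \<Rightarrow> complex) \<Rightarrow> bool" where
  "stoch_deriv M T i f g \<longleftrightarrow> Linf M g \<and>
     (\<forall>e>0. \<exists>\<delta>>0. \<forall>t::real. t \<noteq> 0 \<and> \<bar>t\<bar> < \<delta> \<longrightarrow>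
        (AE \<omega> in M. cmod ((f (T (t *\<^sub>R axis i 1) \<omega>) - f \<omega>) / of_real t - g \<omega>) \<le> e))"

definition stoch_smooth :: "'w measure \<Rightarrow> (real^'n \<Rightarrow> 'w \<Rightarrow> 'w) \<Rightarrow> ('w \<Rightarrow> complex) \<Rightarrow> bool" where
  "stoch_smooth M T f \<longleftrightarrow>
     (\<exists>d :: 'n list \<Rightarrow> 'w \<Rightarrow> complex. d [] = f \<and> (\<forall>\<alpha>. Linf M (d \<alpha>)) \<and>
        (\<forall>\<alpha> i. stoch_deriv M T i (d \<alpha>) (d (i # \<alpha>))))"

definition smooth_compact_support :: "(real^'n) set \<Rightarrow> (real^'n \<Rightarrow> complex) \<Rightarrow> bool" where
  "smooth_compact_support Q \<phi> \<longleftrightarrow>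
     (\<exists>d :: 'n list \<Rightarrow> real^'n \<Rightarrow> complex. d [] = \<phi> \<and>
        (\<forall>\<alpha> x. (d \<alpha> has_derivative (\<lambda>h. \<Sum>i\<in>UNIV. (h $ i) *\<^sub>R d (i # \<alpha>) x)) (at x))) \<and>
     compact (closure {x. \<phi> x \<noteq> 0}) \<and> closure {x. \<phi> x \<noteq> 0} \<subseteq> Q"

definition bcont :: "(real^'n \<Rightarrow> complex) \<Rightarrow> bool" where
  "bcont u \<longleftrightarrow> continuous_on UNIV u \<and> bounded (range u)"

text \<open>u(./t) \<rightarrow> m weakly-* in L^infinity(R^N) as t \<rightarrow> 0+, i.e. against every L^1 function.\<close>
definition has_mean :: "(real^'n \<Rightarrow> complex) \<Rightarrow> complex \<Rightarrow> bool" where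
  "has_mean u m \<longleftrightarrow>
     (\<forall>\<phi> :: real^'n \<Rightarrow> complex. integrable lborel \<phi> \<longrightarrow>
        ((\<lambda>t. LINT x|lborel. u ((1 / t) *\<^sub>R x) * \<phi> x) \<longlongrightarrow> m * (LINT x|lborel. \<phi> x)) (at_right 0))"

definition mean_value :: "(real^'n \<Rightarrow> complex) \<Rightarrow> complex" where
  "mean_value u = (THE m. has_mean u m)"

definition H_supralgebra :: "(real^'n \<Rightarrow> complex) set \<Rightarrow> bool" where
  "H_supralgebra A \<longleftrightarrow>
     (\<forall>u\<in>A. bcont u) \<and>
     (\<forall>c. (\<lambda>_. c) \<in> A) \<and>
     (\<forall>u\<in>A. \<forall>v\<in>A. (\<lambda>y. u y + v y) \<in> A \<and> (\<lambda>y. u y * v y) \<in> A) \<and>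
     (\<forall>c. \<forall>u\<in>A. (\<lambda>y. c * u y) \<in> A) \<and>
     (\<forall>u\<in>A. (\<lambda>y. cnj (u y)) \<in> A) \<and>
     (\<forall>u. bcont u \<and> (\<forall>e>0. \<exists>a\<in>A. \<forall>y. cmod (u y - a y) \<le> e) \<longrightarrow> u \<in> A) \<and>
     (\<forall>u\<in>A. \<exists>m. has_mean u m)"

text \<open>Delta(A): nonzero continuous multiplicative linear functionals on A (extended by 0
  outside A). It carries the weak-* topology, i.e. the subspace topology of the product
  (pointwise) topology on the function type. The Gelfand transform of u \<in> A is s \<mapsto> s u.\<close>
definition spectrum_alg :: "(real^'n \<Rightarrow> complex) set \<Rightarrow> ((real^'n \<Rightarrow> complex) \<Rightarrow> complex) set" where
  "spectrum_alg A = {s.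
     (\<forall>u\<in>A. \<forall>v\<in>A. s (\<lambda>y. u y + v y) = s u + s v \<and> s (\<lambda>y. u y * v y) = s u * s v) \<and>
     (\<forall>c. \<forall>u\<in>A. s (\<lambda>y. c * u y) = c * s u) \<and>
     (\<exists>C. \<forall>u\<in>A. cmod (s u) \<le> C * (SUP y. cmod (u y))) \<and>
     (\<exists>u\<in>A. s u \<noteq> 0) \<and>
     (\<forall>u. u \<notin> A \<longrightarrow> s u = 0)}"

definition gelfand_measure :: "(real^'n \<Rightarrow> complex) set \<Rightarrow> ((real^'n \<Rightarrow> complex) \<Rightarrow> complex) measure \<Rightarrow> bool" where
  "gelfand_measure A \<beta> \<longleftrightarrow>
     prob_space \<beta> \<and> sets \<beta> = sets (restrict_space borel (spectrum_alg A)) \<and>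
     (\<forall>B\<in>sets \<beta>. emeasure \<beta> B = (SUP K \<in> {K. K \<subseteq> B \<and> compact K}. emeasure \<beta> K)) \<and>
     (\<forall>u\<in>A. integrable \<beta> (\<lambda>s. s u) \<and> (LINT s|\<beta>. s u) = mean_value u)"

definition test_fun :: "(real^'n) set \<Rightarrow> 'w measure \<Rightarrow> (real^'n \<Rightarrow> 'w \<Rightarrow> 'w) \<Rightarrow> (real^'n \<Rightarrow> complex) set
    \<Rightarrow> (real^'n \<Rightarrow> 'w \<Rightarrow> real^'n \<Rightarrow> complex) \<Rightarrow> bool" where
  "test_fun Q M T A f \<longleftrightarrow>
     (\<exists>(m::nat) \<phi> \<psi> a. (\<forall>k<m. smooth_compact_support Q (\<phi> k) \<and> stoch_smooth M T (\<psi> k) \<and> a k \<in> A) \<and>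
        (\<forall>x \<omega> y. f x \<omega> y = (\<Sum>k<m. \<phi> k x * \<psi> k \<omega> * a k y)))"

definition QOm :: "(real^'n) set \<Rightarrow> 'w measure \<Rightarrow> ((real^'n) \<times> 'w) measure" where
  "QOm Q M = restrict_space lborel Q \<Otimes>\<^sub>M M"

definition Lp :: "'a measure \<Rightarrow> real \<Rightarrow> ('a \<Rightarrow> complex) \<Rightarrow> bool" where
  "Lp N p u \<longleftrightarrow> u \<in> borel_measurable N \<and> integrable N (\<lambda>z. cmod (u z) powr p)"

definition Lp_norm :: "'a measure \<Rightarrow> real \<Rightarrow> ('a \<Rightarrow> complex) \<Rightarrow> real" where
  "Lp_norm N p u = (LINT z|N. cmod (u z) powr p) powr (1 / p)"

definition osc :: "(real^'n \<Rightarrow> 'w \<Rightarrow> 'w) \<Rightarrow> real \<Rightarrow> real \<Rightarrow> (real^'n \<Rightarrow> 'w \<Rightarrow> real^'n \<Rightarrow> complex)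
    \<Rightarrow> (real^'n) \<times> 'w \<Rightarrow> complex" where
  "osc T e1 e2 f z = f (fst z) (T ((1 / e1) *\<^sub>R fst z) (snd z)) ((1 / e2) *\<^sub>R fst z)"

text \<open>The limit is represented by U0 = G_1 \<circ> u0, a function on Q \<times> Omega \<times> Delta(A)
  (via the isometric isomorphism G_1 : B^p_A \<rightarrow> L^p(Delta(A))). The sequence u is indexed
  by n, with eps = e n ranging over the fundamental sequence E.\<close>
definition weak_stoch_sigma_conv ::
  "(real^'n) set \<Rightarrow> 'w measure \<Rightarrow> (real^'n \<Rightarrow> 'w \<Rightarrow> 'w) \<Rightarrow> (real^'n \<Rightarrow> complex) set
   \<Rightarrow> ((real^'n \<Rightarrow> complex) \<Rightarrow> complex) measure \<Rightarrow> (nat \<Rightarrow> real) \<Rightarrow> (real \<Rightarrow> real) \<Rightarrow> (real \<Rightarrow> real)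
   \<Rightarrow> real \<Rightarrow> (nat \<Rightarrow> (real^'n) \<times> 'w \<Rightarrow> complex)
   \<Rightarrow> (((real^'n) \<times> 'w) \<times> ((real^'n \<Rightarrow> complex) \<Rightarrow> complex) \<Rightarrow> complex) \<Rightarrow> bool" where
  "weak_stoch_sigma_conv Q M T A \<beta> e e1 e2 p u U0 \<longleftrightarrow>
     (\<forall>n. Lp (QOm Q M) p (u n)) \<and> (\<exists>C. \<forall>n. Lp_norm (QOm Q M) p (u n) \<le> C) \<and>
     Lp (QOm Q M \<Otimes>\<^sub>M \<beta>) p U0 \<and>
     (\<forall>f. test_fun Q M T A f \<longrightarrow>
        (\<lambda>n. LINT z|QOm Q M. u n z * osc T (e1 (e n)) (e2 (e n)) f z)
          \<longlonglongrightarrow> (LINT w|(QOm Q M \<Otimes>\<^sub>M \<beta>). U0 w * snd w (f (fst (fst w)) (snd (fst w)))))"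

definition strong_stoch_sigma_conv ::
  "(real^'n) set \<Rightarrow> 'w measure \<Rightarrow> (real^'n \<Rightarrow> 'w \<Rightarrow> 'w) \<Rightarrow> (real^'n \<Rightarrow> complex) set
   \<Rightarrow> ((real^'n \<Rightarrow> complex) \<Rightarrow> complex) measure \<Rightarrow> (nat \<Rightarrow> real) \<Rightarrow> (real \<Rightarrow> real) \<Rightarrow> (real \<Rightarrow> real)
   \<Rightarrow> real \<Rightarrow> (nat \<Rightarrow> (real^'n) \<times> 'w \<Rightarrow> complex)
   \<Rightarrow> (((real^'n) \<times> 'w) \<times> ((real^'n \<Rightarrow> complex) \<Rightarrow> complex) \<Rightarrow> complex) \<Rightarrow> bool" where
  "strong_stoch_sigma_conv Q M T A \<beta> e e1 e2 p u U0 \<longleftrightarrow>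
     weak_stoch_sigma_conv Q M T A \<beta> e e1 e2 p u U0 \<and>
     (\<lambda>n. Lp_norm (QOm Q M) p (u n)) \<longlonglongrightarrow> Lp_norm (QOm Q M \<Otimes>\<^sub>M \<beta>) p U0"

definition fundamental_seq :: "(nat \<Rightarrow> real) \<Rightarrow> bool" where
  "fundamental_seq e \<longleftrightarrow> (\<forall>n. 0 < e n \<and> e n \<le> 1) \<and> e \<longlonglongrightarrow> 0"

end

theory Submission
  imports Defs
begin

text \<open>
  Everything is measured by the modulars \<open>\<integral>|f|\<^sup>p\<close>, so Young's inequality replaces those of Hoelder
  and Minkowski. The map \<open>(x, \<omega>) \<mapsto> (x, T(x / \<epsilon>\<^sub>1) \<omega>)\<close> preserves the measure of \<open>Q \<times> \<Omega>\<close>; hence weak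
  convergence extends from test functions to all \<open>\<Phi>(x, \<omega>) a(y)\<close> with \<open>\<Phi>\<close> in the dual Lebesgue
  space and \<open>a \<in> A\<close>, once the test functions are known to be dense (bumps in \<open>x\<close>, mollification along
  the flow in \<open>\<omega>\<close>). For a simple function \<open>g\<close> with values in \<open>A\<close> the function \<open>|g|\<^sup>p\<close> is again of
  this kind, because \<open>A\<close> has a continuous functional calculus compatible with the Gelfand
  transformation; so the norms of the oscillating functions \<open>g\<^sup>\<epsilon>\<close> converge. By Stone-Weierstrass and
  regularity of \<open>\<beta>\<close> such \<open>g\<close> are dense in \<open>L\<^sup>p(Q \<times> \<Omega> \<times> \<Delta>(A))\<close>.

  Take \<open>g\<close> close to \<open>v\<^sub>0\<close> and \<open>h\<close> close to \<open>|v\<^sub>0|\<^sup>p\<^sup>-\<^sup>2\<close> times the conjugate of \<open>v\<^sub>0\<close>. Testing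
  \<open>(v\<^sub>\<epsilon> + g\<^sup>\<epsilon>) / 2\<close> against \<open>h\<^sup>\<epsilon>\<close> shows that its norm is asymptotically at least about that of \<open>v\<^sub>0\<close>, so
  uniform convexity and the convergence of norms make \<open>v\<^sub>\<epsilon> - g\<^sup>\<epsilon>\<close> small in \<open>L\<^sup>p\<close>. Replacing \<open>v\<^sub>\<epsilon>\<close> by
  \<open>g\<^sup>\<epsilon>\<close> in \<open>\<integral> u\<^sub>\<epsilon> v\<^sub>\<epsilon> f\<^sup>\<epsilon>\<close> reduces the claim to the weak convergence of \<open>u\<^sub>\<epsilon>\<close>.
\<close>

section \<open>Approximation in \<open>L\<^sup>p\<close>\<close>

text \<open>Two obstacles shape the proof. The limit v0 lives on Q \<times> Omega \<times> Delta(A),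
  only up to null sets, so it cannot be evaluated at x / eps; only approximants with values in A
  oscillate. And for p \<noteq> 2 the modular of v_eps - g^eps cannot be expanded into terms that
  weak convergence controls. What testing does control is a linear functional of the midpoint of
  v_eps and g^eps, hence a lower bound for its modular, and convexity turns that bound into
  closeness. The inequalities are kept soft: a bounded quantity with an arbitrarily small weight
  \<eta>, plus a constant C times a quantity that is made small. Hence a fixed order of choices:
  first \<eta>, then C, which depends on \<eta>, and last the accuracy of approximation, which must
  beat C. When 1/p + 1/q < 1, u_eps f^eps is given in \<open>L\<^sup>q\<close> with q larger than
  the exponent p' dual to p. Test functions vanish outside a set of finite measure, and this brings
  the product down to \<open>L\<^sup>p\<^sup>'\<close>.\<close>

lemma powr_add_le:
  fixes a b s :: real
  assumes "0 \<le> a" "0 \<le> b" "0 \<le> s"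
  shows "(a + b) powr s \<le> 2 powr s * (a powr s + b powr s)"
proof -
  have "(a + b) powr s \<le> (2 * max a b) powr s"
    using assms by (intro powr_mono2) auto
  also have "\<dots> = 2 powr s * (max a b) powr s"
    using assms by (simp add: powr_mult)
  also have "\<dots> \<le> 2 powr s * (a powr s + b powr s)"
    using assms by (intro mult_left_mono) (auto simp: max_def)
  finally show ?thesis .
qed

lemma cmod_add_powr_le:
  assumes "0 \<le> s"
  shows "cmod (a + b) powr s \<le> 2 powr s * (cmod a powr s + cmod b powr s)"
proof -
  have "cmod (a + b) powr s \<le> (cmod a + cmod b) powr s"
    using assms by (intro powr_mono2 norm_triangle_ineq) auto
  also have "\<dots> \<le> 2 powr s * (cmod a powr s + cmod b powr s)"
    using assms by (intro powr_add_le) auto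
  finally show ?thesis .
qed

lemma LpD:
  assumes "Lp N s f"
  shows "f \<in> borel_measurable N" "integrable N (\<lambda>z. cmod (f z) powr s)"
  using assms by (auto simp: Lp_def)

lemma Lp_bound:
  assumes "f \<in> borel_measurable N" "Lp N s g" "AE z in N. cmod (f z) \<le> cmod (g z)" "0 \<le> s"
  shows "Lp N s f"
  unfolding Lp_def
proof
  note [measurable] = assms(1)
  show "integrable N (\<lambda>z. cmod (f z) powr s)"
    by (rule Bochner_Integration.integrable_bound[OF LpD(2)[OF assms(2)]])
      (use assms in \<open>auto intro!: powr_mono2 elim!: eventually_mono\<close>)
qed (use assms in auto)

lemma Lp_add:
  assumes "Lp N s f" "Lp N s g" "0 \<le> s"
  shows "Lp N s (\<lambda>z. f z + g z)"
  unfolding Lp_def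
proof
  note [measurable] = LpD(1)[OF assms(1)] LpD(1)[OF assms(2)]
  show "(\<lambda>z. f z + g z) \<in> borel_measurable N" by measurable
  show "integrable N (\<lambda>z. cmod (f z + g z) powr s)"
    by (rule Bochner_Integration.integrable_bound[where
          f="\<lambda>z. 2 powr s * (cmod (f z) powr s + cmod (g z) powr s)"])
      (use assms in \<open>auto intro!: cmod_add_powr_le LpD(2)\<close>)
qed

lemma Lp_cmult:
  assumes "Lp N s f"
  shows "Lp N s (\<lambda>z. c * f z)"
  using assms by (auto simp: Lp_def norm_mult powr_mult)

lemma Lp_diff:
  assumes "Lp N s f" "Lp N s g" "0 \<le> s"
  shows "Lp N s (\<lambda>z. f z - g z)"
  using Lp_add[OF assms(1) Lp_cmult[OF assms(2), of "-1"] assms(3)] by simp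

lemma Lp_indicator:
  assumes "A \<in> sets N" "emeasure N A < \<infinity>" "0 < s"
  shows "Lp N s (indicator A)"
proof -
  have "(\<lambda>z. cmod (indicator A z) powr s) = indicator A"
    using assms by (auto simp: indicator_def)
  then show ?thesis
    using assms by (auto simp: Lp_def)
qed

lemma Lp_mult_bounded:
  assumes "Lp N s f" "g \<in> borel_measurable N" "AE z in N. cmod (g z) \<le> C" "0 \<le> s"
  shows "Lp N s (\<lambda>z. f z * g z)"
proof (rule Lp_bound[OF _ Lp_cmult[OF assms(1), of "of_real C"]])
  show "(\<lambda>z. f z * g z) \<in> borel_measurable N"
    using assms(2) LpD(1)[OF assms(1)] by measurable
  show "AE z in N. cmod (f z * g z) \<le> cmod (of_real C * f z)"
    using assms(3)
  proof eventually_elim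
    case (elim z)
    then have "cmod (g z) \<le> \<bar>C\<bar>" by linarith
    then show ?case by (simp add: norm_mult mult.commute[of "cmod (f z)"] mult_right_mono)
  qed
qed (use assms in auto)

text \<open>The substitute for the triangle inequality on modulars. Its factor
  \<open>2 powr s\<close> is harmless because it is known before any accuracy is chosen.\<close>

lemma integral_powr_add_le:
  assumes "Lp N s f" "Lp N s g" "0 \<le> s"
  shows "(LINT z|N. cmod (f z + g z) powr s)
    \<le> 2 powr s * ((LINT z|N. cmod (f z) powr s) + (LINT z|N. cmod (g z) powr s))"
proof -
  have "(LINT z|N. cmod (f z + g z) powr s)
      \<le> (LINT z|N. 2 powr s * (cmod (f z) powr s + cmod (g z) powr s))"
    using assms
    by (intro integral_mono LpD(2)[OF Lp_add] cmod_add_powr_le) (auto intro: LpD)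
  also have "\<dots> = 2 powr s * ((LINT z|N. cmod (f z) powr s) + (LINT z|N. cmod (g z) powr s))"
    using LpD(2)[OF assms(1)] LpD(2)[OF assms(2)] by simp
  finally show ?thesis .
qed

text \<open>The approximant is required to satisfy \<open>Lp N s d\<close> because D may contain
  functions that are not s-integrable, and because the integral of a non-integrable function is 0,
  so that the bound alone could hold for no good reason.\<close>

definition Lp_closure :: "'a measure \<Rightarrow> real \<Rightarrow> ('a \<Rightarrow> complex) set \<Rightarrow> ('a \<Rightarrow> complex) set" where
  "Lp_closure N s D = {f. Lp N s f \<and>
     (\<forall>\<delta>>0. \<exists>d\<in>D. Lp N s d \<and> (LINT z|N. cmod (f z - d z) powr s) < \<delta>)}"

definition lin_closed :: "('a \<Rightarrow> complex) set \<Rightarrow> bool" where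
  "lin_closed D \<longleftrightarrow> (\<lambda>_. 0) \<in> D \<and> (\<forall>f\<in>D. \<forall>g\<in>D. (\<lambda>z. f z + g z) \<in> D) \<and> (\<forall>c. \<forall>f\<in>D. (\<lambda>z. c * f z) \<in> D)"

lemma Lp_closureD:
  assumes "f \<in> Lp_closure N s D"
  shows "Lp N s f"
  using assms by (auto simp: Lp_closure_def)

lemma Lp_closureE:
  assumes "f \<in> Lp_closure N s D" "0 < \<delta>"
  obtains d where "d \<in> D" "Lp N s d" "(LINT z|N. cmod (f z - d z) powr s) < \<delta>"
  using assms by (auto simp: Lp_closure_def)

lemma Lp_closure_base:
  assumes "f \<in> D" "Lp N s f"
  shows "f \<in> Lp_closure N s D"
  using assms by (auto simp: Lp_closure_def intro!: bexI[of _ f])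

text \<open>Idempotence of the closure. It allows density to be proved in stages, each approximating
  by elements of the closure only.\<close>

lemma Lp_closure_closed:
  assumes "Lp N s f" "0 \<le> s"
    and "\<And>\<delta>. 0 < \<delta> \<Longrightarrow> \<exists>g\<in>Lp_closure N s D. (LINT z|N. cmod (f z - g z) powr s) < \<delta>"
  shows "f \<in> Lp_closure N s D"
  unfolding Lp_closure_def
proof safe
  fix \<delta> :: real assume "0 < \<delta>"
  \<comment> \<open>Two errors below \<eta>, multiplied by the factor \<open>2 powr s\<close> of
    \<open>integral_powr_add_le\<close>, add up to \<delta>.\<close>
  define \<eta> where "\<eta> = \<delta> / (2 * 2 powr s)"
  have "\<eta> > 0" using \<open>0 < \<delta>\<close> by (simp add: \<eta>_def)
  obtain g where g: "g \<in> Lp_closure N s D" "(LINT z|N. cmod (f z - g z) powr s) < \<eta>"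
    using assms(3)[OF \<open>\<eta> > 0\<close>] by auto
  obtain d where d: "d \<in> D" "Lp N s d" "(LINT z|N. cmod (g z - d z) powr s) < \<eta>"
    using Lp_closureE[OF g(1) \<open>\<eta> > 0\<close>] .
  have "(LINT z|N. cmod ((f z - g z) + (g z - d z)) powr s)
     \<le> 2 powr s * ((LINT z|N. cmod (f z - g z) powr s) + (LINT z|N. cmod (g z - d z) powr s))"
    using assms d g by (intro integral_powr_add_le Lp_diff) (auto dest: Lp_closureD)
  also have "\<dots> < 2 powr s * (\<eta> + \<eta>)"
    using d g by (intro mult_strict_left_mono) auto
  also have "\<dots> = \<delta>" by (simp add: \<eta>_def)
  finally show "\<exists>d\<in>D. Lp N s d \<and> (LINT z|N. cmod (f z - d z) powr s) < \<delta>"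
    using d by auto
qed (use assms in auto)

lemma lin_closed_Lp_closure:
  assumes "lin_closed D" "0 < s"
  shows "lin_closed (Lp_closure N s D)"
  unfolding lin_closed_def
proof safe
  show "(\<lambda>_. 0) \<in> Lp_closure N s D"
    using assms by (intro Lp_closure_base) (auto simp: lin_closed_def Lp_def)
next
  fix f g assume f: "f \<in> Lp_closure N s D" and g: "g \<in> Lp_closure N s D"
  show "(\<lambda>z. f z + g z) \<in> Lp_closure N s D"
    unfolding Lp_closure_def
  proof safe
    fix \<delta> :: real assume "0 < \<delta>"
    define \<eta> where "\<eta> = \<delta> / (2 * 2 powr s)"
    have "\<eta> > 0" using \<open>0 < \<delta>\<close> by (simp add: \<eta>_def)
    obtain d where d: "d \<in> D" "Lp N s d" "(LINT z|N. cmod (f z - d z) powr s) < \<eta>"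
      using Lp_closureE[OF f \<open>\<eta> > 0\<close>] .
    obtain d' where d': "d' \<in> D" "Lp N s d'" "(LINT z|N. cmod (g z - d' z) powr s) < \<eta>"
      using Lp_closureE[OF g \<open>\<eta> > 0\<close>] .
    have "(LINT z|N. cmod ((f z - d z) + (g z - d' z)) powr s)
       \<le> 2 powr s * ((LINT z|N. cmod (f z - d z) powr s) + (LINT z|N. cmod (g z - d' z) powr s))"
      using assms d d' f g by (intro integral_powr_add_le Lp_diff) (auto dest: Lp_closureD)
    also have "\<dots> < 2 powr s * (\<eta> + \<eta>)"
      using d d' by (intro mult_strict_left_mono) auto
    also have "\<dots> = \<delta>" by (simp add: \<eta>_def)
    finally show "\<exists>d\<in>D. Lp N s d \<and> (LINT z|N. cmod (f z + g z - d z) powr s) < \<delta>"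
      using d d' assms
      by (intro bexI[of _ "\<lambda>z. d z + d' z"]) (auto simp: lin_closed_def add_diff_add intro: Lp_add)
  qed (use f g assms in \<open>auto intro!: Lp_add dest: Lp_closureD\<close>)
next
  fix c f assume f: "f \<in> Lp_closure N s D"
  show "(\<lambda>z. c * f z) \<in> Lp_closure N s D"
    unfolding Lp_closure_def
  proof safe
    fix \<delta> :: real assume "0 < \<delta>"
    define \<eta> where "\<eta> = \<delta> / (cmod c powr s + 1)"
    have pos: "cmod c powr s + 1 > 0" by (simp add: add_nonneg_pos)
    have "\<eta> > 0" using \<open>0 < \<delta>\<close> pos by (simp add: \<eta>_def)
    obtain d where d: "d \<in> D" "Lp N s d" "(LINT z|N. cmod (f z - d z) powr s) < \<eta>"
      using Lp_closureE[OF f \<open>\<eta> > 0\<close>] .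
    have "(LINT z|N. cmod (c * f z - c * d z) powr s) = cmod c powr s * (LINT z|N. cmod (f z - d z) powr s)"
      by (simp flip: right_diff_distrib add: norm_mult powr_mult)
    also have "\<dots> \<le> cmod c powr s * \<eta>"
      using d by (intro mult_left_mono) auto
    also have "\<dots> < \<delta>"
      using pos \<open>0 < \<delta>\<close> unfolding \<eta>_def by (simp add: field_simps)
    finally show "\<exists>d\<in>D. Lp N s d \<and> (LINT z|N. cmod (c * f z - d z) powr s) < \<delta>"
      using d assms
      by (intro bexI[of _ "\<lambda>z. c * d z"]) (auto simp: lin_closed_def intro: Lp_cmult)
  qed (use f in \<open>auto intro!: Lp_cmult dest: Lp_closureD\<close>)
qed

lemma lin_closedD:
  assumes "lin_closed D"
  shows "(\<lambda>_. 0) \<in> D" "f \<in> D \<Longrightarrow> g \<in> D \<Longrightarrow> (\<lambda>z. f z + g z) \<in> D"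
    "f \<in> D \<Longrightarrow> (\<lambda>z. c * f z) \<in> D"
  using assms by (auto simp: lin_closed_def)

lemma lin_closed_diff:
  assumes "lin_closed D" "f \<in> D" "g \<in> D"
  shows "(\<lambda>z. f z - g z) \<in> D"
  using lin_closedD(2)[OF assms(1,2) lin_closedD(3)[OF assms(1,3), of "-1"]] by simp

lemma lin_closed_sum:
  assumes "lin_closed D" "finite I" "\<And>i. i \<in> I \<Longrightarrow> f i \<in> D"
  shows "(\<lambda>z. \<Sum>i\<in>I. f i z) \<in> D"
  using assms(2,3)
  by (induction I rule: finite_induct) (auto intro: lin_closedD[OF assms(1)])

text \<open>Dominated convergence for the s-th power of |f - F i|, with majorant
  \<open>2 powr s\<close> times the sum of the powers of |f| and |g|. This carries the closure from
  bumps to boxes and from finite to countable disjoint unions.\<close>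

lemma Lp_closure_limit:
  assumes F: "\<And>i. F i \<in> Lp_closure N s D" and s: "0 < s"
    and f: "Lp N s f" and g: "Lp N s g"
    and lim: "AE z in N. (\<lambda>i. F i z) \<longlonglongrightarrow> f z"
    and bound: "\<And>i. AE z in N. cmod (F i z) \<le> cmod (g z)"
  shows "f \<in> Lp_closure N s D"
proof (rule Lp_closure_closed[OF f])
  fix \<delta> :: real assume "0 < \<delta>"
  have [measurable]: "\<And>i. F i \<in> borel_measurable N" "f \<in> borel_measurable N" "g \<in> borel_measurable N"
    using F f g by (auto dest: Lp_closureD LpD)
  have "(\<lambda>i. LINT z|N. cmod (f z - F i z) powr s) \<longlonglongrightarrow> (LINT z|N. 0)"
  proof (rule integral_dominated_convergence[where
        w="\<lambda>z. 2 powr s * (cmod (f z) powr s + cmod (g z) powr s)"])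
    show "integrable N (\<lambda>z. 2 powr s * (cmod (f z) powr s + cmod (g z) powr s))"
      using f g by (auto dest: LpD)
    show "AE z in N. (\<lambda>i. cmod (f z - F i z) powr s) \<longlonglongrightarrow> 0"
      using lim
    proof eventually_elim
      case (elim z)
      then have "(\<lambda>i. cmod (f z - F i z)) \<longlonglongrightarrow> cmod (f z - f z)"
        by (intro tendsto_intros)
      then show ?case
        using tendsto_powr'[of "\<lambda>i. cmod (f z - F i z)" 0 sequentially "\<lambda>_. s" s] s by simp
    qed
    show "AE z in N. norm (cmod (f z - F i z) powr s) \<le> 2 powr s * (cmod (f z) powr s + cmod (g z) powr s)" for i
      using bound[of i]
    proof eventually_elim
      case (elim z)
      have "cmod (f z - F i z) powr s \<le> 2 powr s * (cmod (f z) powr s + cmod (F i z) powr s)"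
        using cmod_add_powr_le[of s "f z" "- F i z"] s by simp
      also have "\<dots> \<le> 2 powr s * (cmod (f z) powr s + cmod (g z) powr s)"
        using elim s by (intro mult_left_mono add_left_mono powr_mono2) auto
      finally show ?case by simp
    qed
  qed (auto)
  then have "\<forall>\<^sub>F i in sequentially. (LINT z|N. cmod (f z - F i z) powr s) < \<delta>"
    using \<open>0 < \<delta>\<close> by (auto dest: order_tendstoD)
  then obtain i where "(LINT z|N. cmod (f z - F i z) powr s) < \<delta>"
    by (auto simp: eventually_sequentially)
  then show "\<exists>g\<in>Lp_closure N s D. (LINT z|N. cmod (f z - g z) powr s) < \<delta>"
    using F by auto
qed (use s in auto)

lemma Lp_in_closure:
  assumes D: "lin_closed D" and s: "0 < s"
    and ind: "\<And>A. A \<in> sets N \<Longrightarrow> emeasure N A < \<infinity> \<Longrightarrow> indicator A \<in> Lp_closure N s D"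
    and f: "Lp N s f"
  shows "f \<in> Lp_closure N s D"
proof -
  note cl = lin_closed_Lp_closure[OF D s, of N]
  obtain F where F: "\<And>i. simple_function N (F i)"
    and lim: "\<And>z. z \<in> space N \<Longrightarrow> (\<lambda>i. F i z) \<longlonglongrightarrow> f z"
    and bd: "\<And>i z. z \<in> space N \<Longrightarrow> dist (F i z) 0 \<le> 2 * dist (f z) 0"
    using borel_measurable_implies_sequence_metric[OF LpD(1)[OF f], of 0] by blast
  have bd': "cmod (F i z) \<le> cmod (2 * f z)" if "z \<in> space N" for i z
    using bd[OF that, of i] by (simp add: norm_mult)
  have LF: "Lp N s (F i)" for i
    using bd'[of _ i] s
    by (intro Lp_bound[OF _ Lp_cmult[OF f, of 2]]) (auto intro: borel_measurable_simple_function F)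
  show ?thesis
  proof (rule Lp_closure_limit[where F=F and g="\<lambda>z. 2 * f z"])
    fix i
    \<comment> \<open>The value 0 is left out because its level set may have infinite
      measure.\<close>
    define R where "R = F i ` space N - {0}"
    have "finite R" using F[of i] by (auto simp: R_def simple_function_def)
    define H where "H z = (\<Sum>c\<in>R. c * indicator (F i -` {c} \<inter> space N) z)" for z
    have "H \<in> Lp_closure N s D"
      unfolding H_def
    proof (intro lin_closed_sum[OF cl \<open>finite R\<close>] lin_closedD(3)[OF cl] ind)
      fix c assume c: "c \<in> R"
      show *: "F i -` {c} \<inter> space N \<in> sets N"
        using F[of i] by (rule simple_functionD)
      have "c \<noteq> 0" using c by (auto simp: R_def)
      \<comment> \<open>Chebyshev: this function equals 1 on the level set of c, so it dominates the
        indicator of that set.\<close>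
      have "integrable N (\<lambda>z. (1 / cmod c powr s) * cmod (F i z) powr s)"
        using LpD(2)[OF LF[of i]] by simp
      then have "integrable N (indicator (F i -` {c} \<inter> space N) :: _ \<Rightarrow> real)"
        by (rule Bochner_Integration.integrable_bound) (use * \<open>c \<noteq> 0\<close> in \<open>auto simp: indicator_def\<close>)
      then show "emeasure N (F i -` {c} \<inter> space N) < \<infinity>"
        using * by (simp add: integrable_indicator_iff Int_absorb2 sets.sets_into_space)
    qed
    moreover have HF: "H z = F i z" if "z \<in> space N" for z
    proof (cases "F i z = 0")
      case True
      then show ?thesis by (auto simp: H_def R_def indicator_def intro!: sum.neutral)
    next
      case False
      have "H z = (\<Sum>c\<in>{F i z}. c * indicator (F i -` {c} \<inter> space N) z)"
        unfolding H_def using False that \<open>finite R\<close>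
        by (intro sum.mono_neutral_right) (auto simp: R_def indicator_def)
      then show ?thesis using that by simp
    qed
    ultimately show "F i \<in> Lp_closure N s D"
      using LF[of i] unfolding Lp_closure_def
      by (simp add: HF cong: Bochner_Integration.integral_cong)
  qed (use LF lim bd' f s in \<open>auto intro!: Lp_cmult\<close>)
qed

text \<open>A Dynkin class argument, localized because N may be infinite and complements of sets of
  finite measure then leave the class: for a fixed generator E the induction runs over the sets B
  \<inter> E. Afterwards A is cut into countably many disjoint pieces, each inside one member of the
  exhausting sequence U.\<close>

lemma indicator_in_Lp_closure:
  fixes U :: "nat \<Rightarrow> 'a set"
  assumes D: "lin_closed D" and s: "0 < s"
    and G: "Int_stable G" "G \<subseteq> Pow (space N)" "sets N = sigma_sets (space N) G"
    and Gcl: "\<And>B. B \<in> G \<Longrightarrow> emeasure N B < \<infinity> \<and> indicator B \<in> Lp_closure N s D"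
    and U: "range U \<subseteq> G" "(\<Union>i. U i) = space N"
    and A: "A \<in> sets N" "emeasure N A < \<infinity>"
  shows "indicator A \<in> Lp_closure N s D"
proof -
  note cl = lin_closed_Lp_closure[OF D s, of N]
  have GN: "G \<subseteq> sets N" using G by (auto intro: sigma_sets.Basic)
  have step: "indicator (B \<inter> E) \<in> Lp_closure N s D" if "B \<in> sets N" "E \<in> G" for B E
  proof -
    have E: "E \<in> sets N" "emeasure N E < \<infinity>" using that GN Gcl by auto
    have "B \<in> sigma_sets (space N) G" using that G by simp
    then show ?thesis
    proof (induction rule: sigma_sets_induct_disjoint[OF G(1,2), consumes 1])
      case (1 B)
      then show ?case using G(1) that Gcl by (auto simp: Int_stable_def)
    next
      case 2
      then show ?case using lin_closedD(1)[OF cl] by (simp add: indicator_def)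
    next
      case (3 B)
      have "(\<lambda>z. indicator E z - indicator (B \<inter> E) z) \<in> Lp_closure N s D"
        using 3 that Gcl by (intro lin_closed_diff[OF cl]) auto
      also have "(\<lambda>z. indicator E z - indicator (B \<inter> E) z) = (indicator ((space N - B) \<inter> E) :: 'a \<Rightarrow> complex)"
        using sets.sets_into_space[OF E(1)] by (auto simp: indicator_def fun_eq_iff)
      finally show ?case .
    next
      case (4 B)
      have B: "\<And>i. B i \<in> sets N" using 4 G by auto
      show ?case
      proof (rule Lp_closure_limit[where F="\<lambda>i z. \<Sum>j<i. indicator (B j \<inter> E) z" and g="indicator E"])
        show "(\<lambda>z. \<Sum>j<i. indicator (B j \<inter> E) z) \<in> Lp_closure N s D" for i
          using 4 by (intro lin_closed_sum[OF cl]) auto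
        have *: "(\<Sum>j<i. indicator (B j \<inter> E) z) = (indicator (\<Union>j<i. B j \<inter> E) z :: complex)" for i z
        proof (rule indicator_UN_disjoint[symmetric])
          show "disjoint_family_on (\<lambda>j. B j \<inter> E) {..<i}"
            using 4 by (auto simp: disjoint_family_on_def)
        qed auto
        show "AE z in N. cmod (\<Sum>j<i. indicator (B j \<inter> E) z) \<le> cmod (indicator E z)" for i
          unfolding * by (auto simp: indicator_def)
        have "(\<lambda>i. indicator (\<Union>j<i. B j \<inter> E) z :: complex) \<longlonglongrightarrow> indicator (\<Union>j. B j \<inter> E) z" for z
          by (rule LIMSEQ_indicator_UN)
        then show "AE z in N. (\<lambda>i. \<Sum>j<i. indicator (B j \<inter> E) z) \<longlonglongrightarrow> (indicator (\<Union> (range B) \<inter> E) z :: complex)"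
          unfolding * by simp
        have "emeasure N (\<Union> (range B) \<inter> E) \<le> emeasure N E"
          using E by (intro emeasure_mono) auto
        also have "\<dots> < \<infinity>" using E by simp
        finally show "Lp N s (indicator (\<Union> (range B) \<inter> E))"
          using B E s by (intro Lp_indicator) auto
        show "Lp N s (indicator E)" using E s by (intro Lp_indicator)
      qed (use s in auto)
    qed
  qed
  define W where "W i = A \<inter> disjointed U i" for i
  have Us: "U i \<in> G" "U i \<in> sets N" for i using U GN by auto
  then have "range U \<subseteq> sets N" by auto
  then have dU: "disjointed U i \<in> sets N" for i
    using sets.range_disjointed_sets by blast
  have Wcl: "indicator (W i) \<in> Lp_closure N s D" for i
  proof -
    have "W i = (A \<inter> disjointed U i) \<inter> U i"
      using disjointed_subset[of U i] by (auto simp: W_def)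
    then show ?thesis using step[of "A \<inter> disjointed U i" "U i"] A dU Us by auto
  qed
  have WA: "(\<Union>i. W i) = A"
    using UN_disjointed_eq[of U] U(2) sets.sets_into_space[OF A(1)] by (auto simp: W_def)
  show ?thesis
  proof (rule Lp_closure_limit[where F="\<lambda>i z. \<Sum>j<i. indicator (W j) z" and g="indicator A"])
    show "(\<lambda>z. \<Sum>j<i. indicator (W j) z) \<in> Lp_closure N s D" for i
      using Wcl by (intro lin_closed_sum[OF cl]) auto
    have *: "(\<Sum>j<i. indicator (W j) z) = (indicator (\<Union>j<i. W j) z :: complex)" for i z
    proof (rule indicator_UN_disjoint[symmetric])
      show "disjoint_family_on W {..<i}"
        using disjoint_family_disjointed[of U] by (auto simp: disjoint_family_on_def W_def)
    qed auto
    show "AE z in N. cmod (\<Sum>j<i. indicator (W j) z) \<le> cmod (indicator A z)" for i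
      unfolding * using WA by (auto simp: indicator_def)
    have "(\<lambda>i. indicator (\<Union>j<i. W j) z :: complex) \<longlonglongrightarrow> indicator (\<Union>j. W j) z" for z
      by (rule LIMSEQ_indicator_UN)
    then show "AE z in N. (\<lambda>i. \<Sum>j<i. indicator (W j) z) \<longlonglongrightarrow> (indicator A z :: complex)"
      unfolding * WA by simp
    show "Lp N s (indicator A)" using A s by (intro Lp_indicator)
    show "Lp N s (indicator A)" using A s by (intro Lp_indicator)
  qed (use s in auto)
qed

section \<open>Density in product spaces\<close>

lemma Lp_tensor:
  assumes "sigma_finite_measure M1" "sigma_finite_measure M2"
    and f: "Lp M1 s f" and g: "Lp M2 s g"
  shows "Lp (M1 \<Otimes>\<^sub>M M2) s (\<lambda>(x, y). f x * g y)"
    and "(LINT z|(M1 \<Otimes>\<^sub>M M2). cmod (case z of (x, y) \<Rightarrow> f x * g y) powr s)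
      = (LINT x|M1. cmod (f x) powr s) * (LINT y|M2. cmod (g y) powr s)"
proof -
  interpret M1: sigma_finite_measure M1 by fact
  interpret M2: sigma_finite_measure M2 by fact
  interpret pair_sigma_finite M1 M2 ..
  note [measurable] = LpD(1)[OF f] LpD(1)[OF g]
  have int: "integrable (M1 \<Otimes>\<^sub>M M2) (\<lambda>(x, y). cmod (f x) powr s * cmod (g y) powr s)"
    using LpD(2)[OF f] LpD(2)[OF g] by (intro Fubini_integrable) auto
  have eq: "cmod (case z of (x, y) \<Rightarrow> f x * g y) powr s = (case z of (x, y) \<Rightarrow> cmod (f x) powr s * cmod (g y) powr s)" for z
    by (auto simp: norm_mult powr_mult split: prod.split)
  show "Lp (M1 \<Otimes>\<^sub>M M2) s (\<lambda>(x, y). f x * g y)"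
    unfolding Lp_def eq using int by auto
  show "(LINT z|(M1 \<Otimes>\<^sub>M M2). cmod (case z of (x, y) \<Rightarrow> f x * g y) powr s)
      = (LINT x|M1. cmod (f x) powr s) * (LINT y|M2. cmod (g y) powr s)"
    unfolding eq using integral_fst'[OF int] by simp
qed

text \<open>The factors are replaced one at a time. The modular of a tensor product is the product
  of the modulars, so each error is multiplied by the modular a of the factor kept fixed; accuracy
  \<delta> / (a + 1) suffices and makes sense for a = 0.\<close>

lemma Lp_closure_tensor:
  assumes M1: "sigma_finite_measure M1" and M2: "sigma_finite_measure M2" and s: "0 < s"
    and f: "f \<in> Lp_closure M1 s D1" and g: "g \<in> Lp_closure M2 s D2"
    and D: "\<And>d1 d2. d1 \<in> D1 \<Longrightarrow> d2 \<in> D2 \<Longrightarrow> (\<lambda>(x, y). d1 x * d2 y) \<in> D"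
  shows "(\<lambda>(x, y). f x * g y) \<in> Lp_closure (M1 \<Otimes>\<^sub>M M2) s D"
proof -
  have small: "a * (\<delta> / (a + 1)) < \<delta>" if "0 \<le> a" "0 < \<delta>" for a \<delta> :: real
    using that by (simp add: field_simps)
  have nn: "0 \<le> (LINT x|N. cmod (h x) powr s)" for N and h :: "'z \<Rightarrow> complex"
    by simp
  have step: "(\<lambda>(x, y). d x * g y) \<in> Lp_closure (M1 \<Otimes>\<^sub>M M2) s D" if d: "d \<in> D1" "Lp M1 s d" for d
    unfolding Lp_closure_def
  proof safe
    show "Lp (M1 \<Otimes>\<^sub>M M2) s (\<lambda>(x, y). d x * g y)"
      by (intro Lp_tensor M1 M2 d Lp_closureD[OF g])
    fix \<delta> :: real assume "0 < \<delta>"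
    let ?a = "LINT x|M1. cmod (d x) powr s"
    have "0 < \<delta> / (?a + 1)" using \<open>0 < \<delta>\<close> nn[of M1 d] by (simp add: add_nonneg_pos)
    then obtain d2 where d2: "d2 \<in> D2" "Lp M2 s d2" "(LINT z|M2. cmod (g z - d2 z) powr s) < \<delta> / (?a + 1)"
      using Lp_closureE[OF g] by metis
    have "(LINT z|(M1 \<Otimes>\<^sub>M M2). cmod (case z of (x, y) \<Rightarrow> d x * (g y - d2 y)) powr s)
        = ?a * (LINT y|M2. cmod (g y - d2 y) powr s)"
      using s by (intro Lp_tensor M1 M2 d d2 Lp_diff Lp_closureD[OF g]) auto
    also have "\<dots> \<le> ?a * (\<delta> / (?a + 1))"
      using d2 by (intro mult_left_mono) auto
    also have "\<dots> < \<delta>" using nn[of M1 d] \<open>0 < \<delta>\<close> by (intro small)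
    finally have "(LINT z|(M1 \<Otimes>\<^sub>M M2). cmod ((case z of (x, y) \<Rightarrow> d x * g y) - (case z of (x, y) \<Rightarrow> d x * d2 y)) powr s) < \<delta>"
      by (simp add: split_beta right_diff_distrib)
    then show "\<exists>h\<in>D. Lp (M1 \<Otimes>\<^sub>M M2) s h \<and>
        (LINT z|(M1 \<Otimes>\<^sub>M M2). cmod ((case z of (x, y) \<Rightarrow> d x * g y) - h z) powr s) < \<delta>"
      using D[OF d(1) d2(1)] Lp_tensor(1)[OF M1 M2 d(2) d2(2)] by (intro bexI) auto
  qed
  show ?thesis
  proof (rule Lp_closure_closed)
    show "Lp (M1 \<Otimes>\<^sub>M M2) s (\<lambda>(x, y). f x * g y)"
      by (intro Lp_tensor M1 M2 Lp_closureD[OF f] Lp_closureD[OF g])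
    fix \<delta> :: real assume "0 < \<delta>"
    let ?a = "LINT x|M2. cmod (g x) powr s"
    have "0 < \<delta> / (?a + 1)" using \<open>0 < \<delta>\<close> nn[of M2 g] by (simp add: add_nonneg_pos)
    then obtain d where d: "d \<in> D1" "Lp M1 s d" "(LINT z|M1. cmod (f z - d z) powr s) < \<delta> / (?a + 1)"
      using Lp_closureE[OF f] by metis
    have "(LINT z|(M1 \<Otimes>\<^sub>M M2). cmod (case z of (x, y) \<Rightarrow> (f x - d x) * g y) powr s)
        = (LINT y|M1. cmod (f y - d y) powr s) * ?a"
      using s by (intro Lp_tensor M1 M2 d Lp_diff Lp_closureD[OF f] Lp_closureD[OF g]) auto
    also have "\<dots> \<le> ?a * (\<delta> / (?a + 1))"
      unfolding mult.commute[of _ ?a] using d by (intro mult_left_mono) auto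
    also have "\<dots> < \<delta>" using nn[of M2 g] \<open>0 < \<delta>\<close> by (intro small)
    finally have "(LINT z|(M1 \<Otimes>\<^sub>M M2). cmod ((case z of (x, y) \<Rightarrow> f x * g y) - (case z of (x, y) \<Rightarrow> d x * g y)) powr s) < \<delta>"
      by (simp add: split_beta left_diff_distrib)
    then show "\<exists>h\<in>Lp_closure (M1 \<Otimes>\<^sub>M M2) s D.
        (LINT z|(M1 \<Otimes>\<^sub>M M2). cmod ((case z of (x, y) \<Rightarrow> f x * g y) - h z) powr s) < \<delta>"
      using step[OF d(1,2)] by (intro bexI) auto
  qed (use s in auto)
qed

text \<open>\<open>indicator_in_Lp_closure\<close> asks for generators of finite measure. Here the
  second factor will be a finite measure, so only the first side of a rectangle has to be
  restricted.\<close>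

lemma sets_pair_finite_rectangles:
  assumes "sigma_finite_measure M1"
  shows "sets (M1 \<Otimes>\<^sub>M M2) = sigma_sets (space (M1 \<Otimes>\<^sub>M M2))
    {B \<times> C |B C. B \<in> sets M1 \<and> emeasure M1 B < \<infinity> \<and> C \<in> sets M2}" (is "_ = sigma_sets ?X ?G")
proof
  interpret sigma_finite_measure M1 by fact
  obtain E :: "nat \<Rightarrow> _" where E: "range E \<subseteq> sets M1" "(\<Union>i. E i) = space M1" "\<And>i. emeasure M1 (E i) \<noteq> \<infinity>"
    using sigma_finite by metis
  have "B \<times> C \<in> sigma_sets ?X ?G" if "B \<in> sets M1" "C \<in> sets M2" for B C
  proof -
    have "emeasure M1 (B \<inter> E i) < \<infinity>" for i
      using le_less_trans[OF emeasure_mono[of "B \<inter> E i" "E i" M1]] E(1) E(3)[of i]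
      by (auto simp: less_top)
    then have "(B \<inter> E i) \<times> C \<in> sigma_sets ?X ?G" for i
      using that E(1) by (intro sigma_sets.Basic CollectI exI[of _ "B \<inter> E i"] exI[of _ C]) auto
    then have "(\<Union>i. (B \<inter> E i) \<times> C) \<in> sigma_sets ?X ?G"
      by (rule sigma_sets.Union)
    moreover have "(\<Union>i. (B \<inter> E i) \<times> C) = B \<times> C"
      using E(2) sets.sets_into_space[OF that(1)] by auto
    ultimately show ?thesis by simp
  qed
  then show "sets (M1 \<Otimes>\<^sub>M M2) \<subseteq> sigma_sets ?X ?G"
    unfolding sets_pair_measure space_pair_measure by (intro sigma_sets_mono) auto
  show "sigma_sets ?X ?G \<subseteq> sets (M1 \<Otimes>\<^sub>M M2)"
    by (intro sets.sigma_sets_subset) auto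
qed

text \<open>Serves twice: for Q \<times> Omega with smooth functions as factors, and for (Q \<times>
  Omega) \<times> Delta(A) with indicators and Gelfand transforms as factors.\<close>

lemma Lp_in_closure_pair:
  assumes M1: "sigma_finite_measure M1" and M2: "finite_measure M2" and s: "0 < s"
    and D: "lin_closed D" "\<And>d1 d2. d1 \<in> D1 \<Longrightarrow> d2 \<in> D2 \<Longrightarrow> (\<lambda>(x, y). d1 x * d2 y) \<in> D"
    and D1: "\<And>B. B \<in> sets M1 \<Longrightarrow> emeasure M1 B < \<infinity> \<Longrightarrow> indicator B \<in> Lp_closure M1 s D1"
    and D2: "\<And>C. C \<in> sets M2 \<Longrightarrow> indicator C \<in> Lp_closure M2 s D2"
    and f: "Lp (M1 \<Otimes>\<^sub>M M2) s f"
  shows "f \<in> Lp_closure (M1 \<Otimes>\<^sub>M M2) s D"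
proof (rule Lp_in_closure[OF D(1) s _ f])
  interpret M1: sigma_finite_measure M1 by fact
  interpret M2: finite_measure M2 by fact
  obtain E :: "nat \<Rightarrow> _" where E: "range E \<subseteq> sets M1" "(\<Union>i. E i) = space M1" "\<And>i. emeasure M1 (E i) \<noteq> \<infinity>"
    using M1.sigma_finite by metis
  let ?G = "{B \<times> C |B C. B \<in> sets M1 \<and> emeasure M1 B < \<infinity> \<and> C \<in> sets M2}"
  fix A assume A: "A \<in> sets (M1 \<Otimes>\<^sub>M M2)" "emeasure (M1 \<Otimes>\<^sub>M M2) A < \<infinity>"
  show "indicator A \<in> Lp_closure (M1 \<Otimes>\<^sub>M M2) s D"
  proof (rule indicator_in_Lp_closure[OF D(1) s _ _ sets_pair_finite_rectangles[OF M1] _ _ _ A])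
    show "Int_stable ?G"
      unfolding Int_stable_def
    proof safe
      fix B C B' C' assume *: "B \<in> sets M1" "emeasure M1 B < \<infinity>" "C \<in> sets M2"
        "B' \<in> sets M1" "emeasure M1 B' < \<infinity>" "C' \<in> sets M2"
      have "emeasure M1 (B \<inter> B') < \<infinity>"
        using le_less_trans[OF emeasure_mono[of "B \<inter> B'" B M1]] * by auto
      then show "\<exists>B'' C''. B \<times> C \<inter> B' \<times> C' = B'' \<times> C'' \<and> B'' \<in> sets M1 \<and> emeasure M1 B'' < \<infinity> \<and> C'' \<in> sets M2"
        using * by (intro exI[of _ "B \<inter> B'"] exI[of _ "C \<inter> C'"]) auto
    qed
    show "?G \<subseteq> Pow (space (M1 \<Otimes>\<^sub>M M2))"
      by (auto simp: space_pair_measure dest: sets.sets_into_space)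
    show "range (\<lambda>i. E i \<times> space M2) \<subseteq> ?G"
    proof safe
      fix i show "\<exists>B C. E i \<times> space M2 = B \<times> C \<and> B \<in> sets M1 \<and> emeasure M1 B < \<infinity> \<and> C \<in> sets M2"
        using E(1) E(3)[of i] by (intro exI[of _ "E i"] exI[of _ "space M2"]) (auto simp: less_top)
    qed
    show "(\<Union>i. E i \<times> space M2) = space (M1 \<Otimes>\<^sub>M M2)"
      using E(2) by (auto simp: space_pair_measure)
  next
    fix R assume "R \<in> ?G"
    then obtain B C where R: "R = B \<times> C" "B \<in> sets M1" "emeasure M1 B < \<infinity>" "C \<in> sets M2"
      by auto
    have "(\<lambda>(x, y). indicator B x * indicator C y) \<in> Lp_closure (M1 \<Otimes>\<^sub>M M2) s D"
      using R D M2.sigma_finite_measure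
      by (intro Lp_closure_tensor[OF M1 _ s D1 D2]) (auto intro: M2.sigma_finite_measure_axioms)
    moreover have "(\<lambda>(x, y). indicator B x * indicator C y) = (indicator R :: _ \<Rightarrow> complex)"
      by (auto simp: R indicator_def fun_eq_iff)
    moreover have "emeasure (M1 \<Otimes>\<^sub>M M2) R < \<infinity>"
      using R M2.emeasure_finite[of C]
      by (simp add: M2.emeasure_pair_measure_Times ennreal_mult_eq_top_iff less_top[symmetric])
    ultimately show "emeasure (M1 \<Otimes>\<^sub>M M2) R < \<infinity> \<and> indicator R \<in> Lp_closure (M1 \<Otimes>\<^sub>M M2) s D"
      by simp
  qed
qed

section \<open>Smooth functions of compact support\<close>

definition has_partials :: "(real^'n \<Rightarrow> complex) \<Rightarrow> ('n \<Rightarrow> real^'n \<Rightarrow> complex) \<Rightarrow> bool" where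
  "has_partials f g \<longleftrightarrow> (\<forall>x. (f has_derivative (\<lambda>h. \<Sum>i\<in>UNIV. (h $ i) *\<^sub>R g i x)) (at x))"

definition partials_closed :: "(real^'n \<Rightarrow> complex) set \<Rightarrow> bool" where
  "partials_closed S \<longleftrightarrow> (\<forall>f\<in>S. \<exists>g. has_partials f g \<and> (\<forall>i. g i \<in> S))"

text \<open>Choose for each member of S partial derivatives inside S and iterate the choice along
  the list of directions. The result is the kind of derivative family that
  \<open>smooth_compact_support\<close> demands.\<close>

lemma partials_closed_family:
  fixes S :: "(real^'n \<Rightarrow> complex) set"
  assumes S: "partials_closed S" and f: "f \<in> S"
  obtains d :: "'n list \<Rightarrow> real^'n \<Rightarrow> complex"
  where "d [] = f" "\<And>\<alpha>. d \<alpha> \<in> S" "\<And>\<alpha>. has_partials (d \<alpha>) (\<lambda>i. d (i # \<alpha>))"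
proof -
  obtain D where D: "\<And>f. f \<in> S \<Longrightarrow> has_partials f (D f) \<and> (\<forall>i. D f i \<in> S)"
    using S unfolding partials_closed_def by metis
  define d where "d \<alpha> = foldr (\<lambda>i g. D g i) \<alpha> f" for \<alpha>
  have dS: "d \<alpha> \<in> S" for \<alpha>
    by (induction \<alpha>) (use f D in \<open>auto simp: d_def\<close>)
  show thesis
    by (rule that[of d]) (use dS D in \<open>auto simp: d_def\<close>)
qed

text \<open>The function exp(-1/t), flat at 0, with a polynomial factor in 1/t. The factor makes the
  family stable under differentiation: the derivative of P(1/t) exp(-1/t) is (P - P')(1/t) exp(-1/t)
  divided by the square of t.\<close>

definition flat_fun :: "real poly \<Rightarrow> real \<Rightarrow> real" where
  "flat_fun P t = (if 0 < t then poly P (1 / t) * exp (- (1 / t)) else 0)"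

lemma tendsto_poly_exp_at_top:
  "((\<lambda>x::real. poly P x * exp (- x)) \<longlongrightarrow> 0) at_top"
proof -
  have "((\<lambda>x::real. \<Sum>i\<le>degree P. coeff P i * (x ^ i / exp x)) \<longlongrightarrow> (\<Sum>i\<le>degree P. coeff P i * 0)) at_top"
    by (intro tendsto_intros tendsto_power_div_exp_0)
  then show ?thesis
    by (simp add: poly_altdef exp_minus sum_distrib_right divide_inverse mult.assoc)
qed

lemma flat_fun_has_derivative:
  "(flat_fun P has_real_derivative flat_fun ([:0, 0, 1:] * (P - pderiv P)) t) (at t)"
proof -
  consider "t > 0" | "t < 0" | "t = 0" by linarith
  then show ?thesis
  proof cases
    case 1
    have inv: "((\<lambda>t. 1 / t) has_real_derivative (- 1 / t^2)) (at t)"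
      using 1 by (auto intro!: derivative_eq_intros simp: power2_eq_square)
    have pol: "((\<lambda>t. poly P (1 / t)) has_real_derivative poly (pderiv P) (1 / t) * (- 1 / t^2)) (at t)"
      by (rule DERIV_chain2[OF poly_DERIV inv])
    have "((\<lambda>t. exp (- (1 / t))) has_real_derivative exp (- (1 / t)) * (- (- 1 / t^2))) (at t)"
      by (rule DERIV_chain2[OF DERIV_exp DERIV_minus[OF inv]])
    then
    have "((\<lambda>t. poly P (1 / t) * exp (- (1 / t))) has_real_derivative
        poly P (1 / t) * (exp (- (1 / t)) * (1 / t^2)) + (poly (pderiv P) (1 / t) * (- 1 / t^2)) * exp (- (1 / t))) (at t)"
      by (intro DERIV_cong[OF DERIV_mult[OF pol]]) auto
    moreover have "poly P (1 / t) * (exp (- (1 / t)) * (1 / t^2)) + (poly (pderiv P) (1 / t) * (- 1 / t^2)) * exp (- (1 / t))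
       = flat_fun ([:0, 0, 1:] * (P - pderiv P)) t"
      using 1 by (simp add: flat_fun_def power2_eq_square algebra_simps)
    moreover have ev: "\<forall>\<^sub>F x in nhds t. poly P (1 / x) * exp (- (1 / x)) = flat_fun P x"
      using eventually_nhds_in_open[of "{0<..}" t] 1 by (auto simp: flat_fun_def elim!: eventually_mono)
    ultimately show ?thesis
      using DERIV_cong_ev[OF refl ev refl] by simp
  next
    case 2
    have "\<forall>\<^sub>F x in nhds t. 0 = flat_fun P x"
      using eventually_nhds_in_open[of "{..<0}" t] 2 by (auto simp: flat_fun_def elim!: eventually_mono)
    then show ?thesis
      using DERIV_cong_ev[OF refl _ refl, of "\<lambda>_. 0" "flat_fun P" t] DERIV_const[of 0 "at t"] 2
      by (simp add: flat_fun_def)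
  next
    case 3
    have "((\<lambda>h. flat_fun P h / h) \<longlongrightarrow> 0) (at 0)"
    proof (rule filterlim_split_at)
      have "\<forall>\<^sub>F h in at_left 0. 0 = flat_fun P h / h"
        by (auto simp: eventually_at flat_fun_def intro!: exI[of _ 1])
      then show "((\<lambda>h. flat_fun P h / h) \<longlongrightarrow> 0) (at_left 0)"
        by (rule Lim_transform_eventually[OF tendsto_const])
      \<comment> \<open>Dividing by h multiplies the polynomial in 1/h by its variable, which is
        what \<open>pCons 0\<close> does; so the difference quotient at 0 is of the same form and
        exponential decay kills it.\<close>
      have "((\<lambda>h. poly (pCons 0 P) (inverse h) * exp (- inverse h)) \<longlongrightarrow> 0) (at_right 0)"
        by (rule filterlim_compose[OF tendsto_poly_exp_at_top filterlim_inverse_at_top_right])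
      moreover have "\<forall>\<^sub>F h in at_right 0. poly (pCons 0 P) (inverse h) * exp (- inverse h) = flat_fun P h / h"
        by (auto simp: eventually_at flat_fun_def field_simps intro!: exI[of _ 1])
      ultimately show "((\<lambda>h. flat_fun P h / h) \<longlongrightarrow> 0) (at_right 0)"
        by (rule Lim_transform_eventually)
    qed
    then show ?thesis using 3 by (simp add: DERIV_def flat_fun_def)
  qed
qed

text \<open>Since this algebra is closed under partial derivatives, its members have all iterated
  derivatives; no calculus of higher derivatives is needed.\<close>
inductive_set smooth_alg :: "(real^'n \<Rightarrow> complex) set" where
  const: "(\<lambda>_. c) \<in> smooth_alg"
| coord: "(\<lambda>x. of_real (flat_fun P (k * x $ i + c))) \<in> smooth_alg"
| add: "f \<in> smooth_alg \<Longrightarrow> g \<in> smooth_alg \<Longrightarrow> (\<lambda>x. f x + g x) \<in> smooth_alg"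
| mult: "f \<in> smooth_alg \<Longrightarrow> g \<in> smooth_alg \<Longrightarrow> (\<lambda>x. f x * g x) \<in> smooth_alg"

lemma partials_closed_smooth_alg: "partials_closed (smooth_alg :: (real^'n \<Rightarrow> complex) set)"
  unfolding partials_closed_def
proof
  fix f :: "real^'n \<Rightarrow> complex" assume "f \<in> smooth_alg"
  then show "\<exists>g. has_partials f g \<and> (\<forall>i. g i \<in> smooth_alg)"
  proof induction
    case (const c)
    show ?case
      by (rule exI[of _ "\<lambda>_ _. 0"]) (auto simp: has_partials_def smooth_alg.const)
  next
    case (coord P k j c)
    let ?g = "\<lambda>i x. (if i = j then of_real k else 0) * of_real (flat_fun ([:0, 0, 1:] * (P - pderiv P)) (k * x $ j + c)) :: complex"
    have "has_partials (\<lambda>x. of_real (flat_fun P (k * x $ j + c))) ?g"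
      unfolding has_partials_def
    proof
      fix x :: "real^'n"
      have 1: "((\<lambda>x. k * x $ j + c) has_derivative (\<lambda>h. k * h $ j)) (at x)"
        by (auto intro!: derivative_eq_intros bounded_linear.has_derivative[OF bounded_linear_vec_nth])
      have 2: "((\<lambda>x. flat_fun P (k * x $ j + c)) has_derivative
          (\<lambda>h. flat_fun ([:0, 0, 1:] * (P - pderiv P)) (k * x $ j + c) * (k * h $ j))) (at x)"
        using has_derivative_compose[OF 1 flat_fun_has_derivative[unfolded has_field_derivative_def]] .
      have 3: "((\<lambda>x. of_real (flat_fun P (k * x $ j + c)) :: complex) has_derivative
          (\<lambda>h. of_real (flat_fun ([:0, 0, 1:] * (P - pderiv P)) (k * x $ j + c) * (k * h $ j)))) (at x)"
        by (rule bounded_linear.has_derivative[OF bounded_linear_of_real 2])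
      have "(\<Sum>i\<in>UNIV. (h $ i) *\<^sub>R ?g i x) = of_real (flat_fun ([:0, 0, 1:] * (P - pderiv P)) (k * x $ j + c) * (k * h $ j))" for h
      proof -
        have "(\<Sum>i\<in>UNIV. (h $ i) *\<^sub>R ?g i x) = (\<Sum>i\<in>UNIV. if i = j then (h $ j) *\<^sub>R (of_real k * of_real (flat_fun ([:0, 0, 1:] * (P - pderiv P)) (k * x $ j + c))) else 0)"
          by (intro sum.cong) auto
        then show ?thesis by (simp add: scaleR_conv_of_real mult_ac)
      qed
      then show "((\<lambda>x. of_real (flat_fun P (k * x $ j + c)) :: complex) has_derivative (\<lambda>h. \<Sum>i\<in>UNIV. (h $ i) *\<^sub>R ?g i x)) (at x)"
        using 3 by simp
    qed
    moreover have "?g i \<in> smooth_alg" for i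
      by (intro smooth_alg.mult smooth_alg.const smooth_alg.coord)
    ultimately show ?case by blast
  next
    case (add f1 f2)
    then obtain g1 g2 where g: "has_partials f1 g1" "has_partials f2 g2" "\<And>i. g1 i \<in> smooth_alg" "\<And>i. g2 i \<in> smooth_alg"
      by auto
    have "has_partials (\<lambda>x. f1 x + f2 x) (\<lambda>i x. g1 i x + g2 i x)"
      using g(1,2) unfolding has_partials_def
      by (auto simp: scaleR_add_right sum.distrib intro!: has_derivative_add)
    then show ?case
      using g(3,4) by (intro exI[of _ "\<lambda>i x. g1 i x + g2 i x"]) (auto intro: smooth_alg.add)
  next
    case (mult f1 f2)
    then obtain g1 g2 where g: "has_partials f1 g1" "has_partials f2 g2" "\<And>i. g1 i \<in> smooth_alg" "\<And>i. g2 i \<in> smooth_alg"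
      by auto
    have "has_partials (\<lambda>x. f1 x * f2 x) (\<lambda>i x. f1 x * g2 i x + g1 i x * f2 x)"
      unfolding has_partials_def
    proof
      fix x
      have "((\<lambda>x. f1 x * f2 x) has_derivative
          (\<lambda>h. f1 x * (\<Sum>i\<in>UNIV. (h $ i) *\<^sub>R g2 i x) + (\<Sum>i\<in>UNIV. (h $ i) *\<^sub>R g1 i x) * f2 x)) (at x)"
        using g(1,2) unfolding has_partials_def by (intro has_derivative_mult) auto
      then show "((\<lambda>x. f1 x * f2 x) has_derivative
          (\<lambda>h. \<Sum>i\<in>UNIV. (h $ i) *\<^sub>R (f1 x * g2 i x + g1 i x * f2 x))) (at x)"
        by (simp add: scaleR_add_right sum.distrib sum_distrib_left sum_distrib_right)
    qed
    then show ?case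
      using g(3,4) mult.hyps
      by (intro exI[of _ "\<lambda>i x. f1 x * g2 i x + g1 i x * f2 x"] conjI allI smooth_alg.add smooth_alg.mult) auto
  qed
qed

lemma smooth_alg_prod:
  assumes "finite I" "\<And>i. i \<in> I \<Longrightarrow> f i \<in> smooth_alg"
  shows "(\<lambda>x. \<Prod>i\<in>I. f i x) \<in> smooth_alg"
  using assms by (induction I rule: finite_induct) (auto intro: smooth_alg.intros)

lemma has_partials_continuous:
  assumes "has_partials f g"
  shows "continuous_on UNIV f"
  using assms unfolding has_partials_def
  by (auto intro!: continuous_at_imp_continuous_on has_derivative_continuous)

text \<open>Off the closed support f vanishes in a neighbourhood, so uniqueness of the derivative
  gives a zero gradient there. In \<open>stoch_smooth_mollify\<close> this keeps all iterated
  derivatives in one ball.\<close>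

lemma has_partials_support:
  assumes "has_partials f g"
  shows "closure {x. g i x \<noteq> 0} \<subseteq> closure {x. f x \<noteq> 0}"
proof (rule closure_minimal)
  show "{x. g i x \<noteq> 0} \<subseteq> closure {x. f x \<noteq> 0}"
  proof (rule ccontr)
    assume "\<not> ?thesis"
    then obtain x where x: "g i x \<noteq> 0" "x \<notin> closure {x. f x \<noteq> 0}" by auto
    have "\<forall>\<^sub>F y in nhds x. y \<in> - closure {x. f x \<noteq> 0}"
      using x by (intro eventually_nhds_in_open) auto
    then have "\<forall>\<^sub>F y in nhds x. f y = 0"
      by (rule eventually_mono) (use closure_subset in force)
    then obtain U where U: "open U" "x \<in> U" "\<And>y. y \<in> U \<Longrightarrow> f y = 0"
      by (auto simp: eventually_nhds)
    have "((\<lambda>_. 0) has_derivative (\<lambda>h. \<Sum>i\<in>UNIV. (h $ i) *\<^sub>R g i x)) (at x)"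
      using assms U has_derivative_transform_within_open[of f _ x UNIV U "\<lambda>_. 0"]
      unfolding has_partials_def by auto
    then have "(\<lambda>h. \<Sum>i\<in>UNIV. (h $ i) *\<^sub>R g i x) = (\<lambda>_. 0)"
      using has_derivative_unique[OF _ has_derivative_const] by blast
    then have "(\<Sum>j\<in>UNIV. (axis i 1 $ j) *\<^sub>R g j x) = 0"
      by metis
    moreover have "(\<Sum>j\<in>UNIV. (axis i 1 $ j) *\<^sub>R g j x) = (\<Sum>j\<in>UNIV. if j = i then g i x else 0)"
      by (intro sum.cong) (auto simp: axis_def)
    ultimately show False using x by simp
  qed
qed simp

section \<open>Bump functions on boxes\<close>

lemma flat_fun_one_bounds: "0 \<le> flat_fun 1 t" "flat_fun 1 t \<le> 1" "flat_fun 1 t \<noteq> 0 \<Longrightarrow> 0 < t"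
  by (auto simp: flat_fun_def split: if_splits)

lemma flat_fun_one_tendsto: "(flat_fun 1 \<longlongrightarrow> 1) at_top"
proof -
  have "((\<lambda>t::real. exp (- inverse t)) \<longlongrightarrow> exp (- 0)) at_top"
    by (intro tendsto_intros tendsto_inverse_0_at_top filterlim_ident)
  moreover have "\<forall>\<^sub>F t in at_top. exp (- inverse t) = flat_fun 1 t"
    using eventually_gt_at_top[of 0] by eventually_elim (auto simp: flat_fun_def inverse_eq_divide)
  ultimately show ?thesis
    by (auto intro: Lim_transform_eventually)
qed

text \<open>As \<open>k\<close> grows these bumps tend to the indicator of the open box; the shift by 1 keeps their
  supports inside it.\<close>
definition box_bump :: "real^'n \<Rightarrow> real^'n \<Rightarrow> real \<Rightarrow> real^'n \<Rightarrow> real" where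
  "box_bump a b k x = (\<Prod>i\<in>UNIV. flat_fun 1 (k * x $ i + (- (k * a $ i) - 1)) * flat_fun 1 ((- k) * x $ i + (k * b $ i - 1)))"

lemma box_bump_smooth: "(\<lambda>x. of_real (box_bump a b k x)) \<in> smooth_alg"
  unfolding box_bump_def of_real_prod of_real_mult
  by (intro smooth_alg_prod smooth_alg.mult smooth_alg.coord) auto

lemma box_bump_bounds: "0 \<le> box_bump a b k x" "box_bump a b k x \<le> 1"
  unfolding box_bump_def
  by (auto intro!: prod_nonneg prod_le_1 mult_le_one simp: flat_fun_one_bounds)

lemma box_bump_nonzero:
  assumes "box_bump a b k x \<noteq> 0" "k > 0"
  shows "x \<in> cbox (\<chi> i. a $ i + 1 / k) (\<chi> i. b $ i - 1 / k)"
proof -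
  have "a $ i + 1 / k \<le> x $ i \<and> x $ i \<le> b $ i - 1 / k" for i
  proof -
    have "flat_fun 1 (k * x $ i + (- (k * a $ i) - 1)) \<noteq> 0" "flat_fun 1 ((- k) * x $ i + (k * b $ i - 1)) \<noteq> 0"
      using assms(1) unfolding box_bump_def by auto
    from this[THEN flat_fun_one_bounds(3)]
    have "0 < k * x $ i + (- (k * a $ i) - 1)" "0 < (- k) * x $ i + (k * b $ i - 1)" .
    then show ?thesis using assms(2) by (simp add: field_simps)
  qed
  then show ?thesis by (simp add: mem_box_cart)
qed

lemma cbox_shrink_subset:
  fixes a b :: "real^'n"
  assumes "k > 0"
  shows "cbox (\<chi> i. a $ i + 1 / k) (\<chi> i. b $ i - 1 / k) \<subseteq> box a b"
proof
  fix x assume "x \<in> cbox (\<chi> i. a $ i + 1 / k) (\<chi> i. b $ i - 1 / k)"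
  then have "a $ i + 1 / k \<le> x $ i" "x $ i \<le> b $ i - 1 / k" for i
    by (auto simp: mem_box_cart)
  moreover have "1 / k > 0" using assms by simp
  ultimately have "a $ i < x $ i" "x $ i < b $ i" for i
    by (smt (verit))+
  then show "x \<in> box a b" by (auto simp: mem_box_cart)
qed

text \<open>Inside the box every factor has an argument of the form k c - 1 with c > 0 and therefore
  tends to 1; outside it the bumps vanish identically. \<open>Suc k\<close> keeps the parameter
  positive.\<close>

lemma box_bump_tendsto: "(\<lambda>k. box_bump a b (real (Suc k)) x) \<longlonglongrightarrow> indicator (box a b) x"
proof (cases "x \<in> box a b")
  case True
  have "(\<lambda>k. box_bump a b (real (Suc k)) x) \<longlonglongrightarrow> (\<Prod>i\<in>(UNIV :: 'a set). 1 * 1)"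
    unfolding box_bump_def
  proof (intro tendsto_intros filterlim_compose[OF flat_fun_one_tendsto])
    fix i
    have lim: "filterlim (\<lambda>k. c * real (Suc k) - 1) at_top sequentially" if "c > 0" for c :: real
      using filterlim_tendsto_add_at_top[OF tendsto_const[of "-1"]
          filterlim_tendsto_pos_mult_at_top[OF tendsto_const that
            filterlim_compose[OF filterlim_real_sequentially filterlim_Suc]]] by simp
    have "x $ i - a $ i > 0" "b $ i - x $ i > 0" using True by (auto simp: mem_box_cart)
    from lim[OF this(1)] lim[OF this(2)]
    show "filterlim (\<lambda>k. real (Suc k) * x $ i + (- (real (Suc k) * a $ i) - 1)) at_top sequentially"
      and "filterlim (\<lambda>k. - real (Suc k) * x $ i + (real (Suc k) * b $ i - 1)) at_top sequentially"
      by (simp_all add: algebra_simps)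
  qed
  then show ?thesis using True by simp
next
  case False
  then have "box_bump a b (real (Suc k)) x = 0" for k
    using box_bump_nonzero[of a b "real (Suc k)" x] cbox_shrink_subset[of "real (Suc k)" a b] by auto
  then show ?thesis using False by simp
qed

lemma compact_closure_subset:
  fixes S :: "'a::t2_space set"
  assumes "compact K" "closure S \<subseteq> K"
  shows "compact (closure S)"
  using compact_Int_closed[OF assms(1) closed_closure, of S] assms(2) by (simp add: Int_absorb1)

lemma smooth_compact_support_iff:
  "smooth_compact_support Q \<phi> \<longleftrightarrow>
     (\<exists>d. d [] = \<phi> \<and> (\<forall>\<alpha>. has_partials (d \<alpha>) (\<lambda>i. d (i # \<alpha>)))) \<and>
     compact (closure {x. \<phi> x \<noteq> 0}) \<and> closure {x. \<phi> x \<noteq> 0} \<subseteq> Q"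
  by (auto simp: smooth_compact_support_def has_partials_def)

lemma smooth_compact_support_continuous:
  assumes "smooth_compact_support Q \<phi>"
  shows "continuous_on UNIV \<phi>"
  using assms has_partials_continuous unfolding smooth_compact_support_iff by metis

lemma box_bump_smooth_compact_support:
  assumes "box a b \<subseteq> Q" "k > 0"
  shows "smooth_compact_support Q (\<lambda>x. of_real (box_bump a b k x))"
proof -
  let ?C = "cbox (\<chi> i. a $ i + 1 / k) (\<chi> i. b $ i - 1 / k)"
  have sub: "closure {x. (of_real (box_bump a b k x) :: complex) \<noteq> 0} \<subseteq> ?C"
    using assms by (intro closure_minimal) (auto dest: box_bump_nonzero)
  then have "compact (closure {x. (of_real (box_bump a b k x) :: complex) \<noteq> 0})"
    using compact_cbox by (rule compact_closure_subset[rotated])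
  moreover obtain d where "d [] = (\<lambda>x. of_real (box_bump a b k x))" "\<And>\<alpha>. has_partials (d \<alpha>) (\<lambda>i. d (i # \<alpha>))"
    using partials_closed_family[OF partials_closed_smooth_alg box_bump_smooth] by metis
  ultimately show ?thesis
    unfolding smooth_compact_support_iff
    using sub cbox_shrink_subset[OF assms(2), of a b] assms(1) by blast
qed

lemma lin_closed_smooth_compact_support: "lin_closed {\<phi>. smooth_compact_support Q \<phi>}"
  unfolding lin_closed_def mem_Collect_eq
proof (intro conjI allI ballI; (unfold mem_Collect_eq)?)
  show "smooth_compact_support Q (\<lambda>_. 0)"
    unfolding smooth_compact_support_iff
    by (auto intro!: exI[of _ "\<lambda>_ _. 0"] simp: has_partials_def)
next
  fix f g assume f: "smooth_compact_support Q f" and g: "smooth_compact_support Q g"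
  have sub: "closure {x. f x + g x \<noteq> 0} \<subseteq> closure {x. f x \<noteq> 0} \<union> closure {x. g x \<noteq> 0}"
    unfolding closure_Un[symmetric] by (intro closure_mono) auto
  then have "compact (closure {x. f x + g x \<noteq> 0})"
    using f g unfolding smooth_compact_support_iff by (meson compact_closure_subset compact_Un)
  moreover obtain d1 d2 where d: "d1 [] = f" "\<And>\<alpha>. has_partials (d1 \<alpha>) (\<lambda>i. d1 (i # \<alpha>))"
     "d2 [] = g" "\<And>\<alpha>. has_partials (d2 \<alpha>) (\<lambda>i. d2 (i # \<alpha>))"
    using f g unfolding smooth_compact_support_iff by metis
  have "has_partials (\<lambda>x. d1 \<alpha> x + d2 \<alpha> x) (\<lambda>i x. d1 (i # \<alpha>) x + d2 (i # \<alpha>) x)" for \<alpha>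
    using d(2,4) unfolding has_partials_def
    by (auto simp: scaleR_add_right sum.distrib intro!: has_derivative_add)
  then have "\<exists>d. d [] = (\<lambda>x. f x + g x) \<and> (\<forall>\<alpha>. has_partials (d \<alpha>) (\<lambda>i. d (i # \<alpha>)))"
    using d by (intro exI[of _ "\<lambda>\<alpha> x. d1 \<alpha> x + d2 \<alpha> x"]) auto
  ultimately show "smooth_compact_support Q (\<lambda>x. f x + g x)"
    using f g sub unfolding smooth_compact_support_iff by blast
next
  fix c f assume f: "smooth_compact_support Q f"
  have sub: "closure {x. c * f x \<noteq> 0} \<subseteq> closure {x. f x \<noteq> 0}"
    by (intro closure_mono) auto
  then have "compact (closure {x. c * f x \<noteq> 0})"
    using f unfolding smooth_compact_support_iff by (meson compact_closure_subset)
  moreover obtain d where d: "d [] = f" "\<And>\<alpha>. has_partials (d \<alpha>) (\<lambda>i. d (i # \<alpha>))"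
    using f unfolding smooth_compact_support_iff by metis
  have "has_partials (\<lambda>x. c * d \<alpha> x) (\<lambda>i x. c * d (i # \<alpha>) x)" for \<alpha>
    using d(2) unfolding has_partials_def
    by (auto simp: sum_distrib_left[symmetric] mult_scaleR_right[symmetric] simp del: mult_scaleR_right intro!: has_derivative_mult_right)
  then have "\<exists>d. d [] = (\<lambda>x. c * f x) \<and> (\<forall>\<alpha>. has_partials (d \<alpha>) (\<lambda>i. d (i # \<alpha>)))"
    using d by (intro exI[of _ "\<lambda>\<alpha> x. c * d \<alpha> x"]) auto
  ultimately show "smooth_compact_support Q (\<lambda>x. c * f x)"
    using f sub unfolding smooth_compact_support_iff by blast
qed

text \<open>Open boxes form an intersection-stable generator whose members are approximated by bumps
  that are products over the coordinates.\<close>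

lemma sets_restrict_open_boxes:
  fixes Q :: "(real^'n) set"
  assumes "open Q"
  shows "sets (restrict_space lborel Q) = sigma_sets Q {box a b |a b. box a b \<subseteq> Q}" (is "_ = sigma_sets Q ?G")
proof
  have op: "U \<in> sigma_sets Q ?G" if U: "open U" "U \<subseteq> Q" for U
  proof -
    obtain \<D> where \<D>: "countable \<D>" "\<D> \<subseteq> Pow U" "\<And>X. X \<in> \<D> \<Longrightarrow> \<exists>a b. X = box a b" "\<Union>\<D> = U"
      using open_countable_Union_open_box[OF U(1)] by metis
    have "X \<in> sigma_sets Q ?G" if "X \<in> \<D>" for X
      using \<D>(2,3) that U(2) by (intro sigma_sets.Basic) blast
    then have "\<Union>\<D> \<in> sigma_sets Q ?G"
      by (rule sigma_sets_UNION[OF \<D>(1)])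
    then show ?thesis using \<D> by simp
  qed
  have "Q \<inter> A \<in> sigma_sets Q ?G" if "A \<in> sets borel" for A
  proof -
    have "A \<in> sigma_sets UNIV {S. open S}" using that by (simp add: borel_def)
    then show ?thesis
    proof induction
      case (Basic a)
      then show ?case using assms by (intro op) auto
    next
      case Empty
      show ?case by (simp add: sigma_sets.Empty)
    next
      case (Compl a)
      have "Q - (Q \<inter> a) \<in> sigma_sets Q ?G" using Compl by (intro sigma_sets.Compl)
      moreover have "Q - (Q \<inter> a) = Q \<inter> (UNIV - a)" by auto
      ultimately show ?case by simp
    next
      case (Union a)
      then have "(\<Union>i. Q \<inter> a i) \<in> sigma_sets Q ?G" by (intro sigma_sets.Union)
      then show ?case by (simp only: Int_UN_distrib)
    qed
  qed
  then show "sets (restrict_space lborel Q) \<subseteq> sigma_sets Q ?G"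
    by (auto simp: sets_restrict_space)
  have "?G \<subseteq> sets (restrict_space lborel Q)"
    using assms by (auto simp: sets_restrict_space_iff)
  then show "sigma_sets Q ?G \<subseteq> sets (restrict_space lborel Q)"
    using sets.sigma_sets_subset[of ?G "restrict_space lborel Q"] by (simp add: space_restrict_space)
qed

lemma indicator_in_smooth_closure:
  fixes Q :: "(real^'n) set"
  assumes Q: "open Q" and s: "0 < s"
    and B: "B \<in> sets (restrict_space lborel Q)" "emeasure (restrict_space lborel Q) B < \<infinity>"
  shows "indicator B \<in> Lp_closure (restrict_space lborel Q) s {\<phi>. smooth_compact_support Q \<phi>}"
proof -
  let ?N = "restrict_space lborel Q"
  let ?G = "{box a b |a b. box a b \<subseteq> Q}"
  have [measurable]: "Q \<in> sets borel" using Q by auto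
  obtain \<D> where \<D>: "countable \<D>" "\<D> \<subseteq> Pow Q" "\<And>X. X \<in> \<D> \<Longrightarrow> \<exists>a b. X = box a b" "\<Union>\<D> = Q"
    using open_countable_Union_open_box[OF Q] by metis
  \<comment> \<open>\<open>from_nat_into\<close> enumerates a nonempty countable set; the empty set
    is added in case Q is empty, and it is itself a degenerate box.\<close>
  define U where "U = from_nat_into (insert {} \<D>)"
  have U: "range U = insert {} \<D>"
    using \<D>(1) unfolding U_def by (intro range_from_nat_into) auto
  show ?thesis
  proof (rule indicator_in_Lp_closure[OF lin_closed_smooth_compact_support s _ _ _ _ _ _ B])
    show "Int_stable ?G"
      unfolding Int_stable_def
    proof safe
      fix a b c d :: "real^'n" assume sub: "box a b \<subseteq> Q"
      have ef: "box a b \<inter> box c d = box (\<chi> i. max (a $ i) (c $ i)) (\<chi> i. min (b $ i) (d $ i))" (is "_ = box ?e ?f")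
        by (auto simp: mem_box_cart)
      then have "box ?e ?f \<subseteq> Q" using sub by blast
      then show "\<exists>e f. box a b \<inter> box c d = box e f \<and> box e f \<subseteq> Q"
        using ef by blast
    qed
    show "?G \<subseteq> Pow (space ?N)" by (auto simp: space_restrict_space)
    show "sets ?N = sigma_sets (space ?N) ?G"
      using sets_restrict_open_boxes[OF Q] by (simp add: space_restrict_space)
    have "{} = box (0::real^'n) 0" by simp
    then have "{} \<in> ?G" by blast
    moreover have "\<D> \<subseteq> ?G" using \<D>(2,3) by blast
    ultimately show "range U \<subseteq> ?G" unfolding U by blast
    show "(\<Union>i. U i) = space ?N"
      using \<D>(4) U by (simp add: space_restrict_space)
  next
    fix X assume "X \<in> ?G"
    then obtain a b where X: "X = box a b" "box a b \<subseteq> Q" by auto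
    have XN: "X \<in> sets ?N" "emeasure ?N X < \<infinity>"
      using X by (auto simp: sets_restrict_space_iff emeasure_restrict_space emeasure_lborel_box_eq)
    have LX: "Lp ?N s (indicator X)" using XN s by (intro Lp_indicator)
    have bd: "cmod (of_real (box_bump a b (real (Suc k)) x)) \<le> cmod (indicator X x)" for k x
      using box_bump_nonzero[of a b "real (Suc k)" x] cbox_shrink_subset[of "real (Suc k)" a b]
        box_bump_bounds[of a b "real (Suc k)" x]
      by (cases "x \<in> box a b") (auto simp: X)
    have sc: "smooth_compact_support Q (\<lambda>x. of_real (box_bump a b (real (Suc k)) x))" for k
      using X by (intro box_bump_smooth_compact_support) auto
    have "(\<lambda>x. of_real (box_bump a b (real (Suc k)) x) :: complex) \<in> borel_measurable ?N" for k
      using smooth_compact_support_continuous[OF sc]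
      by (intro measurable_restrict_space1) (simp add: borel_measurable_continuous_onI)
    then have L: "Lp ?N s (\<lambda>x. of_real (box_bump a b (real (Suc k)) x))" for k
      using bd s by (intro Lp_bound[OF _ LX]) auto
    have "indicator X \<in> Lp_closure ?N s {\<phi>. smooth_compact_support Q \<phi>}"
    proof (rule Lp_closure_limit[where F="\<lambda>k x. of_real (box_bump a b (real (Suc k)) x)" and g="indicator X"])
      show "AE x in ?N. (\<lambda>k. complex_of_real (box_bump a b (real (Suc k)) x)) \<longlonglongrightarrow> indicator X x"
      proof (rule AE_I2)
        fix x
        have "(\<lambda>k. complex_of_real (box_bump a b (real (Suc k)) x)) \<longlonglongrightarrow> of_real (indicator (box a b) x)"
          by (intro tendsto_of_real box_bump_tendsto)
        then show "(\<lambda>k. complex_of_real (box_bump a b (real (Suc k)) x)) \<longlonglongrightarrow> indicator X x"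
          unfolding X by (cases "x \<in> box a b") simp_all
      qed
    qed (use sc L LX bd s in \<open>auto intro!: Lp_closure_base\<close>)
    then show "emeasure ?N X < \<infinity> \<and> indicator X \<in> Lp_closure ?N s {\<phi>. smooth_compact_support Q \<phi>}"
      using XN by simp
  qed
qed

text \<open>Some bump of a small box has positive integral, since these integrals tend to the volume
  of the box; dividing by the integral normalizes it.\<close>

lemma mollifier_exists:
  assumes "0 < \<delta>"
  obtains \<rho> :: "real^'n \<Rightarrow> real"
  where "smooth_compact_support UNIV (\<lambda>x. of_real (\<rho> x))" "\<And>x. 0 \<le> \<rho> x"
    "integrable lborel \<rho>" "(LINT x|lborel. \<rho> x) = 1" "\<And>x. \<rho> x \<noteq> 0 \<Longrightarrow> norm x < \<delta>"
proof -
  obtain a b :: "real^'n" where ab: "0 \<in> box a b" "box a b \<subseteq> ball 0 \<delta>"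
    using open_contains_box[of "ball (0::real^'n) \<delta>" 0] assms by (metis centre_in_ball open_ball)
  let ?B = "\<lambda>k. box_bump a b (real (Suc k))"
  have sc: "smooth_compact_support UNIV (\<lambda>x. complex_of_real (?B k x))" for k
    by (intro box_bump_smooth_compact_support) auto
  have "continuous_on UNIV (\<lambda>x. Re (complex_of_real (?B k x)))" for k
    by (intro continuous_intros smooth_compact_support_continuous[OF sc])
  then have cont: "continuous_on UNIV (?B k)" for k by simp
  then have [measurable]: "?B k \<in> borel_measurable lborel" for k
    by (simp add: borel_measurable_continuous_onI)
  have in_box: "x \<in> box a b" if "?B k x \<noteq> 0" for k x
    using box_bump_nonzero[OF that] cbox_shrink_subset[of "real (Suc k)" a b] by auto
  have fin: "emeasure lborel (box a b) < \<infinity>" by (simp add: emeasure_lborel_box_eq)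
  have "(\<lambda>k. LINT x|lborel. ?B k x) \<longlonglongrightarrow> (LINT x|lborel. indicator (box a b) x)"
  proof (rule integral_dominated_convergence[where w="indicator (box a b)"])
    show "AE x in lborel. norm (?B k x) \<le> indicator (box a b) x" for k
    proof (rule AE_I2)
      fix x show "norm (?B k x) \<le> indicator (box a b) x"
        using in_box[of k x] box_bump_bounds[of a b "real (Suc k)" x]
        by (cases "x \<in> box a b") auto
    qed
    show "AE x in lborel. (\<lambda>k. ?B k x) \<longlonglongrightarrow> indicator (box a b) x"
      by (rule AE_I2) (rule box_bump_tendsto)
    show "?B k \<in> borel_measurable lborel" for k by measurable
  qed (use fin in auto)
  moreover have "0 < (LINT x|lborel. indicator (box a b) x :: real)"
  proof -
    have "a \<bullet> i < b \<bullet> i" if "i \<in> Basis" for i using ab(1) that by (auto simp: box_def)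
    then show ?thesis
      using ab(1) by (auto intro!: prod_pos simp: measure_lborel_box_eq inner_diff_left less_imp_le)
  qed
  ultimately have "\<forall>\<^sub>F k in sequentially. 0 < (LINT x|lborel. ?B k x)"
    by (auto dest: order_tendstoD)
  then obtain k where k: "0 < (LINT x|lborel. ?B k x)"
    by (auto simp: eventually_sequentially)
  let ?c = "LINT x|lborel. ?B k x"
  \<comment> \<open>A function that is not integrable has integral 0, so a positive integral implies
    integrability.\<close>
  have int: "integrable lborel (?B k)"
    using k not_integrable_integral_eq by fastforce
  have "(\<lambda>x. of_real (1 / ?c) * of_real (?B k x)) \<in> {\<phi>. smooth_compact_support UNIV \<phi>}"
    using lin_closedD(3)[OF lin_closed_smooth_compact_support] sc by blast
  then have "smooth_compact_support UNIV (\<lambda>x. complex_of_real (1 / ?c * ?B k x))"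
    unfolding of_real_mult by blast
  then show thesis
  proof (rule that)
    show "norm x < \<delta>" if "1 / ?c * ?B k x \<noteq> 0" for x
      using that in_box[of k x] ab(2) by auto
    show "0 \<le> 1 / ?c * ?B k x" for x
      using k box_bump_bounds(1)[of a b "real (Suc k)" x] by (intro mult_nonneg_nonneg) auto
  qed (use k int in auto)
qed

section \<open>Translations and difference quotients in \<open>L\<^sup>1\<close>\<close>

lemma
  fixes f :: "'a::euclidean_space \<Rightarrow> 'b::{banach, second_countable_topology}"
  assumes f: "f \<in> borel_measurable borel"
  shows lborel_integral_translation: "(LINT x|lborel. f (x + c)) = (LINT x|lborel. f x)"
    and lborel_integrable_translation: "integrable lborel (\<lambda>x. f (x + c)) \<longleftrightarrow> integrable lborel f"
proof -
  have "(\<lambda>x. x + c) = (+) c" by auto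
  then have *: "distr lborel borel (\<lambda>x. x + c) = lborel"
    using lborel_distr_plus[of c] by simp
  show "(LINT x|lborel. f (x + c)) = (LINT x|lborel. f x)"
    using integral_distr[of "\<lambda>x. x + c" lborel borel f] f by (simp add: *)
  show "integrable lborel (\<lambda>x. f (x + c)) \<longleftrightarrow> integrable lborel f"
    using integrable_distr_eq[of "\<lambda>x. x + c" lborel borel f] f by (simp add: *)
qed

lemma compact_support_uniformly_continuous:
  fixes f :: "'a::euclidean_space \<Rightarrow> complex"
  assumes f: "continuous_on UNIV f" and supp: "\<And>x. f x \<noteq> 0 \<Longrightarrow> norm x \<le> R" and "0 < \<epsilon>"
  obtains \<delta> where "0 < \<delta>" "\<delta> \<le> 1" "\<And>x y. norm y < \<delta> \<Longrightarrow> cmod (f (x + y) - f x) \<le> \<epsilon>"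
proof -
  \<comment> \<open>With |y| < 1, either |x| \<le> R + 1 and both points lie in this ball, or both
    lie outside the support.\<close>
  have "uniformly_continuous_on (cball 0 (R + 2)) f"
    by (rule compact_uniformly_continuous[OF continuous_on_subset[OF f]]) auto
  then obtain d where d: "0 < d" "\<And>x x'. x \<in> cball 0 (R + 2) \<Longrightarrow> x' \<in> cball 0 (R + 2) \<Longrightarrow> dist x' x < d \<Longrightarrow> dist (f x') (f x) < \<epsilon>"
    using \<open>0 < \<epsilon>\<close> unfolding uniformly_continuous_on_def by metis
  show thesis
  proof (rule that[of "min d 1"])
    fix x y :: 'a assume y: "norm y < min d 1"
    have tri: "norm (x + y) \<le> norm x + norm y" "norm x \<le> norm (x + y) + norm y"
      using norm_triangle_ineq[of x y] norm_triangle_ineq4[of "x + y" y] by auto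
    show "cmod (f (x + y) - f x) \<le> \<epsilon>"
    proof (cases "norm x \<le> R + 1")
      case True
      then have "x \<in> cball 0 (R + 2)" "x + y \<in> cball 0 (R + 2)" using y tri by auto
      moreover have "dist (x + y) x < d" using y by (simp add: dist_norm)
      ultimately have "dist (f (x + y)) (f x) < \<epsilon>" by (rule d(2))
      then show ?thesis by (simp add: dist_norm)
    next
      case False
      then have "f x = 0" "f (x + y) = 0"
        using supp[of x] supp[of "x + y"] y tri by (auto simp: not_le intro: ccontr)
      then show ?thesis using \<open>0 < \<epsilon>\<close> by simp
    qed
  qed (use d in auto)
qed

lemma smooth_compact_support_bounded_support:
  assumes "smooth_compact_support Q \<phi>"
  obtains R where "\<And>x. \<phi> x \<noteq> 0 \<Longrightarrow> norm x \<le> R"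
proof -
  have "bounded {x. \<phi> x \<noteq> 0}"
    using assms unfolding smooth_compact_support_iff by auto
  then show thesis using that by (auto simp: bounded_iff)
qed

lemma integral_le_ball:
  fixes h :: "'a::euclidean_space \<Rightarrow> real"
  assumes "\<And>x. 0 \<le> h x" "\<And>x. h x \<le> \<epsilon>" "\<And>x. h x \<noteq> 0 \<Longrightarrow> norm x \<le> R" "h \<in> borel_measurable borel"
  shows "integrable lborel h" "(LINT x|lborel. h x) \<le> \<epsilon> * measure lborel (cball (0::'a) R)"
proof -
  have fin: "emeasure lborel (cball (0::'a) R) < \<infinity>"
    by (intro emeasure_bounded_finite) auto
  have int: "integrable lborel (\<lambda>x. \<epsilon> * indicator (cball (0::'a) R) x)"
    using fin by auto
  have le: "h x \<le> \<epsilon> * indicator (cball 0 R) x" for x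
    using assms(1-3)[of x] by (cases "x \<in> cball 0 R") auto
  show *: "integrable lborel h"
    by (rule Bochner_Integration.integrable_bound[OF int])
       (use assms le in \<open>auto intro!: AE_I2 intro: order_trans[OF _ abs_ge_self]\<close>)
  have "(LINT x|lborel. h x) \<le> (LINT x|lborel. \<epsilon> * indicator (cball (0::'a) R) x)"
    using int * le by (intro integral_mono) auto
  then show "(LINT x|lborel. h x) \<le> \<epsilon> * measure lborel (cball (0::'a) R)"
    using fin by simp
qed

text \<open>Three errors: two come from replacing f by a smooth \<phi> of compact support and are
  equal by translation invariance; the third is bounded by uniform continuity of \<phi> on a
  ball.\<close>

lemma translation_continuous_L1:
  fixes f :: "real^'n \<Rightarrow> complex"
  assumes f: "integrable lborel f" and "0 < \<epsilon>"
  obtains \<delta> where "0 < \<delta>" "\<And>y. norm y < \<delta> \<Longrightarrow> (LINT x|lborel. cmod (f (x + y) - f x)) < \<epsilon>"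
proof -
  have [measurable]: "f \<in> borel_measurable borel" using f by auto
  have U: "restrict_space (lborel :: (real^'n) measure) UNIV = lborel"
    by (rule measure_eqI) (simp_all add: emeasure_restrict_space)
  have Lf: "Lp (lborel :: (real^'n) measure) 1 f" using f by (auto simp: Lp_def)
  have cl: "f \<in> Lp_closure lborel 1 {\<phi>. smooth_compact_support UNIV \<phi>}"
    using indicator_in_smooth_closure[of "UNIV :: (real^'n) set" 1]
    by (intro Lp_in_closure[OF lin_closed_smooth_compact_support _ _ Lf]) (auto simp: U)
  have "0 < \<epsilon> / 4" using \<open>0 < \<epsilon>\<close> by simp
  from Lp_closureE[OF cl this]
  obtain \<phi> where \<phi>: "smooth_compact_support UNIV \<phi>" "Lp lborel 1 \<phi>" "(LINT z|lborel. cmod (f z - \<phi> z) powr 1) < \<epsilon> / 4"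
    by blast
  have cont: "continuous_on UNIV \<phi>" by (rule smooth_compact_support_continuous[OF \<phi>(1)])
  then have [measurable]: "\<phi> \<in> borel_measurable borel" by (rule borel_measurable_continuous_onI)
  have int\<phi>: "integrable lborel \<phi>" using \<phi>(2) integrable_norm_cancel[of lborel \<phi>] by (simp add: Lp_def)
  obtain R where R: "\<And>x. \<phi> x \<noteq> 0 \<Longrightarrow> norm x \<le> R"
    using smooth_compact_support_bounded_support[OF \<phi>(1)] by metis
  \<comment> \<open>Radius R + 1 covers the supports of \<phi> and of its translate, because
    translations are shorter than 1. Adding 1 to c below avoids division by 0.\<close>
  define c where "c = measure lborel (cball (0::real^'n) (R + 1))"
  have "c \<ge> 0" by (simp add: c_def)
  have pos: "0 < \<epsilon> / (4 * (c + 1))" using \<open>0 < \<epsilon>\<close> \<open>c \<ge> 0\<close> by simp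
  obtain \<delta> where \<delta>: "0 < \<delta>" "\<delta> \<le> 1" "\<And>x y. norm y < \<delta> \<Longrightarrow> cmod (\<phi> (x + y) - \<phi> x) \<le> \<epsilon> / (4 * (c + 1))"
    using compact_support_uniformly_continuous[OF cont R pos] by metis
  show thesis
  proof (rule that[OF \<delta>(1)])
    fix y :: "real^'n" assume y: "norm y < \<delta>"
    have i1: "integrable lborel (\<lambda>x. cmod (f x - \<phi> x))" using f int\<phi> by auto
    have i2: "integrable lborel (\<lambda>x. cmod (f (x + y) - \<phi> (x + y)))"
      using i1 lborel_integrable_translation[of "\<lambda>x. cmod (f x - \<phi> x)" y] by simp
    have e2: "(LINT x|lborel. cmod (f (x + y) - \<phi> (x + y))) = (LINT x|lborel. cmod (f x - \<phi> x))"
      using lborel_integral_translation[of "\<lambda>x. cmod (f x - \<phi> x)" y] by simp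
    have supp: "norm x \<le> R + 1" if "cmod (\<phi> (x + y) - \<phi> x) \<noteq> 0" for x
      using that R[of x] R[of "x + y"] norm_triangle_ineq4[of "x + y" y] y \<delta>(2) by force
    note i3 = integral_le_ball[where h="\<lambda>x. cmod (\<phi> (x + y) - \<phi> x)", OF _ \<delta>(3)[OF y] supp]
    have "(LINT x|lborel. cmod (f (x + y) - f x)) \<le>
       (LINT x|lborel. cmod (f (x + y) - \<phi> (x + y)) + cmod (\<phi> (x + y) - \<phi> x) + cmod (f x - \<phi> x))"
    proof (rule integral_mono)
      show "integrable lborel (\<lambda>x. cmod (f (x + y) - f x))"
        using f lborel_integrable_translation[of f y] by auto
      show "integrable lborel (\<lambda>x. cmod (f (x + y) - \<phi> (x + y)) + cmod (\<phi> (x + y) - \<phi> x) + cmod (f x - \<phi> x))"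
        using i1 i2 i3 by auto
      show "cmod (f (x + y) - f x) \<le> cmod (f (x + y) - \<phi> (x + y)) + cmod (\<phi> (x + y) - \<phi> x) + cmod (f x - \<phi> x)" for x
        using norm_triangle_ineq[of "f (x + y) - \<phi> (x + y) + (\<phi> (x + y) - \<phi> x)" "\<phi> x - f x"]
          norm_triangle_ineq[of "f (x + y) - \<phi> (x + y)" "\<phi> (x + y) - \<phi> x"]
        by (simp add: norm_minus_commute)
    qed
    also have "\<dots> = (LINT x|lborel. cmod (f (x + y) - \<phi> (x + y))) + (LINT x|lborel. cmod (\<phi> (x + y) - \<phi> x)) + (LINT x|lborel. cmod (f x - \<phi> x))"
      using i1 i2 i3 by simp
    also have "\<dots> \<le> \<epsilon> / 4 + \<epsilon> / (4 * (c + 1)) * c + \<epsilon> / 4"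
      using e2 \<phi>(3) i3(2) by (intro add_mono) (auto simp: c_def)
    also have "\<dots> < \<epsilon>"
    proof -
      have "\<epsilon> / (4 * (c + 1)) * c \<le> \<epsilon> / 4"
        using \<open>c \<ge> 0\<close> \<open>0 < \<epsilon>\<close> by (simp add: field_simps)
      then show ?thesis using \<open>0 < \<epsilon>\<close> by linarith
    qed
    finally show "(LINT x|lborel. cmod (f (x + y) - f x)) < \<epsilon>" .
  qed
qed

text \<open>The sign of g is the one seen by a kernel: moving a point along the flow by t moves the
  argument of the kernel by -t. The bound is in \<open>L\<^sup>1\<close> because that norm of a
  kernel controls its mollification uniformly in \<omega>.\<close>

lemma partial_quotient_L1:
  fixes \<phi> :: "real^'n \<Rightarrow> complex"
  assumes d: "has_partials \<phi> g" and cont: "continuous_on UNIV (g i)"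
    and R: "\<And>x. \<phi> x \<noteq> 0 \<Longrightarrow> norm x \<le> R" "\<And>x. g i x \<noteq> 0 \<Longrightarrow> norm x \<le> R" and "0 < \<epsilon>"
  obtains \<delta> where "0 < \<delta>" "\<And>t. t \<noteq> 0 \<Longrightarrow> \<bar>t\<bar> < \<delta> \<Longrightarrow>
    integrable lborel (\<lambda>y. cmod ((\<phi> (y - t *\<^sub>R axis i 1) - \<phi> y) / of_real t + g i y)) \<and>
    (LINT y|lborel. cmod ((\<phi> (y - t *\<^sub>R axis i 1) - \<phi> y) / of_real t + g i y)) \<le> \<epsilon>"
proof -
  have cont\<phi>: "continuous_on UNIV \<phi>" by (rule has_partials_continuous[OF d])
  note [measurable] = borel_measurable_continuous_onI[OF cont] borel_measurable_continuous_onI[OF cont\<phi>]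
  define c where "c = measure lborel (cball (0::real^'n) (R + 1))"
  have "c \<ge> 0" by (simp add: c_def)
  have pos: "0 < \<epsilon> / (c + 1)" using \<open>0 < \<epsilon>\<close> \<open>c \<ge> 0\<close> by simp
  obtain \<delta> where \<delta>: "0 < \<delta>" "\<delta> \<le> 1" "\<And>x y. norm y < \<delta> \<Longrightarrow> cmod (g i (x + y) - g i x) \<le> \<epsilon> / (c + 1)"
    using compact_support_uniformly_continuous[OF cont R(2) pos] by metis
  show thesis
  proof (rule that[OF \<delta>(1)])
    fix t :: real assume t: "t \<noteq> 0" "\<bar>t\<bar> < \<delta>"
    have le: "cmod ((\<phi> (y - t *\<^sub>R axis i 1) - \<phi> y) / of_real t + g i y) \<le> \<epsilon> / (c + 1)" for y
    proof -
      \<comment> \<open>The increment of h from 0 to t is t times the quantity to be bounded, and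
        the derivative of h vanishes at 0 and is small on the whole segment.\<close>
      define h where "h \<tau> = \<phi> (y - \<tau> *\<^sub>R axis i 1) + \<tau> *\<^sub>R g i y" for \<tau>
      have der: "(h has_vector_derivative (g i y - g i (y - \<tau> *\<^sub>R axis i 1))) (at \<tau> within S)" for \<tau> S
      proof -
        have "((\<lambda>\<tau>. y - \<tau> *\<^sub>R axis i 1) has_derivative (\<lambda>r. - (r *\<^sub>R axis i 1))) (at \<tau>)"
          by (auto intro!: derivative_eq_intros)
        from has_derivative_compose[OF this d[unfolded has_partials_def, rule_format]]
        have "((\<lambda>\<tau>. \<phi> (y - \<tau> *\<^sub>R axis i 1)) has_derivative
           (\<lambda>r. \<Sum>j\<in>UNIV. ((- (r *\<^sub>R axis i 1) :: real^'n) $ j) *\<^sub>R g j (y - \<tau> *\<^sub>R axis i 1))) (at \<tau>)" .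
        moreover have "(\<Sum>j\<in>UNIV. ((- (r *\<^sub>R axis i 1) :: real^'n) $ j) *\<^sub>R g j (y - \<tau> *\<^sub>R axis i 1)) = r *\<^sub>R (- g i (y - \<tau> *\<^sub>R axis i 1))" for r
        proof -
          have "(\<Sum>j\<in>UNIV. ((- (r *\<^sub>R axis i 1) :: real^'n) $ j) *\<^sub>R g j (y - \<tau> *\<^sub>R axis i 1))
              = (\<Sum>j\<in>UNIV. if j = i then r *\<^sub>R (- g i (y - \<tau> *\<^sub>R axis i 1)) else 0)"
            by (intro sum.cong) (auto simp: axis_def)
          then show ?thesis by simp
        qed
        ultimately have "((\<lambda>\<tau>. \<phi> (y - \<tau> *\<^sub>R axis i 1)) has_vector_derivative (- g i (y - \<tau> *\<^sub>R axis i 1))) (at \<tau>)"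
          by (simp add: has_vector_derivative_def)
        moreover have "((\<lambda>\<tau>. \<tau> *\<^sub>R g i y) has_vector_derivative (1 *\<^sub>R g i y)) (at \<tau>)"
          by (auto intro!: derivative_eq_intros)
        ultimately have "(h has_vector_derivative (- g i (y - \<tau> *\<^sub>R axis i 1) + 1 *\<^sub>R g i y)) (at \<tau>)"
          unfolding h_def by (rule has_vector_derivative_add)
        then show ?thesis by (simp add: has_vector_derivative_at_within)
      qed
      have "norm (h t - h 0 - (t - 0) *\<^sub>R (g i y - g i (y - 0 *\<^sub>R axis i 1))) \<le> norm (t - 0) * (\<epsilon> / (c + 1))"
      proof (rule vector_differentiable_bound_linearization[where S="closed_segment 0 t"
            and f'="\<lambda>\<tau>. g i y - g i (y - \<tau> *\<^sub>R axis i 1)"])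
        fix \<tau> assume \<tau>: "\<tau> \<in> closed_segment 0 t"
        then have "\<bar>\<tau>\<bar> \<le> \<bar>t\<bar>" by (auto simp: closed_segment_eq_real_ivl split: if_splits)
        then have "norm (- \<tau> *\<^sub>R axis i 1 :: real^'n) < \<delta>" using t by simp
        from \<delta>(3)[OF this, of y]
        show "norm (g i y - g i (y - \<tau> *\<^sub>R axis i 1) - (g i y - g i (y - 0 *\<^sub>R axis i 1))) \<le> \<epsilon> / (c + 1)"
          by (simp add: norm_minus_commute)
      qed (auto intro: der)
      then have "cmod (\<phi> (y - t *\<^sub>R axis i 1) + t *\<^sub>R g i y - \<phi> y) \<le> \<epsilon> / (c + 1) * \<bar>t\<bar>"
        by (simp add: h_def mult.commute)
      moreover have "(\<phi> (y - t *\<^sub>R axis i 1) - \<phi> y) / of_real t + g i y = (\<phi> (y - t *\<^sub>R axis i 1) + t *\<^sub>R g i y - \<phi> y) / of_real t"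
        using t by (simp add: field_simps scaleR_conv_of_real)
      ultimately show ?thesis using t by (simp add: norm_divide divide_le_eq)
    qed
    have supp: "norm y \<le> R + 1" if "cmod ((\<phi> (y - t *\<^sub>R axis i 1) - \<phi> y) / of_real t + g i y) \<noteq> 0" for y
    proof -
      have "\<phi> (y - t *\<^sub>R axis i 1) \<noteq> 0 \<or> \<phi> y \<noteq> 0 \<or> g i y \<noteq> 0" using that by auto
      moreover have "norm y \<le> norm (y - t *\<^sub>R axis i 1) + \<bar>t\<bar>"
        using norm_triangle_ineq[of "y - t *\<^sub>R axis i 1" "t *\<^sub>R axis i 1"] by simp
      ultimately show ?thesis
        using R[of y] R(1)[of "y - t *\<^sub>R axis i 1"] t \<delta>(2) by force
    qed
    note * = integral_le_ball[where h="\<lambda>y. cmod ((\<phi> (y - t *\<^sub>R axis i 1) - \<phi> y) / of_real t + g i y)", OF _ le supp]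
    have "\<epsilon> / (c + 1) * c \<le> \<epsilon>"
      using \<open>c \<ge> 0\<close> \<open>0 < \<epsilon>\<close> by (simp add: field_simps)
    then show "integrable lborel (\<lambda>y. cmod ((\<phi> (y - t *\<^sub>R axis i 1) - \<phi> y) / of_real t + g i y)) \<and>
      (LINT y|lborel. cmod ((\<phi> (y - t *\<^sub>R axis i 1) - \<phi> y) / of_real t + g i y)) \<le> \<epsilon>"
      using * by (auto simp: c_def)
  qed
qed

section \<open>Stochastically smooth functions\<close>

lemma continuous_bounded_support_integrable:
  fixes f :: "real^'n \<Rightarrow> complex"
  assumes "continuous_on UNIV f" "\<And>x. f x \<noteq> 0 \<Longrightarrow> norm x \<le> R"
  shows "integrable lborel f"
proof -
  have "integrable lborel (\<lambda>x. indicator (cball 0 R) x *\<^sub>R f x)"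
    using borel_integrable_compact[of "cball 0 R" f] continuous_on_subset[OF assms(1)] by simp
  moreover have "indicator (cball 0 R) x *\<^sub>R f x = f x" for x
    using assms(2)[of x] by (cases "x \<in> cball 0 R") auto
  ultimately show ?thesis by simp
qed

section \<open>Displacement of sets under the flow\<close>

locale flow =
  fixes M :: "'w measure" and T :: "real^'n \<Rightarrow> 'w \<Rightarrow> 'w"
  assumes flow: "dynamical_system M T"
begin

sublocale prob_space M
  using flow by (simp add: dynamical_system_def)

lemma T_measurable [measurable]: "T x \<in> M \<rightarrow>\<^sub>M M"
  and T_distr: "distr M M (T x) = M"
  and T_add: "\<omega> \<in> space M \<Longrightarrow> T x (T y \<omega>) = T (x + y) \<omega>"
  and T_joint: "(\<lambda>(x, \<omega>). T x \<omega>) \<in> (lborel \<Otimes>\<^sub>M M) \<rightarrow>\<^sub>M M"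
  using flow by (simp_all add: dynamical_system_def)

lemma T_joint_compose [measurable (raw)]:
  assumes "f \<in> borel_measurable N" "g \<in> N \<rightarrow>\<^sub>M M"
  shows "(\<lambda>z. T (f z) (g z)) \<in> N \<rightarrow>\<^sub>M M"
  using measurable_compose[OF measurable_Pair[of f N lborel g M] T_joint] assms by simp

lemma T_integral:
  fixes f :: "'w \<Rightarrow> 'b::{banach, second_countable_topology}"
  assumes "f \<in> borel_measurable M"
  shows "(LINT \<omega>|M. f (T x \<omega>)) = (LINT \<omega>|M. f \<omega>)"
  using integral_distr[of "T x" M M f] assms T_distr[of x] by simp

sublocale joint: pair_sigma_finite M "lborel :: (real^'n) measure" ..

text \<open>The measure of the symmetric difference of C and its preimage under
  \<open>T y\<close>.\<close>

definition displacement :: "'w set \<Rightarrow> real^'n \<Rightarrow> real" where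
  "displacement C y = (LINT \<omega>|M. \<bar>indicator C (T y \<omega>) - indicator C \<omega>\<bar>)"

text \<open>By invariance the displacement is also the average over a unit box of the displacement along
  orbits, so that continuity of translations in \<open>L\<^sup>1(\<real>\<^sup>N)\<close> applies orbit by orbit.\<close>
lemma displacement_tendsto:
  assumes C [measurable]: "C \<in> sets M" and y: "y \<longlonglongrightarrow> 0"
  shows "(\<lambda>k. displacement C (y k)) \<longlonglongrightarrow> 0"
proof -
  let ?W = "box 0 One :: (real^'n) set"
  let ?I = "indicator C :: 'w \<Rightarrow> real"
  have W: "measure lborel ?W = 1" "emeasure lborel ?W < \<infinity>"
    by (simp_all add: measure_lborel_box_eq emeasure_lborel_box_eq)
  define inner where "inner k \<omega> = (LINT x|lborel. indicator ?W x * \<bar>?I (T (x + y k) \<omega>) - ?I (T x \<omega>)\<bar>)" for k \<omega>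
  have intW: "integrable lborel (indicator ?W :: real^'n \<Rightarrow> real)" using W by simp
  have eq: "displacement C (y k) = (LINT \<omega>|M. inner k \<omega>)" for k
  proof -
    define F where "F \<omega> x = indicator ?W x * \<bar>?I (T (x + y k) \<omega>) - ?I (T x \<omega>)\<bar>" for \<omega> x
    have [measurable]: "(\<lambda>(\<omega>, x). F \<omega> x) \<in> borel_measurable (M \<Otimes>\<^sub>M lborel)"
      unfolding F_def by measurable
    have "integrable (M \<Otimes>\<^sub>M lborel) (\<lambda>(\<omega>, x). indicator ?W x :: real)"
      using intW by (intro joint.Fubini_integrable) auto
    then have int: "integrable (M \<Otimes>\<^sub>M lborel) (\<lambda>(\<omega>, x). F \<omega> x)"
      by (rule Bochner_Integration.integrable_bound) (auto simp: F_def indicator_def)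
    have "(LINT \<omega>|M. F \<omega> x) = indicator ?W x * displacement C (y k)" for x
    proof -
      have "(LINT \<omega>|M. F \<omega> x) = indicator ?W x * (LINT \<omega>|M. \<bar>?I (T (x + y k) \<omega>) - ?I (T x \<omega>)\<bar>)"
        by (simp add: F_def)
      also have "(LINT \<omega>|M. \<bar>?I (T (x + y k) \<omega>) - ?I (T x \<omega>)\<bar>) = (LINT \<omega>|M. \<bar>?I (T (y k) (T x \<omega>)) - ?I (T x \<omega>)\<bar>)"
        by (intro Bochner_Integration.integral_cong) (simp_all add: T_add add.commute)
      also have "\<dots> = displacement C (y k)"
        unfolding displacement_def by (rule T_integral[where f="\<lambda>\<omega>. \<bar>?I (T (y k) \<omega>) - ?I \<omega>\<bar>"]) measurable
      finally show ?thesis .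
    qed
    then have "(LINT x|lborel. (LINT \<omega>|M. F \<omega> x)) = displacement C (y k)"
      using W by simp
    then show ?thesis
      using joint.Fubini_integral[OF int] unfolding inner_def F_def by simp
  qed
  have "(\<lambda>k. LINT \<omega>|M. inner k \<omega>) \<longlonglongrightarrow> (LINT \<omega>|M. 0)"
  proof (rule integral_dominated_convergence[where w="\<lambda>_. 1"])
    have [measurable]: "inner k \<in> borel_measurable M" for k
      unfolding inner_def by measurable
    then show "inner k \<in> borel_measurable M" for k .
    show "AE \<omega> in M. norm (inner k \<omega>) \<le> 1" for k
    proof (rule AE_I2)
      fix \<omega> assume "\<omega> \<in> space M"
      have "norm (inner k \<omega>) \<le> (LINT x|lborel. norm (indicator ?W x * \<bar>?I (T (x + y k) \<omega>) - ?I (T x \<omega>)\<bar>))"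
        unfolding inner_def by (rule integral_norm_bound)
      also have "\<dots> \<le> (LINT x|lborel. indicator ?W x)"
        by (intro integral_mono' intW) (auto simp: indicator_def)
      finally show "norm (inner k \<omega>) \<le> 1" using W by simp
    qed
    show "AE \<omega> in M. (\<lambda>k. inner k \<omega>) \<longlonglongrightarrow> 0"
    proof (rule AE_I2)
      fix \<omega> assume \<omega>: "\<omega> \<in> space M"
      have "(\<lambda>x. T x \<omega>) \<in> borel \<rightarrow>\<^sub>M M"
        using \<omega> by measurable
      then have [measurable]: "(\<lambda>x. ?I (T x \<omega>)) \<in> borel_measurable borel"
        by (rule measurable_compose) measurable
      obtain R where R: "\<And>x. x \<in> ?W \<Longrightarrow> norm x \<le> R"
        using bounded_box[of "0::real^'n" One] by (auto simp: bounded_iff)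
      \<comment> \<open>The cut-off makes the indicator along the orbit integrable. Its radius
        leaves room for translations shorter than 1, so f agrees with the orbit function at x and at
        x + y k for every x in the unit box.\<close>
      define f where "f x = complex_of_real (indicator (cball 0 (R + 1)) x * ?I (T x \<omega>))" for x
      have [measurable]: "cball (0::real^'n) (R + 1) \<in> sets borel" by simp
      have [measurable]: "f \<in> borel_measurable borel" unfolding f_def by measurable
      have "integrable lborel (indicator (cball 0 (R + 1)) :: real^'n \<Rightarrow> real)"
        using emeasure_bounded_finite[of "cball (0::real^'n) (R + 1)"] by (simp add: integrable_indicator_iff)
      then have "integrable lborel f"
        by (rule Bochner_Integration.integrable_bound) (auto simp: f_def indicator_def)
      show "(\<lambda>k. inner k \<omega>) \<longlonglongrightarrow> 0"
      proof (rule LIMSEQ_I)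
        fix \<epsilon> :: real assume "0 < \<epsilon>"
        obtain \<delta> where \<delta>: "0 < \<delta>" "\<And>z. norm z < \<delta> \<Longrightarrow> (LINT x|lborel. cmod (f (x + z) - f x)) < \<epsilon>"
          using translation_continuous_L1[OF \<open>integrable lborel f\<close> \<open>0 < \<epsilon>\<close>] by metis
        obtain K where K: "\<And>k. k \<ge> K \<Longrightarrow> norm (y k) < min \<delta> 1"
          using LIMSEQ_D[OF y, of "min \<delta> 1"] \<delta>(1) by auto
        have "norm (inner k \<omega> - 0) < \<epsilon>" if "k \<ge> K" for k
        proof -
          have le: "indicator ?W x * \<bar>?I (T (x + y k) \<omega>) - ?I (T x \<omega>)\<bar> \<le> cmod (f (x + y k) - f x)" for x
          proof (cases "x \<in> ?W")
            case True
            then have "norm x \<le> R + 1" "norm (x + y k) \<le> R + 1"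
              using R[OF True] K[OF that] norm_triangle_ineq[of x "y k"] by auto
            then have "f (x + y k) - f x = complex_of_real (?I (T (x + y k) \<omega>) - ?I (T x \<omega>))"
              unfolding f_def of_real_diff by simp
            then show ?thesis
              using True by (simp only: norm_of_real) simp
          qed simp
          have "0 \<le> inner k \<omega>" unfolding inner_def by (intro Bochner_Integration.integral_nonneg) auto
          moreover have "inner k \<omega> \<le> (LINT x|lborel. cmod (f (x + y k) - f x))"
            unfolding inner_def
            using le \<open>integrable lborel f\<close> lborel_integrable_translation[of f "y k"]
            by (intro integral_mono') auto
          moreover have "\<dots> < \<epsilon>" using \<delta>(2) K[OF that] by auto
          ultimately show ?thesis by simp
        qed
        then show "\<exists>K. \<forall>k\<ge>K. norm (inner k \<omega> - 0) < \<epsilon>" by blast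
      qed
    qed
  qed auto
  then show ?thesis by (simp add: eq)
qed

lemma displacement_small:
  assumes C: "C \<in> sets M" and "0 < \<epsilon>"
  obtains \<delta> where "0 < \<delta>" "\<And>y. norm y < \<delta> \<Longrightarrow> displacement C y < \<epsilon>"
proof (rule ccontr)
  assume "\<not> thesis"
  with that have "\<exists>y. norm y < \<delta> \<and> \<not> displacement C y < \<epsilon>" if "0 < \<delta>" for \<delta>
    using \<open>0 < \<delta>\<close> by blast
  then have "\<exists>y. norm y < inverse (real (Suc k)) \<and> \<not> displacement C y < \<epsilon>" for k
    by simp
  then obtain y where y: "\<And>k. norm (y k) < inverse (real (Suc k))" "\<And>k. \<not> displacement C (y k) < \<epsilon>"
    by metis
  have "y \<longlonglongrightarrow> 0"
    by (rule Lim_null_comparison[OF _ LIMSEQ_inverse_real_of_nat])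
      (intro always_eventually allI less_imp_le y(1))
  from displacement_tendsto[OF C this] have "\<forall>\<^sub>F k in sequentially. displacement C (y k) < \<epsilon>"
    using \<open>0 < \<epsilon>\<close> by (rule order_tendstoD)
  then show False using y(2) by (auto simp: eventually_sequentially)
qed

section \<open>Mollification along the flow\<close>

definition mollify :: "'w set \<Rightarrow> (real^'n \<Rightarrow> complex) \<Rightarrow> 'w \<Rightarrow> complex" where
  "mollify C \<phi> \<omega> = (LINT y|lborel. \<phi> y * indicator C (T y \<omega>))"

lemma mollify_measurable [measurable]:
  assumes [measurable]: "C \<in> sets M" "\<phi> \<in> borel_measurable borel"
  shows "mollify C \<phi> \<in> borel_measurable M"
  unfolding mollify_def by measurable

lemma integrable_mollify:
  fixes \<phi> :: "real^'n \<Rightarrow> complex"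
  assumes [measurable]: "C \<in> sets M" and \<omega>: "\<omega> \<in> space M" and \<phi>: "integrable lborel \<phi>"
  shows "integrable lborel (\<lambda>y. \<phi> y * indicator C (T y \<omega>))"
proof -
  have [measurable]: "(\<lambda>x. T x \<omega>) \<in> borel \<rightarrow>\<^sub>M M" using \<omega> by measurable
  have [measurable]: "\<phi> \<in> borel_measurable borel" using \<phi> by auto
  show ?thesis
    by (rule Bochner_Integration.integrable_bound[OF \<phi>]) (auto simp: indicator_def)
qed

lemma norm_mollify_le:
  assumes "integrable lborel \<phi>"
  shows "cmod (mollify C \<phi> \<omega>) \<le> (LINT y|lborel. cmod (\<phi> y))"
proof -
  have "cmod (mollify C \<phi> \<omega>) \<le> (LINT y|lborel. cmod (\<phi> y * indicator C (T y \<omega>)))"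
    unfolding mollify_def by (rule integral_norm_bound)
  also have "\<dots> \<le> (LINT y|lborel. cmod (\<phi> y))"
    using assms by (intro integral_mono') (auto simp: indicator_def)
  finally show ?thesis .
qed

lemma Linf_mollify:
  assumes "C \<in> sets M" "integrable lborel \<phi>"
  shows "Linf M (mollify C \<phi>)"
  unfolding Linf_def using assms norm_mollify_le[OF assms(2), of C]
  by (auto intro!: mollify_measurable)

text \<open>By the group law and translation invariance, a move along the flow acts on the kernel
  alone. Thus smoothness of the kernel becomes stochastic smoothness, however rough C is.\<close>

lemma mollify_translate:
  assumes [measurable]: "C \<in> sets M" "\<phi> \<in> borel_measurable borel" and \<omega>: "\<omega> \<in> space M"
  shows "mollify C \<phi> (T z \<omega>) = mollify C (\<lambda>y. \<phi> (y - z)) \<omega>"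
proof -
  have [measurable]: "(\<lambda>x. T x \<omega>) \<in> borel \<rightarrow>\<^sub>M M" using \<omega> by measurable
  have "mollify C \<phi> (T z \<omega>) = (LINT y|lborel. \<phi> ((y + z) - z) * indicator C (T (y + z) \<omega>))"
    unfolding mollify_def using \<omega> by (simp add: T_add)
  also have "\<dots> = mollify C (\<lambda>y. \<phi> (y - z)) \<omega>"
    unfolding mollify_def
    by (rule lborel_integral_translation[where f="\<lambda>y. \<phi> (y - z) * indicator C (T y \<omega>)"]) measurable
  finally show ?thesis .
qed

text \<open>The error of the difference quotient is itself a mollification, with the error of the
  quotient of the kernel as its kernel. Its supremum is at most the \<open>L\<^sup>1\<close> norm of
  that kernel, which \<open>partial_quotient_L1\<close> makes small.\<close>

lemma stoch_deriv_mollify: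
  assumes C [measurable]: "C \<in> sets M" and d: "has_partials \<phi> g" and cont: "continuous_on UNIV (g i)"
    and R: "\<And>x. \<phi> x \<noteq> 0 \<Longrightarrow> norm x \<le> R" "\<And>x. g i x \<noteq> 0 \<Longrightarrow> norm x \<le> R"
    and int: "integrable lborel \<phi>" "integrable lborel (g i)"
  shows "stoch_deriv M T i (mollify C \<phi>) (mollify C (\<lambda>y. - g i y))"
  unfolding stoch_deriv_def
proof (intro conjI allI impI)
  show "Linf M (mollify C (\<lambda>y. - g i y))" using C int by (intro Linf_mollify) auto
  fix \<epsilon> :: real assume "0 < \<epsilon>"
  have [measurable]: "\<phi> \<in> borel_measurable borel" "g i \<in> borel_measurable borel" using int by auto
  obtain \<delta> where \<delta>: "0 < \<delta>" "\<And>t. t \<noteq> 0 \<Longrightarrow> \<bar>t\<bar> < \<delta> \<Longrightarrow>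
    integrable lborel (\<lambda>y. cmod ((\<phi> (y - t *\<^sub>R axis i 1) - \<phi> y) / of_real t + g i y)) \<and>
    (LINT y|lborel. cmod ((\<phi> (y - t *\<^sub>R axis i 1) - \<phi> y) / of_real t + g i y)) \<le> \<epsilon>"
    using partial_quotient_L1[OF d cont R \<open>0 < \<epsilon>\<close>] by blast
  show "\<exists>\<delta>>0. \<forall>t. t \<noteq> 0 \<and> \<bar>t\<bar> < \<delta> \<longrightarrow> (AE \<omega> in M.
     cmod ((mollify C \<phi> (T (t *\<^sub>R axis i 1) \<omega>) - mollify C \<phi> \<omega>) / of_real t - mollify C (\<lambda>y. - g i y) \<omega>) \<le> \<epsilon>)"
  proof (intro exI[of _ \<delta>] conjI allI impI AE_I2 \<delta>(1); elim conjE)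
    fix t :: real and \<omega> assume t: "t \<noteq> 0" "\<bar>t\<bar> < \<delta>" and \<omega>: "\<omega> \<in> space M"
    let ?q = "\<lambda>y. (\<phi> (y - t *\<^sub>R axis i 1) - \<phi> y) / of_real t + g i y"
    have int': "integrable lborel (\<lambda>y. \<phi> (y - t *\<^sub>R axis i 1))"
      using int lborel_integrable_translation[of \<phi> "- (t *\<^sub>R axis i 1)"] by simp
    have ind: "(a - b) / c * k + m * k = (a * k - b * k) / c - (- m) * k" for a b c m k :: complex
      by (simp add: diff_divide_distrib left_diff_distrib)
    have "(mollify C \<phi> (T (t *\<^sub>R axis i 1) \<omega>) - mollify C \<phi> \<omega>) / of_real t - mollify C (\<lambda>y. - g i y) \<omega> = mollify C ?q \<omega>"
    proof -
      have "mollify C ?q \<omega> = (LINT y|lborel. (\<phi> (y - t *\<^sub>R axis i 1) * indicator C (T y \<omega>) - \<phi> y * indicator C (T y \<omega>)) / of_real t - (- g i y) * indicator C (T y \<omega>))"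
        unfolding mollify_def
        by (intro Bochner_Integration.integral_cong refl) (simp only: distrib_right ind)
      also have "\<dots> = ((LINT y|lborel. \<phi> (y - t *\<^sub>R axis i 1) * indicator C (T y \<omega>)) - (LINT y|lborel. \<phi> y * indicator C (T y \<omega>))) / of_real t - (LINT y|lborel. (- g i y) * indicator C (T y \<omega>))"
      proof -
        have i1: "integrable lborel (\<lambda>y. \<phi> (y - t *\<^sub>R axis i 1) * indicator C (T y \<omega>) - \<phi> y * indicator C (T y \<omega>))"
          by (intro Bochner_Integration.integrable_diff integrable_mollify[OF C \<omega>] int' int)
        have i2: "integrable lborel (\<lambda>y. (- g i y) * indicator C (T y \<omega>))"
          using int(2) by (intro integrable_mollify[OF C \<omega>]) auto
        show ?thesis
          unfolding Bochner_Integration.integral_diff[OF integrable_divide_zero[OF i1] i2] integral_divide_zero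
            Bochner_Integration.integral_diff[OF integrable_mollify[OF C \<omega> int'] integrable_mollify[OF C \<omega> int(1)]] ..
      qed
      finally show ?thesis
        using mollify_translate[OF C _ \<omega>, of \<phi> "t *\<^sub>R axis i 1"] by (simp add: mollify_def)
    qed
    moreover have "integrable lborel ?q" using int int' by auto
    then have "cmod (mollify C ?q \<omega>) \<le> (LINT y|lborel. cmod (?q y))"
      by (rule norm_mollify_le)
    ultimately show "cmod ((mollify C \<phi> (T (t *\<^sub>R axis i 1) \<omega>) - mollify C \<phi> \<omega>) / of_real t - mollify C (\<lambda>y. - g i y) \<omega>) \<le> \<epsilon>"
      using \<delta>(2)[OF t] by auto
  qed
qed

lemma stoch_smooth_mollify:
  assumes C: "C \<in> sets M" and \<phi>: "smooth_compact_support UNIV \<phi>"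
  shows "stoch_smooth M T (mollify C \<phi>)"
proof -
  obtain d where d: "d [] = \<phi>" "\<And>\<alpha>. has_partials (d \<alpha>) (\<lambda>i. d (i # \<alpha>))"
    and "compact (closure {x. \<phi> x \<noteq> 0})"
    using \<phi> unfolding smooth_compact_support_iff by metis
  then have "bounded (closure {x. \<phi> x \<noteq> 0})" by (auto dest: compact_imp_bounded)
  then obtain R where R: "\<And>x. x \<in> closure {x. \<phi> x \<noteq> 0} \<Longrightarrow> norm x \<le> R"
    by (auto simp: bounded_iff)
  have "closure {x. d \<alpha> x \<noteq> 0} \<subseteq> closure {x. \<phi> x \<noteq> 0}" for \<alpha>
  proof (induction \<alpha>)
    case (Cons i \<alpha>)
    then show ?case using has_partials_support[OF d(2), of i \<alpha>] by blast
  qed (simp add: d)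
  then have R': "norm x \<le> R" if "d \<alpha> x \<noteq> 0" for \<alpha> x
    using that R closure_subset[of "{x. d \<alpha> x \<noteq> 0}"] by blast
  have cont: "continuous_on UNIV (d \<alpha>)" for \<alpha> by (rule has_partials_continuous[OF d(2)])
  have int: "integrable lborel (d \<alpha>)" for \<alpha>
    using cont R' by (rule continuous_bounded_support_integrable)
  \<comment> \<open>Every stochastic derivative puts one more minus sign on the kernel, hence the
    power of -1.\<close>
  define D where "D \<alpha> = mollify C (\<lambda>y. (- 1) ^ length \<alpha> * d \<alpha> y)" for \<alpha>
  have "stoch_deriv M T i (D \<alpha>) (D (i # \<alpha>))" for i \<alpha>
  proof -
    have "has_partials (\<lambda>y. (- 1) ^ length \<alpha> * d \<alpha> y) (\<lambda>i y. (- 1) ^ length \<alpha> * d (i # \<alpha>) y)"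
      using d(2) unfolding has_partials_def
      by (auto simp: sum_distrib_left[symmetric] mult_scaleR_right[symmetric] simp del: mult_scaleR_right intro!: has_derivative_mult_right)
    moreover have c: "continuous_on UNIV (\<lambda>y. (- 1) ^ length \<alpha> * d (i # \<alpha>) y)"
      by (intro continuous_intros cont)
    ultimately have "stoch_deriv M T i (mollify C (\<lambda>y. (- 1) ^ length \<alpha> * d \<alpha> y))
        (mollify C (\<lambda>y. - ((- 1) ^ length \<alpha> * d (i # \<alpha>) y)))"
      by (rule stoch_deriv_mollify[OF C, where R=R]) (use R' int in auto)
    then show ?thesis by (simp add: D_def)
  qed
  moreover have "Linf M (D \<alpha>)" for \<alpha>
    unfolding D_def using int by (intro Linf_mollify[OF C]) auto
  moreover have "D [] = mollify C \<phi>" by (simp add: D_def d)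
  ultimately show ?thesis unfolding stoch_smooth_def by blast
qed

text \<open>By Fubini the integral of |indicator C - mollification| is at most the average of
  \<open>displacement C\<close> with weight \<rho>, and \<rho> lives where the displacement is below
  \<epsilon>/2. The difference is at most 1 and s \<ge> 1, so its s-th power is no larger than the
  difference itself.\<close>

lemma indicator_in_stoch_smooth_closure:
  assumes C [measurable]: "C \<in> sets M" and s: "1 \<le> s"
  shows "indicator C \<in> Lp_closure M s {\<psi>. stoch_smooth M T \<psi>}"
  unfolding Lp_closure_def
proof safe
  show "Lp M s (indicator C)" using s by (intro Lp_indicator) (auto simp: less_top[symmetric])
  fix \<epsilon> :: real assume "0 < \<epsilon>"
  then have "0 < \<epsilon> / 2" by simp
  obtain \<delta> where \<delta>: "0 < \<delta>" "\<And>y. norm y < \<delta> \<Longrightarrow> displacement C y < \<epsilon> / 2"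
    using displacement_small[OF C \<open>0 < \<epsilon> / 2\<close>] by metis
  obtain \<rho> :: "real^'n \<Rightarrow> real" where \<rho>: "smooth_compact_support UNIV (\<lambda>x. of_real (\<rho> x))" "\<And>x. 0 \<le> \<rho> x"
    "integrable lborel \<rho>" "(LINT x|lborel. \<rho> x) = 1" "\<And>x. \<rho> x \<noteq> 0 \<Longrightarrow> norm x < \<delta>"
    using mollifier_exists[OF \<delta>(1)] by metis
  let ?\<rho> = "\<lambda>x. complex_of_real (\<rho> x)"
  have [measurable]: "\<rho> \<in> borel_measurable borel" using \<rho>(3) by auto
  have int: "integrable lborel ?\<rho>" using \<rho>(3) by auto
  define F where "F \<omega> y = \<rho> y * \<bar>indicator C (T y \<omega>) - indicator C \<omega>\<bar>" for \<omega> y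
  have [measurable]: "(\<lambda>(\<omega>, y). F \<omega> y) \<in> borel_measurable (M \<Otimes>\<^sub>M lborel)"
    unfolding F_def by measurable
  have "integrable (M \<Otimes>\<^sub>M lborel) (\<lambda>(\<omega>, y). \<rho> y)"
    using \<rho>(3) by (intro joint.Fubini_integrable) auto
  then have intF: "integrable (M \<Otimes>\<^sub>M lborel) (\<lambda>(\<omega>, y). F \<omega> y)"
    by (rule Bochner_Integration.integrable_bound) (auto simp: F_def indicator_def)
  have diff: "cmod (indicator C \<omega> - mollify C ?\<rho> \<omega>) \<le> (LINT y|lborel. F \<omega> y)"
    and diff1: "cmod (indicator C \<omega> - mollify C ?\<rho> \<omega>) \<le> 1" if \<omega>: "\<omega> \<in> space M" for \<omega>
  proof -
    have "(LINT y|lborel. ?\<rho> y * indicator C \<omega>) = indicator C \<omega>"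
      using \<rho>(4) by simp
    then have "mollify C ?\<rho> \<omega> - indicator C \<omega> = (LINT y|lborel. ?\<rho> y * indicator C (T y \<omega>) - ?\<rho> y * indicator C \<omega>)"
      using integrable_mollify[OF C \<omega> int] int by (simp add: mollify_def)
    then have "cmod (mollify C ?\<rho> \<omega> - indicator C \<omega>) \<le> (LINT y|lborel. cmod (?\<rho> y * indicator C (T y \<omega>) - ?\<rho> y * indicator C \<omega>))"
      by simp
    also have "\<dots> = (LINT y|lborel. F \<omega> y)"
      using \<rho>(2) by (intro Bochner_Integration.integral_cong) (auto simp: F_def indicator_def)
    finally show *: "cmod (indicator C \<omega> - mollify C ?\<rho> \<omega>) \<le> (LINT y|lborel. F \<omega> y)"
      by (simp add: norm_minus_commute)
    also have "\<dots> \<le> (LINT y|lborel. \<rho> y)"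
      using \<rho>(2,3) by (intro integral_mono') (auto simp: F_def indicator_def)
    finally show "cmod (indicator C \<omega> - mollify C ?\<rho> \<omega>) \<le> 1" using \<rho>(4) by simp
  qed
  have L: "Lp M s (mollify C ?\<rho>)"
  proof (rule Lp_bound[where g="\<lambda>_. of_real (LINT y|lborel. cmod (?\<rho> y))"])
    show "mollify C ?\<rho> \<in> borel_measurable M" by measurable
    show "Lp M s (\<lambda>_. of_real (LINT y|lborel. cmod (?\<rho> y)))" by (simp add: Lp_def)
    show "AE \<omega> in M. cmod (mollify C ?\<rho> \<omega>) \<le> cmod (of_real (LINT y|lborel. cmod (?\<rho> y)))"
      using norm_mollify_le[OF int, of C] by (auto intro: order_trans[OF _ abs_ge_self])
  qed (use s in auto)
  have "(LINT \<omega>|M. cmod (indicator C \<omega> - mollify C ?\<rho> \<omega>) powr s) \<le> (LINT \<omega>|M. (LINT y|lborel. F \<omega> y))"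
  proof (rule integral_mono')
    show "integrable M (\<lambda>\<omega>. LINT y|lborel. F \<omega> y)"
      using joint.integrable_fst'[OF intF] by simp
    fix \<omega> assume \<omega>: "\<omega> \<in> space M"
    have "cmod (indicator C \<omega> - mollify C ?\<rho> \<omega>) powr s \<le> cmod (indicator C \<omega> - mollify C ?\<rho> \<omega>) powr 1"
      using diff1[OF \<omega>] s by (intro powr_mono') auto
    also have "\<dots> \<le> (LINT y|lborel. F \<omega> y)" using diff[OF \<omega>] by simp
    finally show "cmod (indicator C \<omega> - mollify C ?\<rho> \<omega>) powr s \<le> (LINT y|lborel. F \<omega> y)" .
    show "0 \<le> (LINT y|lborel. F \<omega> y)" using \<rho>(2) by (intro Bochner_Integration.integral_nonneg) (auto simp: F_def)
  qed
  also have "\<dots> = (LINT y|lborel. (LINT \<omega>|M. F \<omega> y))"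
    using joint.Fubini_integral[OF intF] by simp
  also have "\<dots> = (LINT y|lborel. \<rho> y * displacement C y)"
    by (simp add: F_def displacement_def)
  also have "\<dots> \<le> (LINT y|lborel. \<rho> y * (\<epsilon> / 2))"
  proof (rule integral_mono')
    show "integrable lborel (\<lambda>y. \<rho> y * (\<epsilon> / 2))" using \<rho>(3) by auto
    show "\<rho> y * displacement C y \<le> \<rho> y * (\<epsilon> / 2)" for y
      using \<rho>(2)[of y] \<rho>(5)[of y] \<delta>(2)[of y] by (cases "\<rho> y = 0") (auto intro!: mult_left_mono)
    show "0 \<le> \<rho> y * (\<epsilon> / 2)" for y using \<rho>(2)[of y] \<open>0 < \<epsilon>\<close> by simp
  qed
  also have "\<dots> < \<epsilon>" using \<rho>(4) \<open>0 < \<epsilon>\<close> by simp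
  finally show "\<exists>d\<in>{\<psi>. stoch_smooth M T \<psi>}. Lp M s d \<and> (LINT \<omega>|M. cmod (indicator C \<omega> - d \<omega>) powr s) < \<epsilon>"
    using L stoch_smooth_mollify[OF C \<rho>(1)] by blast
qed

end

section \<open>The Gelfand transformation\<close>

locale supralgebra =
  fixes A :: "(real^'n \<Rightarrow> complex) set"
  assumes A: "H_supralgebra A"
begin

lemma A_bcont: "u \<in> A \<Longrightarrow> bcont u"
  using A[unfolded H_supralgebra_def, THEN conjunct1] by blast

lemma A_const: "(\<lambda>_. c) \<in> A"
  using A[unfolded H_supralgebra_def, THEN conjunct2, THEN conjunct1] by blast

lemma A_add: "u \<in> A \<Longrightarrow> v \<in> A \<Longrightarrow> (\<lambda>y. u y + v y) \<in> A"
  and A_mult: "u \<in> A \<Longrightarrow> v \<in> A \<Longrightarrow> (\<lambda>y. u y * v y) \<in> A"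
  using A[unfolded H_supralgebra_def, THEN conjunct2, THEN conjunct2, THEN conjunct1] by simp_all

lemma A_scale: "u \<in> A \<Longrightarrow> (\<lambda>y. c * u y) \<in> A"
  using A[unfolded H_supralgebra_def, THEN conjunct2, THEN conjunct2, THEN conjunct2, THEN conjunct1]
  by simp

lemma A_cnj: "u \<in> A \<Longrightarrow> (\<lambda>y. cnj (u y)) \<in> A"
  using A[unfolded H_supralgebra_def, THEN conjunct2, THEN conjunct2, THEN conjunct2, THEN conjunct2,
      THEN conjunct1] by simp

lemma A_closed:
  assumes "bcont u" "\<And>e. 0 < e \<Longrightarrow> \<exists>a\<in>A. \<forall>y. cmod (u y - a y) \<le> e"
  shows "u \<in> A"
  using A[unfolded H_supralgebra_def, THEN conjunct2, THEN conjunct2, THEN conjunct2, THEN conjunct2,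
      THEN conjunct2, THEN conjunct1, THEN spec, of u] assms by simp

lemma A_mean: "u \<in> A \<Longrightarrow> \<exists>m. has_mean u m"
  using A[unfolded H_supralgebra_def, THEN conjunct2, THEN conjunct2, THEN conjunct2, THEN conjunct2,
      THEN conjunct2, THEN conjunct2] by blast

lemma A_continuous: "u \<in> A \<Longrightarrow> continuous_on UNIV u"
  using A_bcont by (auto simp: bcont_def)

lemma A_measurable: "u \<in> A \<Longrightarrow> u \<in> borel_measurable borel"
  using A_continuous by (rule borel_measurable_continuous_onI)

lemma A_bdd: "u \<in> A \<Longrightarrow> bdd_above (range (\<lambda>y. cmod (u y)))"
  using A_bcont[of u] by (auto simp: bcont_def bounded_iff bdd_above_def)

abbreviation sup_norm :: "(real^'n \<Rightarrow> complex) \<Rightarrow> real" where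
  "sup_norm u \<equiv> SUP y. cmod (u y)"

lemma norm_le_sup_norm: "u \<in> A \<Longrightarrow> cmod (u y) \<le> sup_norm u"
  using A_bdd by (rule cSUP_upper[OF UNIV_I])

lemma sup_norm_nonneg: "u \<in> A \<Longrightarrow> 0 \<le> sup_norm u"
  using norm_le_sup_norm[of u 0] by (rule order_trans[OF norm_ge_zero])

lemma sup_norm_le: "(\<And>y. cmod (u y) \<le> C) \<Longrightarrow> sup_norm u \<le> C"
  by (rule cSUP_least) auto

lemma A_power: "u \<in> A \<Longrightarrow> (\<lambda>y. u y ^ k) \<in> A"
  by (induction k) (auto intro: A_const A_mult)

text \<open>\<open>mean_value\<close> is a definite description, so uniqueness is the point. Testing
  with the indicator of the unit box, which has integral 1, exhibits the mean as a limit.\<close>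

lemma has_mean_mean_value: "u \<in> A \<Longrightarrow> has_mean u (mean_value u)"
proof -
  assume "u \<in> A"
  then obtain m where m: "has_mean u m" using A_mean by auto
  have "m' = m" if m': "has_mean u m'" for m'
  proof -
    let ?\<phi> = "\<lambda>x. of_real (indicator (box 0 One :: (real^'n) set) x) :: complex"
    have "integrable lborel (indicator (box 0 One :: (real^'n) set) :: _ \<Rightarrow> real)"
      by (simp add: emeasure_lborel_box_eq)
    then have int: "integrable lborel ?\<phi>" by (rule integrable_of_real)
    have 1: "(LINT x|lborel. ?\<phi> x) = 1"
      by (simp add: measure_lborel_box_eq)
    from m m' int show ?thesis
      using tendsto_unique[OF trivial_limit_at_right_real] unfolding has_mean_def 1[symmetric]
      by (metis (no_types, lifting) 1 mult.right_neutral)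
  qed
  with m show ?thesis unfolding mean_value_def by (metis theI)
qed

section \<open>Characters of the algebra\<close>

lemma
  assumes "s \<in> spectrum_alg A"
  shows spec_add: "u \<in> A \<Longrightarrow> v \<in> A \<Longrightarrow> s (\<lambda>y. u y + v y) = s u + s v"
    and spec_mult: "u \<in> A \<Longrightarrow> v \<in> A \<Longrightarrow> s (\<lambda>y. u y * v y) = s u * s v"
    and spec_scale: "u \<in> A \<Longrightarrow> s (\<lambda>y. c * u y) = c * s u"
    and spec_bounded: "\<exists>C. \<forall>u\<in>A. cmod (s u) \<le> C * sup_norm u"
    and spec_nonzero: "\<exists>u\<in>A. s u \<noteq> 0"
    and spec_outside: "u \<notin> A \<Longrightarrow> s u = 0"
  using assms unfolding spectrum_alg_def by blast+

lemma spec_one: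
  assumes "s \<in> spectrum_alg A"
  shows "s (\<lambda>_. 1) = 1"
proof -
  obtain u where u: "u \<in> A" "s u \<noteq> 0" using spec_nonzero[OF assms] by auto
  have "s (\<lambda>y. u y * 1) = s u * s (\<lambda>_. 1)"
    by (rule spec_mult[OF assms u(1) A_const])
  then show ?thesis using u by simp
qed

lemma spec_const:
  assumes "s \<in> spectrum_alg A"
  shows "s (\<lambda>_. c) = c"
  using spec_scale[OF assms A_const, of c 1] spec_one[OF assms] by simp

lemma spec_power:
  assumes "s \<in> spectrum_alg A" "u \<in> A"
  shows "s (\<lambda>y. u y ^ k) = s u ^ k"
  by (induction k) (auto simp: spec_one[OF assms(1)] spec_mult[OF assms(1,2) A_power[OF assms(2)]])

text \<open>The constant in the definition of the spectrum is irrelevant: apply the bound to powers.\<close>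
lemma spec_contractive:
  assumes s: "s \<in> spectrum_alg A" and u: "u \<in> A"
  shows "cmod (s u) \<le> sup_norm u"
proof (rule ccontr)
  assume "\<not> ?thesis"
  then have less: "sup_norm u < cmod (s u)" by simp
  obtain C where C: "\<And>u. u \<in> A \<Longrightarrow> cmod (s u) \<le> C * sup_norm u" using spec_bounded[OF s] by auto
  have nn: "0 \<le> sup_norm u" by (rule sup_norm_nonneg[OF u])
  have pos: "0 < cmod (s u)" using less nn by linarith
  have bound: "cmod (s u) ^ k \<le> \<bar>C\<bar> * sup_norm u ^ k" for k
  proof -
    have "cmod (s u) ^ k = cmod (s (\<lambda>y. u y ^ k))"
      by (simp add: spec_power[OF s u] norm_power)
    also have "\<dots> \<le> C * sup_norm (\<lambda>y. u y ^ k)" by (rule C[OF A_power[OF u]])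
    also have "\<dots> \<le> \<bar>C\<bar> * sup_norm (\<lambda>y. u y ^ k)"
      by (intro mult_right_mono sup_norm_nonneg A_power u) auto
    also have "\<dots> \<le> \<bar>C\<bar> * sup_norm u ^ k"
    proof (intro mult_left_mono sup_norm_le)
      show "cmod (u y ^ k) \<le> sup_norm u ^ k" for y
        unfolding norm_power by (intro power_mono norm_le_sup_norm u) auto
    qed auto
    finally show ?thesis .
  qed
  define \<rho> where "\<rho> = sup_norm u / cmod (s u)"
  have "1 \<le> \<bar>C\<bar> * \<rho> ^ k" for k
    using bound[of k] pos by (simp add: \<rho>_def power_divide field_simps)
  moreover have "(\<lambda>k. \<bar>C\<bar> * \<rho> ^ k) \<longlonglongrightarrow> \<bar>C\<bar> * 0"
    using less nn pos by (intro tendsto_intros LIMSEQ_power_zero) (auto simp: \<rho>_def)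
  ultimately have "1 \<le> \<bar>C\<bar> * (0::real)"
    by (intro LIMSEQ_le_const) auto
  then show False by simp
qed

text \<open>Arens' argument: contractivity applied to u + \<i> t, for all real t, bounds an affine
  function of t with slope 2 Im (s u) from above, so the slope is 0.\<close>

lemma spec_real:
  assumes s: "s \<in> spectrum_alg A" and u: "u \<in> A" and real: "\<And>y. Im (u y) = 0"
  shows "Im (s u) = 0"
proof (rule ccontr)
  assume ne: "Im (s u) \<noteq> 0"
  let ?c = "sup_norm u"
  have key: "(Im (s u) + t)\<^sup>2 \<le> ?c\<^sup>2 + t\<^sup>2" for t
  proof -
    let ?v = "\<lambda>y. u y + \<i> * of_real t"
    have vA: "?v \<in> A" by (intro A_add u A_const)
    have "s ?v = s u + \<i> * of_real t"
      using spec_add[OF s u A_const] spec_const[OF s] by simp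
    then have "Im (s u) + t = Im (s ?v)" by simp
    also have "\<bar>\<dots>\<bar> \<le> sup_norm ?v"
      using abs_Im_le_cmod spec_contractive[OF s vA] by (rule order_trans)
    also have "sup_norm ?v \<le> sqrt (?c\<^sup>2 + t\<^sup>2)"
    proof (rule sup_norm_le)
      fix y
      have "(Re (u y))\<^sup>2 \<le> ?c\<^sup>2"
        using norm_le_sup_norm[OF u, of y] abs_Re_le_cmod[of "u y"] by (intro abs_le_square_iff[THEN iffD1]) auto
      then show "cmod (?v y) \<le> sqrt (?c\<^sup>2 + t\<^sup>2)"
        by (simp add: cmod_def real)
    qed
    finally have "\<bar>Im (s u) + t\<bar> \<le> sqrt (?c\<^sup>2 + t\<^sup>2)" .
    then show ?thesis by (metis real_sqrt_abs real_sqrt_le_iff)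
  qed
  have "(Im (s u))\<^sup>2 + 2 * Im (s u) * t \<le> ?c\<^sup>2" for t
    using key[of t] by (simp add: power2_sum)
  \<comment> \<open>This t turns the term linear in t into the square of the norm plus 1, which
    exceeds the bound.\<close>
  from this[of "(?c\<^sup>2 + 1) / (2 * Im (s u))"]
  have "(Im (s u))\<^sup>2 + (?c\<^sup>2 + 1) \<le> ?c\<^sup>2" using ne by simp
  then show False using zero_le_power2[of "Im (s u)"] by linarith
qed

section \<open>Continuous functional calculus\<close>

lemma functional_calculus_poly:
  assumes u: "u \<in> A" and real: "\<And>y. Im (u y) = 0" and P: "real_polynomial_function P"
  shows "(\<lambda>y. of_real (P (Re (u y)))) \<in> A"
    and "s \<in> spectrum_alg A \<Longrightarrow> s (\<lambda>y. of_real (P (Re (u y)))) = of_real (P (Re (s u)))"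
proof -
  have "(\<lambda>y. complex_of_real (P (Re (u y)))) \<in> A \<and>
    (\<forall>s\<in>spectrum_alg A. s (\<lambda>y. of_real (P (Re (u y)))) = of_real (P (Re (s u))))"
    using P
  proof induction
    case (linear f)
    then have lin: "f x = f 1 * x" for x :: real
      using linear_cmul[of f x 1] by (auto simp: bounded_linear.linear mult.commute)
    have eq: "(\<lambda>y. complex_of_real (f (Re (u y)))) = (\<lambda>y. of_real (f 1) * u y)"
      using real by (subst lin) (auto simp: complex_eq_iff)
    show ?case
      unfolding eq
    proof (intro conjI ballI A_scale u)
      fix s assume s: "s \<in> spectrum_alg A"
      show "s (\<lambda>y. of_real (f 1) * u y) = of_real (f (Re (s u)))"
        using spec_real[OF s u real] by (subst lin) (auto simp: spec_scale[OF s u] complex_eq_iff)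
    qed
  next
    case (const c)
    then show ?case by (auto intro: A_const simp: spec_const)
  next
    case (add f g)
    then show ?case
      using A_add[of "\<lambda>y. of_real (f (Re (u y)))" "\<lambda>y. of_real (g (Re (u y)))"]
        spec_add[of _ "\<lambda>y. of_real (f (Re (u y)))" "\<lambda>y. of_real (g (Re (u y)))"] by simp
  next
    case (mult f g)
    then show ?case
      using A_mult[of "\<lambda>y. of_real (f (Re (u y)))" "\<lambda>y. of_real (g (Re (u y)))"]
        spec_mult[of _ "\<lambda>y. of_real (f (Re (u y)))" "\<lambda>y. of_real (g (Re (u y)))"] by simp
  qed
  then show "(\<lambda>y. of_real (P (Re (u y)))) \<in> A"
    and "s \<in> spectrum_alg A \<Longrightarrow> s (\<lambda>y. of_real (P (Re (u y)))) = of_real (P (Re (s u)))"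
    by auto
qed

text \<open>Polynomial approximation on the interval of radius \<open>sup_norm u\<close>, which
  contains the values of u and, by contractivity, also s u. Uniform closedness of A yields
  membership; contractivity of s carries the identity from polynomials to F.\<close>

lemma functional_calculus:
  assumes u: "u \<in> A" and real: "\<And>y. Im (u y) = 0" and F: "continuous_on UNIV F"
  shows "(\<lambda>y. of_real (F (Re (u y)))) \<in> A"
    and "s \<in> spectrum_alg A \<Longrightarrow> s (\<lambda>y. of_real (F (Re (u y)))) = of_real (F (Re (s u)))"
proof -
  let ?K = "{- sup_norm u..sup_norm u}"
  let ?F = "\<lambda>y. complex_of_real (F (Re (u y)))"
  have uK: "Re (u y) \<in> ?K" for y
    using norm_le_sup_norm[OF u, of y] abs_Re_le_cmod[of "u y"] by auto
  have FK: "continuous_on ?K F" using F by (rule continuous_on_subset) auto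
  have approx: "\<exists>P. real_polynomial_function P \<and> (\<forall>x\<in>?K. \<bar>F x - P x\<bar> < e)" if "0 < e" for e
  proof (rule Stone_Weierstrass_real_polynomial_function[OF compact_Icc FK that])
    fix P assume "real_polynomial_function P" "\<And>x. x \<in> ?K \<Longrightarrow> \<bar>F x - P x\<bar> < e"
    then show ?thesis by (intro exI[of _ P] conjI ballI)
  qed
  show FA: "?F \<in> A"
  proof (rule A_closed)
    have "compact (F ` ?K)" by (intro compact_continuous_image FK compact_Icc)
    then have "bounded (F ` ?K)" by (rule compact_imp_bounded)
    then obtain B where B: "\<And>z. z \<in> F ` ?K \<Longrightarrow> norm z \<le> B"
      unfolding bounded_iff by blast
    have "cmod (?F y) \<le> B" for y
      using B[OF imageI[OF uK[of y]]] by simp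
    then have "bounded (range ?F)"
      unfolding bounded_iff by blast
    moreover have "continuous_on UNIV ?F"
      by (intro continuous_intros continuous_on_compose2[OF F] A_continuous u) auto
    ultimately show "bcont ?F" by (simp add: bcont_def)
    fix e :: real assume "0 < e"
    from approx[OF this] obtain P where P: "real_polynomial_function P" "\<forall>x\<in>?K. \<bar>F x - P x\<bar> < e"
      by (elim exE conjE)
    have "cmod (?F y - of_real (P (Re (u y)))) \<le> e" for y
      using bspec[OF P(2) uK[of y]] by (simp flip: of_real_diff)
    then show "\<exists>a\<in>A. \<forall>y. cmod (?F y - a y) \<le> e"
      by (intro bexI[OF _ functional_calculus_poly(1)[OF u real P(1)]] allI)
  qed
  assume s: "s \<in> spectrum_alg A"
  have sK: "Re (s u) \<in> ?K"
    using spec_contractive[OF s u] abs_Re_le_cmod[of "s u"] by auto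
  have "cmod (s ?F - of_real (F (Re (s u)))) \<le> 2 * e" if "0 < e" for e
  proof -
    from approx[OF that] obtain P where P: "real_polynomial_function P" "\<forall>x\<in>?K. \<bar>F x - P x\<bar> < e"
      by (elim exE conjE)
    let ?P = "\<lambda>y. complex_of_real (P (Re (u y)))"
    have PA: "?P \<in> A" "(\<lambda>y. - 1 * ?P y) \<in> A"
      by (intro functional_calculus_poly(1)[OF u real P(1)] A_scale)+
    have dA: "(\<lambda>y. ?F y + - 1 * ?P y) \<in> A" by (intro A_add FA PA)
    have "s ?F - s ?P = s (\<lambda>y. ?F y + - 1 * ?P y)"
      unfolding spec_add[OF s FA PA(2)] spec_scale[OF s PA(1)] by simp
    also have "cmod \<dots> \<le> sup_norm (\<lambda>y. ?F y + - 1 * ?P y)"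
      by (rule spec_contractive[OF s dA])
    also have "\<dots> \<le> e"
    proof (rule sup_norm_le)
      show "cmod (?F y + - 1 * ?P y) \<le> e" for y
        using bspec[OF P(2) uK[of y]] by (simp flip: of_real_diff)
    qed
    finally have "cmod (s ?F - s ?P) \<le> e" .
    moreover have "cmod (s ?P - of_real (F (Re (s u)))) \<le> e"
      unfolding functional_calculus_poly(2)[OF u real P(1) s]
      using bspec[OF P(2) sK] by (simp flip: of_real_diff)
    ultimately show ?thesis
      using norm_triangle_ineq[of "s ?F - s ?P" "s ?P - of_real (F (Re (s u)))"] by simp
  qed
  \<comment> \<open>With e equal to a quarter of the distance d, the bound says d \<le> d /
    2.\<close>
  from this[of "cmod (s ?F - of_real (F (Re (s u)))) / 4"]
  show "s ?F = of_real (F (Re (s u)))"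
    by (cases "s ?F = of_real (F (Re (s u)))") (auto simp: field_simps)
qed

lemma A_Re: "u \<in> A \<Longrightarrow> (\<lambda>y. of_real (Re (u y))) \<in> A"
proof -
  assume u: "u \<in> A"
  have "(\<lambda>y. (1 / 2) * (u y + cnj (u y))) \<in> A" by (intro A_scale A_add u A_cnj)
  then show ?thesis by (simp add: complex_add_cnj)
qed

lemma A_Im: "u \<in> A \<Longrightarrow> (\<lambda>y. of_real (Im (u y))) \<in> A"
proof -
  assume u: "u \<in> A"
  have "(\<lambda>y. of_real (Re (- \<i> * u y))) \<in> A" by (intro A_Re A_scale u)
  then show ?thesis by simp
qed

lemma spec_Re_Im:
  assumes s: "s \<in> spectrum_alg A" and u: "u \<in> A"
  shows "s u = s (\<lambda>y. of_real (Re (u y))) + \<i> * s (\<lambda>y. of_real (Im (u y)))"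
proof -
  have "u = (\<lambda>y. of_real (Re (u y)) + \<i> * of_real (Im (u y)))"
    by (auto simp: complex_eq_iff)
  then have "s u = s (\<lambda>y. of_real (Re (u y)) + \<i> * of_real (Im (u y)))" by metis
  also have "\<dots> = s (\<lambda>y. of_real (Re (u y))) + \<i> * s (\<lambda>y. of_real (Im (u y)))"
    using spec_add[OF s A_Re[OF u] A_scale[OF A_Im[OF u], of \<i>]] spec_scale[OF s A_Im[OF u], of \<i>] by simp
  finally show ?thesis .
qed

text \<open>A character takes real values at the real and imaginary parts of u, and it is
  linear.\<close>

lemma spec_cnj:
  assumes s: "s \<in> spectrum_alg A" and u: "u \<in> A"
  shows "s (\<lambda>y. cnj (u y)) = cnj (s u)"
proof -
  have r: "Im (s (\<lambda>y. of_real (Re (u y)))) = 0" "Im (s (\<lambda>y. of_real (Im (u y)))) = 0"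
    by (intro spec_real[OF s] A_Re A_Im u; simp)+
  have "s (\<lambda>y. of_real (- Im (u y))) = - s (\<lambda>y. of_real (Im (u y)))"
    using spec_scale[OF s A_Im[OF u], of "-1"] by simp
  then show ?thesis
    using spec_Re_Im[OF s A_cnj[OF u]] spec_Re_Im[OF s u] r by (simp add: complex_eq_iff)
qed

text \<open>The calculus is for real elements, so it is applied to u times its conjugate, with the
  power p / 2. The maximum in F makes F continuous on the whole line without changing it at the
  values that occur.\<close>

lemma A_norm_powr:
  assumes u: "u \<in> A" and p: "0 < p"
  shows "(\<lambda>y. of_real (cmod (u y) powr p)) \<in> A"
    and "s \<in> spectrum_alg A \<Longrightarrow> s (\<lambda>y. of_real (cmod (u y) powr p)) = of_real (cmod (s u) powr p)"
proof -
  define F where "F t = (max t 0) powr (p / 2)" for t :: real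
  have F: "continuous_on UNIV F"
    unfolding F_def using p by (intro continuous_on_powr' continuous_intros) auto
  have uu: "(\<lambda>y. u y * cnj (u y)) \<in> A" by (intro A_mult A_cnj u)
  have F_cmod: "F (Re (z * cnj z)) = cmod z powr p" for z
  proof -
    have "Re (z * cnj z) = cmod z powr 2"
      by (metis Re_complex_of_real complex_norm_square norm_ge_zero powr_numeral)
    then have "F (Re (z * cnj z)) = (cmod z powr 2) powr (p / 2)" by (simp only: F_def) simp
    then show ?thesis by (simp only: powr_powr) simp
  qed
  have im: "Im (u y * cnj (u y)) = 0" for y by simp
  note fc = functional_calculus[OF uu im F, unfolded F_cmod]
  show "(\<lambda>y. of_real (cmod (u y) powr p)) \<in> A" by (rule fc(1))
  assume s: "s \<in> spectrum_alg A"
  have "s (\<lambda>y. u y * cnj (u y)) = s u * cnj (s u)"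
    by (simp only: spec_mult[OF s u A_cnj[OF u]] spec_cnj[OF s u])
  then show "s (\<lambda>y. of_real (cmod (u y) powr p)) = of_real (cmod (s u) powr p)"
    using fc(2)[OF s] by (simp only: F_cmod)
qed

end

section \<open>Separation in the product topology\<close>

lemma open_vimage_coordinate:
  fixes W :: "'b::topological_space set"
  assumes "open W"
  shows "open ((\<lambda>f :: 'a \<Rightarrow> 'b. f i) -` W)"
  using assms by (intro open_vimage continuous_on_product_coordinates)

instance "fun" :: (type, t0_space) t0_space
proof
  fix x y :: "'a \<Rightarrow> 'b" assume "x \<noteq> y"
  then obtain i where "x i \<noteq> y i" by auto
  from t0_space_class.t0_space[OF this] obtain U where "open U" "\<not> (x i \<in> U \<longleftrightarrow> y i \<in> U)"
    by (elim exE conjE)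
  then show "\<exists>U. open U \<and> \<not> (x \<in> U \<longleftrightarrow> y \<in> U)"
    by (intro exI[of _ "(\<lambda>f. f i) -` U"]) (auto intro: open_vimage_coordinate)
qed

instance "fun" :: (type, t1_space) t1_space
proof
  fix x y :: "'a \<Rightarrow> 'b" assume "x \<noteq> y"
  then obtain i where "x i \<noteq> y i" by auto
  from t1_space[OF this] obtain U where "open U" "x i \<in> U" "y i \<notin> U"
    by (elim exE conjE)
  then show "\<exists>U. open U \<and> x \<in> U \<and> y \<notin> U"
    by (intro exI[of _ "(\<lambda>f. f i) -` U"]) (auto intro: open_vimage_coordinate)
qed

text \<open>Characters are points of a function space. The Hausdorff property makes compact sets of
  characters closed and therefore measurable for \<beta>.\<close>

instance "fun" :: (type, t2_space) t2_space
proof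
  fix x y :: "'a \<Rightarrow> 'b" assume "x \<noteq> y"
  then obtain i where "x i \<noteq> y i" by auto
  from hausdorff[OF this] obtain U V where "open U" "open V" "x i \<in> U" "y i \<in> V" "U \<inter> V = {}"
    by (elim exE conjE)
  then show "\<exists>U V. open U \<and> open V \<and> x \<in> U \<and> y \<in> V \<and> U \<inter> V = {}"
    by (intro exI[of _ "(\<lambda>f. f i) -` U"] exI[of _ "(\<lambda>f. f i) -` V"])
      (auto intro: open_vimage_coordinate)
qed

section \<open>Density of the Gelfand transforms\<close>

locale gelfand = supralgebra A for A :: "(real^'n \<Rightarrow> complex) set" +
  fixes \<beta> :: "((real^'n \<Rightarrow> complex) \<Rightarrow> complex) measure"
  assumes gelfand: "gelfand_measure A \<beta>"
begin

sublocale \<beta>: prob_space \<beta>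
  using gelfand by (simp add: gelfand_measure_def)

lemma sets_\<beta>: "sets \<beta> = sets (restrict_space borel (spectrum_alg A))"
  using gelfand by (simp add: gelfand_measure_def)

lemma space_\<beta>: "space \<beta> = spectrum_alg A"
  using sets_eq_imp_space_eq[OF sets_\<beta>] by (simp add: space_restrict_space)

lemma integrable_hat: "u \<in> A \<Longrightarrow> integrable \<beta> (\<lambda>s. s u)"
  and integral_hat: "u \<in> A \<Longrightarrow> (LINT s|\<beta>. s u) = mean_value u"
  using gelfand[unfolded gelfand_measure_def, THEN conjunct2, THEN conjunct2, THEN conjunct2] by auto

lemma hat_measurable: "u \<in> A \<Longrightarrow> (\<lambda>s. s u) \<in> borel_measurable \<beta>"
  by (rule borel_measurable_integrable[OF integrable_hat])

lemma hat_bounded: "u \<in> A \<Longrightarrow> s \<in> space \<beta> \<Longrightarrow> cmod (s u) \<le> sup_norm u"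
  unfolding space_\<beta> by (rule spec_contractive)

lemma compact_sets_\<beta>:
  assumes "compact K" "K \<subseteq> spectrum_alg A"
  shows "K \<in> sets \<beta>"
proof -
  have "K \<in> sets borel" using assms(1) by (intro borel_closed compact_imp_closed)
  then show ?thesis
    unfolding sets_\<beta> using assms(2) by (auto simp: sets_restrict_space)
qed

lemma inner_regular:
  assumes B: "B \<in> sets \<beta>" and "0 < \<delta>"
  obtains K where "K \<subseteq> B" "compact K" "\<beta>.prob (B - K) < \<delta>"
proof (cases "\<beta>.prob B = 0")
  case True
  then show thesis using that[of "{}"] \<open>0 < \<delta>\<close> by simp
next
  case False
  then have pos: "0 < \<beta>.prob B" by (simp add: zero_less_measure_iff)
  have "ennreal (\<beta>.prob B - \<delta>) < ennreal (\<beta>.prob B)"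
    using pos \<open>0 < \<delta>\<close> by (simp add: ennreal_less_iff ennreal_lessI)
  also have "\<dots> = emeasure \<beta> B" by (simp add: \<beta>.emeasure_eq_measure)
  also have "\<dots> = (SUP K \<in> {K. K \<subseteq> B \<and> compact K}. emeasure \<beta> K)"
    using gelfand[unfolded gelfand_measure_def, THEN conjunct2, THEN conjunct2, THEN conjunct1] B by blast
  finally obtain K where K: "K \<subseteq> B" "compact K" "ennreal (\<beta>.prob B - \<delta>) < emeasure \<beta> K"
    by (auto simp: less_SUP_iff)
  have "B \<subseteq> spectrum_alg A" using sets.sets_into_space[OF B] space_\<beta> by simp
  then have "K \<in> sets \<beta>" using K by (intro compact_sets_\<beta>) auto
  then have "\<beta>.prob (B - K) = \<beta>.prob B - \<beta>.prob K"
    using B K by (intro \<beta>.finite_measure_Diff) auto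
  \<comment> \<open>\<open>ennreal\<close> truncates negative numbers to 0, so the inequality for K
    has to be read differently when \<delta> exceeds the measure of B.\<close>
  moreover have "\<beta>.prob B - \<delta> < \<beta>.prob K"
  proof (cases "\<beta>.prob B - \<delta> < 0")
    case True
    then show ?thesis using measure_nonneg[of \<beta> K] by linarith
  next
    case False
    then show ?thesis using K(3) by (simp add: \<beta>.emeasure_eq_measure ennreal_less_iff)
  qed
  ultimately have "\<beta>.prob (B - K) < \<delta>" by simp
  then show thesis using that K by blast
qed

text \<open>The separation lemma behind Stone-Weierstrass, applied on the compact set K \<union> K'
  to the ring of functions that agree there with transforms of real elements of A. It says nothing
  about the rest of the spectrum; the bounds there come from a truncation at the end.\<close>

lemma separating_element:
  assumes K: "compact K" "compact K'" "K \<inter> K' = {}" "K \<subseteq> spectrum_alg A" "K' \<subseteq> spectrum_alg A"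
    and e: "0 < e" "e < 1"
  shows "\<exists>u\<in>A. (\<forall>s\<in>spectrum_alg A. \<exists>t. s u = of_real t \<and> 0 \<le> t \<and> t \<le> 1) \<and>
    (\<forall>s\<in>K. cmod (1 - s u) \<le> e) \<and> (\<forall>s\<in>K'. cmod (s u) \<le> e)"
proof -
  let ?S = "K \<union> K'"
  define R where "R = {f. \<exists>u\<in>A. (\<forall>y. Im (u y) = 0) \<and> (\<forall>s\<in>?S. f s = Re (s u))}"
  have S: "s \<in> spectrum_alg A" if "s \<in> ?S" for s using K that by auto
  interpret function_ring_on R ?S
  proof
    show "compact ?S" using K by (intro compact_Un)
  next
    fix f assume "f \<in> R"
    then obtain u where u: "\<And>s. s \<in> ?S \<Longrightarrow> f s = Re (s u)" unfolding R_def by blast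
    have "continuous_on ?S (\<lambda>s. Re (s u))"
      by (intro continuous_intros continuous_on_subset[OF continuous_on_product_coordinates]) auto
    moreover have "continuous_on ?S f \<longleftrightarrow> continuous_on ?S (\<lambda>s. Re (s u))"
      by (rule continuous_on_cong[OF refl]) (rule u)
    ultimately show "continuous_on ?S f" by simp
  next
    fix f g assume "f \<in> R" "g \<in> R"
    then obtain u v where u: "u \<in> A" "\<And>y. Im (u y) = 0" "\<And>s. s \<in> ?S \<Longrightarrow> f s = Re (s u)"
      and v: "v \<in> A" "\<And>y. Im (v y) = 0" "\<And>s. s \<in> ?S \<Longrightarrow> g s = Re (s v)"
      unfolding R_def by blast
    show "(\<lambda>s. f s + g s) \<in> R"
      unfolding R_def
    proof (intro CollectI bexI[of _ "\<lambda>y. u y + v y"] conjI allI ballI A_add u(1) v(1))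
      fix s assume s: "s \<in> ?S"
      show "f s + g s = Re (s (\<lambda>y. u y + v y))"
        using spec_add[OF S[OF s] u(1) v(1)] u(3)[OF s] v(3)[OF s] by simp
    qed (simp add: u(2) v(2))
    show "(\<lambda>s. f s * g s) \<in> R"
      unfolding R_def
    proof (intro CollectI bexI[of _ "\<lambda>y. u y * v y"] conjI allI ballI A_mult u(1) v(1))
      fix s assume s: "s \<in> ?S"
      show "f s * g s = Re (s (\<lambda>y. u y * v y))"
        using spec_mult[OF S[OF s] u(1) v(1)] spec_real[OF S[OF s] u(1,2)] u(3)[OF s] v(3)[OF s] by simp
    qed (simp add: u(2) v(2))
  next
    fix c :: real
    show "(\<lambda>_. c) \<in> R"
      unfolding R_def
    proof (intro CollectI bexI[of _ "\<lambda>_. of_real c"] conjI allI ballI A_const)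
      fix s assume s: "s \<in> ?S"
      show "c = Re (s (\<lambda>_. of_real c))" using spec_const[OF S[OF s]] by simp
    qed simp
  next
    fix s s' assume s: "s \<in> ?S" "s' \<in> ?S" "s \<noteq> s'"
    then obtain u where ne: "s u \<noteq> s' u" by auto
    \<comment> \<open>Both characters are 0 outside A by convention, so they can differ only on
      A.\<close>
    have u: "u \<in> A"
    proof (rule ccontr)
      assume "u \<notin> A"
      then show False using spec_outside[OF S[OF s(1)]] spec_outside[OF S[OF s(2)]] ne by simp
    qed
    have re: "(\<lambda>s. Re (s (\<lambda>y. of_real (Re (u y))))) \<in> R" "(\<lambda>s. Re (s (\<lambda>y. of_real (Im (u y))))) \<in> R"
      unfolding R_def using A_Re[OF u] A_Im[OF u] by force+
    have im: "Im (s (\<lambda>y. of_real (Re (u y)))) = 0" "Im (s (\<lambda>y. of_real (Im (u y)))) = 0" if "s \<in> ?S" for s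
      by (intro spec_real[OF S[OF that]] A_Re A_Im u; simp)+
    have "Re (s (\<lambda>y. of_real (Re (u y)))) \<noteq> Re (s' (\<lambda>y. of_real (Re (u y)))) \<or>
        Re (s (\<lambda>y. of_real (Im (u y)))) \<noteq> Re (s' (\<lambda>y. of_real (Im (u y))))"
    proof (rule ccontr)
      assume "\<not> ?thesis"
      then have "s (\<lambda>y. of_real (Re (u y))) = s' (\<lambda>y. of_real (Re (u y)))"
          "s (\<lambda>y. of_real (Im (u y))) = s' (\<lambda>y. of_real (Im (u y)))"
        using im[OF s(1)] im[OF s(2)] by (simp_all add: complex_eq_iff)
      then show False
        using spec_Re_Im[OF S[OF s(1)] u] spec_Re_Im[OF S[OF s(2)] u] ne by simp
    qed
    then show "\<exists>f\<in>R. f s \<noteq> f s'"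
      by (elim disjE) (rule bexI[OF _ re(1)], assumption, rule bexI[OF _ re(2)], assumption)
  qed
  have "closed K'" "K' \<subseteq> ?S" "closed K" "K \<subseteq> ?S" "K' \<inter> K = {}"
    using K by (auto intro: compact_imp_closed)
  from two[OF this e] obtain f where f: "f \<in> R" "f ` ?S \<subseteq> {0..1}" "\<forall>s\<in>K'. f s < e" "\<forall>s\<in>K. f s > 1 - e"
    by (elim bexE conjE)
  from f(1)[unfolded R_def] obtain u where u: "u \<in> A" "\<forall>y. Im (u y) = 0" "\<forall>s\<in>?S. f s = Re (s u)"
    by (elim CollectE bexE conjE)
  \<comment> \<open>Truncation to [0, 1] by the functional calculus: it bounds the transform on the
    whole spectrum and leaves the values on K \<union> K' unchanged.\<close>
  define F where "F t = max 0 (min 1 t)" for t :: real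
  have F: "continuous_on UNIV F" unfolding F_def by (intro continuous_intros)
  let ?w = "\<lambda>y. complex_of_real (F (Re (u y)))"
  note w = functional_calculus[OF u(1) spec[OF u(2)] F]
  have wS: "s ?w = of_real (f s)" if "s \<in> ?S" for s
  proof -
    have "f s \<in> {0..1}" using f(2) that by auto
    then show ?thesis using w(2)[OF S[OF that]] bspec[OF u(3) that] by (simp add: F_def)
  qed
  show ?thesis
  proof (intro bexI[OF _ w(1)] conjI ballI)
    fix s assume "s \<in> spectrum_alg A"
    from w(2)[OF this] show "\<exists>t. s ?w = of_real t \<and> 0 \<le> t \<and> t \<le> 1"
      by (intro exI[of _ "F (Re (s u))"]) (simp add: F_def)
  next
    fix s assume s: "s \<in> K"
    have "1 - s ?w = complex_of_real (1 - f s)" using wS[of s] s by simp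
    then have "cmod (1 - s ?w) = \<bar>1 - f s\<bar>" by (simp only: norm_of_real)
    moreover have "f s \<le> 1" using f(2) s by auto
    ultimately show "cmod (1 - s ?w) \<le> e" using bspec[OF f(4) s] by simp
  next
    fix s assume s: "s \<in> K'"
    have "0 \<le> f s" using f(2) s by auto
    then show "cmod (s ?w) \<le> e" using wS[of s] s bspec[OF f(3) s] by simp
  qed
qed

text \<open>Inner regularity gives a compact set inside B and one inside its complement, and the
  separating element is close to the indicator of B on both. On the small remainder the error is at
  most 1, because the transform takes its values in [0, 1].\<close>

lemma indicator_in_hat_closure:
  assumes B: "B \<in> sets \<beta>" and p: "1 \<le> p"
  shows "indicator B \<in> Lp_closure \<beta> p {\<lambda>s. s u |u. u \<in> A}"
  unfolding Lp_closure_def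
proof safe
  show "Lp \<beta> p (indicator B)" using B p by (intro Lp_indicator) (auto simp: less_top[symmetric])
  fix \<delta> :: real assume "0 < \<delta>"
  \<comment> \<open>The total error is below 3 e, which is less than \<delta>; the bound 1 / 2 is
    there because the separating element needs e < 1.\<close>
  define e where "e = min (\<delta> / 4) (1 / 2)"
  have e: "0 < e" "e < 1" "e \<le> \<delta> / 4" using \<open>0 < \<delta>\<close> by (auto simp: e_def)
  obtain K where K: "K \<subseteq> B" "compact K" "\<beta>.prob (B - K) < e"
    using inner_regular[OF B e(1)] by metis
  have B': "space \<beta> - B \<in> sets \<beta>" using B by auto
  obtain K' where K': "K' \<subseteq> space \<beta> - B" "compact K'" "\<beta>.prob (space \<beta> - B - K') < e"
    using inner_regular[OF B' e(1)] by metis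
  have sub: "K \<subseteq> spectrum_alg A" "K' \<subseteq> spectrum_alg A" "K \<inter> K' = {}"
    using K K' sets.sets_into_space[OF B] space_\<beta> by auto
  from separating_element[OF K(2) K'(2) sub(3,1,2) e(1,2)]
  obtain u where u: "u \<in> A" "\<forall>s\<in>spectrum_alg A. \<exists>t. s u = of_real t \<and> 0 \<le> t \<and> t \<le> 1"
    "\<forall>s\<in>K. cmod (1 - s u) \<le> e" "\<forall>s\<in>K'. cmod (s u) \<le> e"
    by (elim bexE conjE)
  note [measurable] = hat_measurable[OF u(1)] B compact_sets_\<beta>[OF K(2) sub(1)] compact_sets_\<beta>[OF K'(2) sub(2)]
  let ?g = "\<lambda>s. e + indicator (B - K) s + indicator (space \<beta> - B - K') s"
  have bound: "cmod (indicator B s - s u) powr p \<le> ?g s" if s: "s \<in> space \<beta>" for s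
  proof -
    obtain t where t: "s u = of_real t" "0 \<le> t" "t \<le> 1" using bspec[OF u(2), of s] s space_\<beta> by auto
    have eq: "cmod (indicator B s - s u) = \<bar>indicator B s - t\<bar>"
    proof -
      have "indicator B s - s u = complex_of_real (indicator B s - t)"
        unfolding t(1) by (cases "s \<in> B") simp_all
      then show ?thesis by (simp only: norm_of_real)
    qed
    have le1: "\<bar>indicator B s - t\<bar> \<le> 1" using t by (cases "s \<in> B") auto
    have "cmod (indicator B s - s u) powr p \<le> cmod (indicator B s - s u) powr 1"
      using p le1 eq by (intro powr_mono') auto
    also have "\<dots> \<le> ?g s"
    proof -
      consider "s \<in> K" | "s \<in> K'" | "s \<in> B - K" | "s \<in> space \<beta> - B - K'" using s by blast
      then show ?thesis
      proof cases
        case 1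
        then show ?thesis using bspec[OF u(3) 1] K by (auto simp: indicator_def)
      next
        case 2
        then show ?thesis using bspec[OF u(4) 2] K' by (auto simp: indicator_def)
      next
        case 3
        then show ?thesis using le1 eq e by simp
      next
        case 4
        then show ?thesis using le1 eq e by simp
      qed
    qed
    finally show ?thesis .
  qed
  have "integrable \<beta> (indicator (B - K) :: _ \<Rightarrow> real)" "integrable \<beta> (indicator (space \<beta> - B - K') :: _ \<Rightarrow> real)"
    by (auto simp: \<beta>.emeasure_eq_measure)
  note int = this
  have "(LINT s|\<beta>. cmod (indicator B s - s u) powr p) \<le> (LINT s|\<beta>. ?g s)"
  proof (rule integral_mono')
    show "integrable \<beta> ?g" using int by (intro Bochner_Integration.integrable_add) simp_all
  qed (use bound e in auto)
  also have "\<dots> = (LINT s|\<beta>. e) + (LINT s|\<beta>. indicator (B - K) s) + (LINT s|\<beta>. indicator (space \<beta> - B - K') s)"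
    using int by (subst Bochner_Integration.integral_add; simp?)+
  also have "\<dots> = e + \<beta>.prob (B - K) + \<beta>.prob (space \<beta> - B - K')"
  proof -
    have "(B - K) \<inter> space \<beta> = B - K" "(space \<beta> - B - K') \<inter> space \<beta> = space \<beta> - B - K'"
      using sets.sets_into_space[OF B] by auto
    then show ?thesis by (simp add: \<beta>.prob_space)
  qed
  also have "\<dots> < e + e + e" using K(3) K'(3) by linarith
  also have "\<dots> \<le> \<delta>" using e \<open>0 < \<delta>\<close> by simp
  finally have "(LINT s|\<beta>. cmod (indicator B s - s u) powr p) < \<delta>" .
  moreover have "Lp \<beta> p (\<lambda>s. s u)"
  proof (rule Lp_bound[where g="\<lambda>_. of_real (sup_norm u)"])
    show "Lp \<beta> p (\<lambda>_. of_real (sup_norm u))" by (simp add: Lp_def)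
    show "AE s in \<beta>. cmod (s u) \<le> cmod (of_real (sup_norm u))"
      using hat_bounded[OF u(1)] by (auto intro: order_trans[OF _ abs_ge_self])
  qed (use p in auto)
  ultimately show "\<exists>d\<in>{\<lambda>s. s u |u. u \<in> A}. Lp \<beta> p d \<and> (LINT s|\<beta>. cmod (indicator B s - d s) powr p) < \<delta>"
    using u(1) by blast
qed

end

section \<open>Uniform convexity and duality\<close>

text \<open>Interchanges the limit in the index with the limit in the accuracy; the comparison
  sequence Y and its limit may depend on \<epsilon>.\<close>

lemma tendsto_approx:
  fixes X :: "nat \<Rightarrow> 'a::real_normed_vector"
  assumes "\<And>\<epsilon>. 0 < \<epsilon> \<Longrightarrow> \<exists>Y m. Y \<longlonglongrightarrow> m \<and> (\<forall>\<^sub>F n in sequentially. norm (X n - Y n) \<le> \<epsilon>) \<and> norm (L - m) \<le> \<epsilon>"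
  shows "X \<longlonglongrightarrow> L"
proof (rule tendstoI)
  fix \<epsilon> :: real assume "0 < \<epsilon>"
  then have "0 < \<epsilon> / 4" by simp
  from assms[OF this] obtain Y m where Y: "Y \<longlonglongrightarrow> m"
    and XY: "\<forall>\<^sub>F n in sequentially. norm (X n - Y n) \<le> \<epsilon> / 4" and L: "norm (L - m) \<le> \<epsilon> / 4"
    by (elim exE conjE)
  have "\<forall>\<^sub>F n in sequentially. dist (Y n) m < \<epsilon> / 4" using tendstoD[OF Y \<open>0 < \<epsilon> / 4\<close>] .
  with XY show "\<forall>\<^sub>F n in sequentially. dist (X n) L < \<epsilon>"
  proof eventually_elim
    case (elim n)
    have "X n - L = (X n - Y n) + (Y n - m) - (L - m)" by simp
    then have "norm (X n - L) \<le> norm (X n - Y n) + norm (Y n - m) + norm (L - m)"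
      using norm_triangle_ineq4[of "(X n - Y n) + (Y n - m)" "L - m"]
        norm_triangle_ineq[of "X n - Y n" "Y n - m"] by simp
    then show ?case using elim L \<open>0 < \<epsilon>\<close> by (simp add: dist_norm)
  qed
qed

text \<open>Plays the part of a product estimate: the bounded sequence Z only ever carries the
  weight \<eta>, while the constant C, which may explode as \<eta> tends to 0, multiplies the null
  sequence Y.\<close>

lemma tendsto_zero_soft:
  fixes X :: "nat \<Rightarrow> real"
  assumes X: "\<And>k. 0 \<le> X k" and Y: "Y \<longlonglongrightarrow> 0" and Z: "Z \<longlonglongrightarrow> l"
    and le: "\<And>\<eta>. 0 < \<eta> \<Longrightarrow> \<exists>C. \<forall>k. X k \<le> \<eta> * Z k + C * Y k"
  shows "X \<longlonglongrightarrow> 0"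
proof (rule tendsto_approx)
  fix \<epsilon> :: real assume "0 < \<epsilon>"
  define \<eta> where "\<eta> = \<epsilon> / (2 * (\<bar>l\<bar> + 1))"
  have "0 < \<eta>" using \<open>0 < \<epsilon>\<close> by (simp add: \<eta>_def add_nonneg_pos)
  from le[OF this] obtain C where C: "\<And>k. X k \<le> \<eta> * Z k + C * Y k" by blast
  have "(\<lambda>k. \<eta> * Z k + C * Y k) \<longlonglongrightarrow> \<eta> * l + C * 0"
    by (intro tendsto_intros Y Z)
  moreover have "\<eta> * l + C * 0 < \<epsilon>"
  proof -
    have "\<eta> * l \<le> \<eta> * (\<bar>l\<bar> + 1)" using \<open>0 < \<eta>\<close> by (intro mult_left_mono) auto
    also have "\<dots> = \<epsilon> / 2" unfolding \<eta>_def by (simp add: field_simps add_nonneg_pos)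
    also have "\<dots> < \<epsilon>" using \<open>0 < \<epsilon>\<close> by simp
    finally show ?thesis by simp
  qed
  ultimately have "\<forall>\<^sub>F k in sequentially. \<eta> * Z k + C * Y k < \<epsilon>" by (rule order_tendstoD)
  then have "\<forall>\<^sub>F k in sequentially. norm (X k - 0) \<le> \<epsilon>"
  proof eventually_elim
    case (elim k)
    then show ?case using X[of k] C[of k] by simp
  qed
  then show "\<exists>Y m. Y \<longlonglongrightarrow> m \<and> (\<forall>\<^sub>F n in sequentially. norm (X n - Y n) \<le> \<epsilon>) \<and> norm (0 - m) \<le> \<epsilon>"
    using \<open>0 < \<epsilon>\<close> by (intro exI[of _ "\<lambda>_. 0"] exI[of _ 0]) auto
qed

text \<open>Young's inequality for the factors t x and y / t, with t chosen so that its p-th power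
  is \<eta>.\<close>

lemma young_eps:
  fixes p q \<eta> :: real
  assumes pq: "1 < p" "1 < q" "1 / p + 1 / q = 1" and "0 < \<eta>"
  obtains C where "0 \<le> C" "\<And>x y. 0 \<le> x \<Longrightarrow> 0 \<le> y \<Longrightarrow> x * y \<le> \<eta> * x powr p + C * y powr q"
proof -
  define t where "t = \<eta> powr (1 / p)"
  have t: "0 < t" "t powr p = \<eta>" using assms by (auto simp: t_def powr_powr)
  show thesis
  proof (rule that[of "(1 / t) powr q / q"])
    show "0 \<le> (1 / t) powr q / q" using pq by simp
    fix x y :: real assume xy: "0 \<le> x" "0 \<le> y"
    have "x * y = (t * x) * (1 / t * y)" using t by simp
    also have "\<dots> \<le> (t * x) powr p / p + (1 / t * y) powr q / q"
      using pq xy t by (intro Youngs_inequality) auto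
    also have "\<dots> = \<eta> * x powr p / p + (1 / t) powr q / q * y powr q"
      using xy t by (simp add: powr_mult powr_divide)
    also have "\<eta> * x powr p / p \<le> \<eta> * x powr p"
      using pq \<open>0 < \<eta>\<close> by (simp add: divide_le_eq mult_left_mono[of 1 p "\<eta> * x powr p", simplified])
    finally show "x * y \<le> \<eta> * x powr p + (1 / t) powr q / q * y powr q" by simp
  qed
qed

text \<open>By homogeneity it suffices to look at the unit sphere, where only the compact set K of
  points with \<Phi> \<ge> \<eta> G matters. On K the function \<Psi> has a positive minimum, and
  |max \<Phi>| / min \<Psi> serves as C.\<close>

lemma homogeneous_compactness:
  fixes \<Phi> \<Psi> :: "complex \<times> complex \<Rightarrow> real"
  assumes p: "0 < p" and cont: "continuous_on UNIV \<Phi>" "continuous_on UNIV \<Psi>"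
    and hom: "\<And>t z. 0 < t \<Longrightarrow> \<Phi> (t *\<^sub>R z) = t powr p * \<Phi> z" "\<And>t z. 0 < t \<Longrightarrow> \<Psi> (t *\<^sub>R z) = t powr p * \<Psi> z"
    and zero: "\<Phi> 0 \<le> 0" and nn: "\<And>z. 0 \<le> \<Psi> z" and pos: "\<And>z. \<Psi> z = 0 \<Longrightarrow> \<Phi> z \<le> 0" and "0 < \<eta>"
  obtains C where "0 \<le> C" "\<And>a b. \<Phi> (a, b) \<le> \<eta> * (cmod a powr p + cmod b powr p) + C * \<Psi> (a, b)"
proof -
  define G where "G z = cmod (fst z) powr p + cmod (snd z) powr p" for z
  have contG: "continuous_on UNIV G"
    unfolding G_def using p by (intro continuous_intros continuous_on_powr') auto
  have homG: "G (t *\<^sub>R z) = t powr p * G z" if "0 < t" for t z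
    using that by (simp add: G_def powr_mult distrib_left)
  have Gpos: "0 < G z" if "z \<noteq> 0" for z
    using that p by (cases z) (auto simp: G_def zero_prod_def add_pos_nonneg add_nonneg_pos)
  let ?S = "sphere (0 :: complex \<times> complex) 1"
  have "\<exists>C\<ge>0. \<forall>z\<in>?S. \<Phi> z \<le> \<eta> * G z + C * \<Psi> z"
  proof -
    define K where "K = ?S \<inter> {z. \<eta> * G z \<le> \<Phi> z}"
    have "closed {z. \<eta> * G z \<le> \<Phi> z}"
      by (intro closed_Collect_le continuous_intros contG cont)
    then have K: "compact K" unfolding K_def by (intro compact_Int_closed) auto
    show ?thesis
    proof (cases "K = {}")
      case True
      then have "\<Phi> z \<le> \<eta> * G z" if "z \<in> ?S" for z
        using that unfolding K_def by (meson disjoint_iff linear mem_Collect_eq)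
      then show ?thesis by (intro exI[of _ 0]) auto
    next
      case False
      obtain z0 where z0: "z0 \<in> K" "\<And>z. z \<in> K \<Longrightarrow> \<Psi> z0 \<le> \<Psi> z"
        using continuous_attains_inf[OF K False continuous_on_subset[OF cont(2)]] by auto
      obtain z1 where z1: "z1 \<in> K" "\<And>z. z \<in> K \<Longrightarrow> \<Phi> z \<le> \<Phi> z1"
        using continuous_attains_sup[OF K False continuous_on_subset[OF cont(1)]] by auto
      have "z0 \<noteq> 0" using z0(1) by (auto simp: K_def)
      then have "0 < \<eta> * G z0" using Gpos \<open>0 < \<eta>\<close> by simp
      then have "0 < \<Phi> z0" using z0(1) by (auto simp: K_def)
      \<comment> \<open>A zero of \<Psi> in K would satisfy both \<Phi> \<le> 0 and \<Phi> \<ge>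
        \<eta> G > 0.\<close>
      then have \<Psi>0: "0 < \<Psi> z0" using pos[of z0] nn[of z0] by fastforce
      define C where "C = \<bar>\<Phi> z1\<bar> / \<Psi> z0"
      have "0 \<le> C" using \<Psi>0 by (simp add: C_def)
      have "\<Phi> z \<le> \<eta> * G z + C * \<Psi> z" if z: "z \<in> ?S" for z
      proof (cases "z \<in> K")
        case True
        have "\<Phi> z \<le> \<bar>\<Phi> z1\<bar>" using z1(2)[OF True] by linarith
        also have "\<dots> = C * \<Psi> z0" using \<Psi>0 by (simp add: C_def)
        also have "\<dots> \<le> C * \<Psi> z" using \<open>0 \<le> C\<close> z0(2)[OF True] by (rule mult_left_mono[rotated])
        moreover have "0 \<le> \<eta> * G z" using \<open>0 < \<eta>\<close> by (simp add: G_def)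
        ultimately show ?thesis by linarith
      next
        case False
        then have "\<Phi> z \<le> \<eta> * G z" using z by (auto simp: K_def)
        moreover have "0 \<le> C * \<Psi> z" using \<open>0 \<le> C\<close> nn by simp
        ultimately show ?thesis by linarith
      qed
      then show ?thesis using \<open>0 \<le> C\<close> by blast
    qed
  qed
  then obtain C where C: "0 \<le> C" "\<forall>z\<in>?S. \<Phi> z \<le> \<eta> * G z + C * \<Psi> z" by blast
  have "\<Phi> z \<le> \<eta> * G z + C * \<Psi> z" for z
  proof (cases "z = 0")
    case True
    have "0 \<le> \<eta> * G z + C * \<Psi> z" using \<open>0 < \<eta>\<close> C nn by (simp add: G_def)
    then show ?thesis using True zero by simp
  next
    case False
    let ?t = "norm z" and ?z = "(1 / norm z) *\<^sub>R z"
    have t: "0 < ?t" and z: "?t *\<^sub>R ?z = z" using False by auto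
    have "\<Phi> ?z \<le> \<eta> * G ?z + C * \<Psi> ?z" using False by (intro C(2)[rule_format]) simp
    then have "?t powr p * \<Phi> ?z \<le> ?t powr p * (\<eta> * G ?z + C * \<Psi> ?z)"
      by (intro mult_left_mono) auto
    then have "?t powr p * \<Phi> ?z \<le> \<eta> * (?t powr p * G ?z) + C * (?t powr p * \<Psi> ?z)"
      by (simp add: algebra_simps)
    then show ?thesis unfolding hom(1)[OF t, symmetric] hom(2)[OF t, symmetric] homG[OF t, symmetric] z .
  qed
  from this[of "(_, _)"] show thesis by (intro that[OF C(1)]) (simp add: G_def)
qed

text \<open>The power lies strictly above its tangent at 1: by the mean value theorem,
  \<open>x powr p - p * x\<close> decreases before 1 and increases after it.\<close>

lemma powr_tangent_strict:
  fixes p t :: real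
  assumes p: "1 < p" and t: "0 \<le> t" "t \<noteq> 1"
  shows "1 + p * (t - 1) < t powr p"
proof (cases "t = 0")
  case True
  then show ?thesis using p by simp
next
  case False
  then have "0 < t" using t by simp
  define f where "f x = x powr p - p * x" for x
  have der: "(f has_real_derivative (p * x powr (p - 1) - p)) (at x)" if "0 < x" for x
    unfolding f_def using that by (auto intro!: derivative_eq_intros)
  have "f 1 < f t"
  proof (cases "t < 1")
    case True
    obtain x where x: "t < x" "x < 1" "f 1 - f t = (1 - t) * (p * x powr (p - 1) - p)"
      using MVT2[OF True, of f "\<lambda>x. p * x powr (p - 1) - p"] der \<open>0 < t\<close> by force
    have "x powr (p - 1) < 1 powr (p - 1)" using x p \<open>0 < t\<close> by (intro powr_less_mono2) auto
    then have "p * x powr (p - 1) - p < 0" using p by simp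
    then have "f 1 - f t < 0" unfolding x(3) using True by (simp add: mult_pos_neg)
    then show ?thesis by simp
  next
    case False
    then have "1 < t" using t by simp
    obtain x where x: "1 < x" "x < t" "f t - f 1 = (t - 1) * (p * x powr (p - 1) - p)"
      using MVT2[OF \<open>1 < t\<close>, of f "\<lambda>x. p * x powr (p - 1) - p"] der by force
    have "1 powr (p - 1) < x powr (p - 1)" using x p by (intro powr_less_mono2) auto
    then have "0 < p * x powr (p - 1) - p" using p by simp
    then have "0 < f t - f 1" unfolding x(3) using \<open>1 < t\<close> by simp
    then show ?thesis by simp
  qed
  then show ?thesis by (simp add: f_def algebra_simps)
qed

text \<open>The tangent inequality at the midpoint m, rescaled by m, is used for x and for y; the
  linear terms cancel in the sum.\<close>

lemma powr_midpoint_strict: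
  fixes p x y :: real
  assumes p: "1 < p" and xy: "0 \<le> x" "0 \<le> y" "x \<noteq> y"
  shows "((x + y) / 2) powr p < (x powr p + y powr p) / 2"
proof -
  define m where "m = (x + y) / 2"
  have m: "0 < m" using xy by (auto simp: m_def)
  have *: "m powr p * (1 + p * (z / m - 1)) < z powr p" if "0 \<le> z" "z \<noteq> m" for z
  proof -
    have "m powr p * (1 + p * (z / m - 1)) < m powr p * (z / m) powr p"
      using m that by (intro mult_strict_left_mono powr_tangent_strict p) auto
    also have "\<dots> = z powr p" using m that by (simp add: powr_divide)
    finally show ?thesis .
  qed
  have "x \<noteq> m" "y \<noteq> m" using xy by (auto simp: m_def)
  from *[OF xy(1) this(1)] *[OF xy(2) this(2)]
  have "m powr p * (1 + p * (x / m - 1)) + m powr p * (1 + p * (y / m - 1)) < x powr p + y powr p" by simp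
  moreover have "m powr p * (1 + p * (x / m - 1)) + m powr p * (1 + p * (y / m - 1)) = 2 * m powr p"
  proof -
    have "x + y = 2 * m" by (simp add: m_def)
    then have "x / m + y / m = 2" using m by (simp only: add_divide_distrib[symmetric]) simp
    moreover have "(1 + p * (x / m - 1)) + (1 + p * (y / m - 1)) = 2 + p * ((x / m + y / m) - 2)"
      by (simp add: algebra_simps)
    ultimately have "(1 + p * (x / m - 1)) + (1 + p * (y / m - 1)) = 2" by simp
    then show ?thesis by (simp add: mult.commute flip: distrib_left)
  qed
  ultimately show ?thesis by (simp add: m_def)
qed

text \<open>In the equality case strict convexity forces |a| = |b|, then |a + b| = 2 |a|, and the
  parallelogram law leaves |a - b| = 0.\<close>

lemma norm_midpoint_powr:
  fixes a b :: complex
  assumes p: "1 < p"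
  shows "cmod ((a + b) / 2) powr p \<le> (cmod a powr p + cmod b powr p) / 2"
    and "cmod ((a + b) / 2) powr p = (cmod a powr p + cmod b powr p) / 2 \<Longrightarrow> a = b"
proof -
  have le1: "cmod ((a + b) / 2) powr p \<le> ((cmod a + cmod b) / 2) powr p"
    using p norm_triangle_ineq[of a b] by (intro powr_mono2) (auto simp: norm_divide)
  have le2: "((cmod a + cmod b) / 2) powr p \<le> (cmod a powr p + cmod b powr p) / 2"
    using powr_midpoint_strict[OF p, of "cmod a" "cmod b"] by (cases "cmod a = cmod b") auto
  show "cmod ((a + b) / 2) powr p \<le> (cmod a powr p + cmod b powr p) / 2"
    using le1 le2 by linarith
  assume eq: "cmod ((a + b) / 2) powr p = (cmod a powr p + cmod b powr p) / 2"
  have ab: "cmod a = cmod b"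
  proof (rule ccontr)
    assume "cmod a \<noteq> cmod b"
    from powr_midpoint_strict[OF p _ _ this] le1 eq show False by simp
  qed
  have "cmod ((a + b) / 2) = cmod a"
  proof (rule ccontr)
    assume "cmod ((a + b) / 2) \<noteq> cmod a"
    then have "cmod ((a + b) / 2) < cmod a"
      using norm_triangle_ineq[of a b] ab by (simp add: norm_divide)
    then have "cmod ((a + b) / 2) powr p < cmod a powr p" using p by (intro powr_less_mono2) auto
    then show False using eq ab by simp
  qed
  then have "cmod (a + b) = 2 * cmod a" by (simp add: norm_divide)
  moreover have "(cmod (a + b))\<^sup>2 + (cmod (a - b))\<^sup>2 = 2 * (cmod a)\<^sup>2 + 2 * (cmod b)\<^sup>2"
    unfolding cmod_power2 by (simp add: power2_eq_square algebra_simps)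
  ultimately have "(cmod (a - b))\<^sup>2 = 0" using ab by (simp add: power_mult_distrib)
  then show "a = b" by simp
qed

text \<open>A soft form of uniform convexity of \<open>L\<^sup>p\<close>, obtained from strict convexity and homogeneity.\<close>
lemma uniform_convexity_pointwise:
  fixes p \<eta> :: real
  assumes p: "1 < p" and "0 < \<eta>"
  obtains C where "0 \<le> C" "\<And>a b. cmod (a - b) powr p \<le> \<eta> * (cmod a powr p + cmod b powr p)
    + C * ((cmod a powr p + cmod b powr p) / 2 - cmod ((a + b) / 2) powr p)"
proof -
  define \<Phi> where "\<Phi> = (\<lambda>z. cmod (fst z - snd z) powr p)"
  define \<Psi> where "\<Psi> = (\<lambda>z. (cmod (fst z) powr p + cmod (snd z) powr p) / 2 - cmod ((fst z + snd z) / 2) powr p)"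
  obtain C where C: "0 \<le> C" "\<And>a b. \<Phi> (a, b) \<le> \<eta> * (cmod a powr p + cmod b powr p) + C * \<Psi> (a, b)"
  proof (rule homogeneous_compactness[of p \<Phi> \<Psi> \<eta>])
    show "continuous_on UNIV \<Phi>" "continuous_on UNIV \<Psi>"
      unfolding \<Phi>_def \<Psi>_def using p by (intro continuous_intros continuous_on_powr'; auto)+
    fix t :: real and z :: "complex \<times> complex" assume t: "0 < t"
    have "fst (t *\<^sub>R z) - snd (t *\<^sub>R z) = t *\<^sub>R (fst z - snd z)" "(fst (t *\<^sub>R z) + snd (t *\<^sub>R z)) / 2 = t *\<^sub>R ((fst z + snd z) / 2)"
      by (simp_all add: scaleR_conv_of_real distrib_left right_diff_distrib)
    note sc = this
    show "\<Phi> (t *\<^sub>R z) = t powr p * \<Phi> z" unfolding \<Phi>_def sc using t by (simp add: powr_mult)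
    show "\<Psi> (t *\<^sub>R z) = t powr p * \<Psi> z"
    proof -
      have np: "cmod (t *\<^sub>R w) powr p = t powr p * cmod w powr p" for w
        using t by (simp add: powr_mult)
      show ?thesis
        unfolding \<Psi>_def sc unfolding fst_scaleR snd_scaleR np
        by (simp only: right_diff_distrib distrib_left times_divide_eq_right)
    qed
  next
    show "\<Phi> 0 \<le> 0" by (simp add: \<Phi>_def)
    show "0 \<le> \<Psi> z" for z using norm_midpoint_powr(1)[OF p, of "fst z" "snd z"] by (simp add: \<Psi>_def)
    show "\<Phi> z \<le> 0" if "\<Psi> z = 0" for z
      using norm_midpoint_powr(2)[OF p, of "fst z" "snd z"] that by (simp add: \<Psi>_def \<Phi>_def)
  qed (use p \<open>0 < \<eta>\<close> in auto)
  show thesis by (rule that[OF C(1)]) (use C(2) in \<open>simp add: \<Phi>_def \<Psi>_def\<close>)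
qed

text \<open>The other instance of the compactness lemma: \<Phi> vanishes on the diagonal, which is
  the zero set of \<Psi>. It is the source of the continuity of the modular.\<close>

lemma powr_diff_pointwise:
  fixes p \<eta> :: real
  assumes p: "0 < p" and "0 < \<eta>"
  obtains C where "0 \<le> C" "\<And>a b. \<bar>cmod a powr p - cmod b powr p\<bar> \<le> \<eta> * (cmod a powr p + cmod b powr p) + C * cmod (a - b) powr p"
proof -
  define \<Phi> where "\<Phi> = (\<lambda>z. \<bar>cmod (fst z) powr p - cmod (snd z) powr p\<bar>)"
  define \<Psi> where "\<Psi> = (\<lambda>z. cmod (fst z - snd z) powr p)"
  obtain C where C: "0 \<le> C" "\<And>a b. \<Phi> (a, b) \<le> \<eta> * (cmod a powr p + cmod b powr p) + C * \<Psi> (a, b)"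
  proof (rule homogeneous_compactness[of p \<Phi> \<Psi> \<eta>])
    show "continuous_on UNIV \<Phi>" "continuous_on UNIV \<Psi>"
      unfolding \<Phi>_def \<Psi>_def using p by (intro continuous_intros continuous_on_powr'; auto)+
    fix t :: real and z :: "complex \<times> complex" assume t: "0 < t"
    have sc: "fst (t *\<^sub>R z) - snd (t *\<^sub>R z) = t *\<^sub>R (fst z - snd z)"
      by (simp add: scaleR_diff_right)
    show "\<Psi> (t *\<^sub>R z) = t powr p * \<Psi> z" unfolding \<Psi>_def sc using t by (simp add: powr_mult)
    have "\<Phi> (t *\<^sub>R z) = \<bar>t powr p * (cmod (fst z) powr p - cmod (snd z) powr p)\<bar>"
      unfolding \<Phi>_def using t by (simp add: powr_mult right_diff_distrib)
    then show "\<Phi> (t *\<^sub>R z) = t powr p * \<Phi> z" by (simp add: \<Phi>_def abs_mult)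
  qed (use p \<open>0 < \<eta>\<close> in \<open>auto simp: \<Phi>_def \<Psi>_def\<close>)
  show thesis by (rule that[OF C(1)]) (use C(2) in \<open>simp add: \<Phi>_def \<Psi>_def\<close>)
qed

section \<open>The pairing of dual exponents\<close>

lemma Lp_mult_integrable:
  assumes pq: "1 < p" "1 < q" "1 / p + 1 / q = 1" and f: "Lp N p f" and g: "Lp N q g"
  shows "integrable N (\<lambda>z. f z * g z)"
proof (rule Bochner_Integration.integrable_bound)
  note [measurable] = LpD(1)[OF f] LpD(1)[OF g]
  show "integrable N (\<lambda>z. cmod (f z) powr p / p + cmod (g z) powr q / q)"
    using LpD(2)[OF f] LpD(2)[OF g] by auto
  show "(\<lambda>z. f z * g z) \<in> borel_measurable N" by measurable
  show "AE z in N. norm (f z * g z) \<le> norm (cmod (f z) powr p / p + cmod (g z) powr q / q)"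
    using pq by (auto simp: norm_mult intro!: AE_I2 Youngs_inequality order_trans[OF _ abs_ge_self])
qed

lemma norm_integral_mult_le:
  assumes pq: "1 < p" "1 < q" "1 / p + 1 / q = 1" and f: "Lp N p f" and g: "Lp N q g"
    and C: "\<And>x y. 0 \<le> x \<Longrightarrow> 0 \<le> y \<Longrightarrow> x * y \<le> \<eta> * x powr p + C * y powr q"
  shows "cmod (LINT z|N. f z * g z) \<le> \<eta> * (LINT z|N. cmod (f z) powr p) + C * (LINT z|N. cmod (g z) powr q)"
proof -
  have "cmod (LINT z|N. f z * g z) \<le> (LINT z|N. cmod (f z * g z))"
    by (rule integral_norm_bound)
  also have "\<dots> \<le> (LINT z|N. \<eta> * cmod (f z) powr p + C * cmod (g z) powr q)"
    using integrable_norm[OF Lp_mult_integrable[OF pq f g]] LpD(2)[OF f] LpD(2)[OF g]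
    by (intro integral_mono) (simp_all add: norm_mult C)
  also have "\<dots> = \<eta> * (LINT z|N. cmod (f z) powr p) + C * (LINT z|N. cmod (g z) powr q)"
    using LpD(2)[OF f] LpD(2)[OF g] by simp
  finally show ?thesis .
qed

text \<open>\<open>powr_diff_pointwise\<close> is integrated and fed to
  \<open>tendsto_zero_soft\<close>. The convergent majorant needed there comes from
  \<open>bd\<close>, the quasi-triangle inequality for F k = f + (F k - f).\<close>

lemma integral_powr_tendsto:
  assumes p: "0 < p" and f: "Lp N p f" and F: "\<And>k. Lp N p (F k)"
    and lim: "(\<lambda>k. LINT z|N. cmod (f z - F k z) powr p) \<longlonglongrightarrow> 0"
  shows "(\<lambda>k. LINT z|N. cmod (F k z) powr p) \<longlonglongrightarrow> (LINT z|N. cmod (f z) powr p)"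
proof -
  let ?I = "\<lambda>f. LINT z|N. cmod (f z) powr p"
  note i_f = LpD(2)[OF f] and iF = LpD(2)[OF F] and id = LpD(2)[OF Lp_diff[OF f F less_imp_le[OF p]]]
  have bd: "?I (F k) \<le> 2 powr p * (?I f + ?I (\<lambda>z. f z - F k z))" for k
  proof -
    have "?I (\<lambda>z. f z + (F k z - f z)) \<le> 2 powr p * (?I f + ?I (\<lambda>z. F k z - f z))"
      using p by (intro integral_powr_add_le f Lp_diff F) auto
    then show ?thesis by (simp add: norm_minus_commute)
  qed
  have "(\<lambda>k. \<bar>?I (F k) - ?I f\<bar>) \<longlonglongrightarrow> 0"
  proof (rule tendsto_zero_soft[OF _ lim])
    show "(\<lambda>k. 2 powr p * (?I f + ?I (\<lambda>z. f z - F k z)) + ?I f) \<longlonglongrightarrow> 2 powr p * (?I f + 0) + ?I f"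
      by (intro tendsto_intros lim)
    fix \<eta> :: real assume "0 < \<eta>"
    obtain C where C: "0 \<le> C" "\<And>a b. \<bar>cmod a powr p - cmod b powr p\<bar> \<le> \<eta> * (cmod a powr p + cmod b powr p) + C * cmod (a - b) powr p"
      by (rule powr_diff_pointwise[OF p \<open>0 < \<eta>\<close>]) (rule that; blast)
    have "\<bar>?I (F k) - ?I f\<bar> \<le> \<eta> * (2 powr p * (?I f + ?I (\<lambda>z. f z - F k z)) + ?I f) + C * ?I (\<lambda>z. f z - F k z)" for k
    proof -
      have "?I (F k) - ?I f = (LINT z|N. cmod (F k z) powr p - cmod (f z) powr p)"
        using i_f iF by simp
      also have "\<bar>\<dots>\<bar> \<le> (LINT z|N. \<bar>cmod (F k z) powr p - cmod (f z) powr p\<bar>)"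
        by (rule integral_abs_bound)
      also have "\<dots> \<le> (LINT z|N. \<eta> * (cmod (F k z) powr p + cmod (f z) powr p) + C * cmod (f z - F k z) powr p)"
        using i_f iF id C(2)[of "F k _" "f _"] by (intro integral_mono) (auto simp: norm_minus_commute)
      also have "\<dots> = \<eta> * (?I (F k) + ?I f) + C * ?I (\<lambda>z. f z - F k z)"
        using i_f iF id by simp
      also have "\<dots> \<le> \<eta> * (2 powr p * (?I f + ?I (\<lambda>z. f z - F k z)) + ?I f) + C * ?I (\<lambda>z. f z - F k z)"
        using bd[of k] \<open>0 < \<eta>\<close> by (intro add_right_mono mult_left_mono) auto
      finally show ?thesis .
    qed
    then show "\<exists>C. \<forall>k. \<bar>?I (F k) - ?I f\<bar> \<le> \<eta> * (2 powr p * (?I f + ?I (\<lambda>z. f z - F k z)) + ?I f) + C * ?I (\<lambda>z. f z - F k z)"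
      by blast
  qed auto
  then show ?thesis
    by (subst Lim_null) (simp add: tendsto_rabs_zero_iff)
qed

text \<open>Rests on f g - F G = f (g - G) + G (f - F); in each product one factor has a bounded
  modular and the other a modular tending to 0.\<close>

lemma integral_mult_tendsto:
  assumes pq: "1 < p" "1 < q" "1 / p + 1 / q = 1"
    and f: "Lp N p f" "\<And>k. Lp N p (F k)" "(\<lambda>k. LINT z|N. cmod (f z - F k z) powr p) \<longlonglongrightarrow> 0"
    and g: "Lp N q g" "\<And>k. Lp N q (G k)" "(\<lambda>k. LINT z|N. cmod (g z - G k z) powr q) \<longlonglongrightarrow> 0"
  shows "(\<lambda>k. LINT z|N. F k z * G k z) \<longlonglongrightarrow> (LINT z|N. f z * g z)"
proof -
  have qp: "1 / q + 1 / p = 1" using pq by simp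
  have df: "Lp N p (\<lambda>z. f z - F k z)" and dg: "Lp N q (\<lambda>z. g z - G k z)" for k
    using pq by (auto intro!: Lp_diff f g)
  have 1: "(\<lambda>k. cmod (LINT z|N. f z * (g z - G k z))) \<longlonglongrightarrow> 0"
  proof (rule tendsto_zero_soft[OF _ g(3)])
    show "(\<lambda>k. LINT z|N. cmod (f z) powr p) \<longlonglongrightarrow> (LINT z|N. cmod (f z) powr p)" by simp
    fix \<eta> :: real assume "0 < \<eta>"
    obtain C where "0 \<le> C" and C: "\<And>x y. 0 \<le> x \<Longrightarrow> 0 \<le> y \<Longrightarrow> x * y \<le> \<eta> * x powr p + C * y powr q"
      by (rule young_eps[OF pq \<open>0 < \<eta>\<close>]) (rule that; blast)
    from norm_integral_mult_le[OF pq f(1) dg C]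
    show "\<exists>C. \<forall>k. cmod (LINT z|N. f z * (g z - G k z)) \<le> \<eta> * (LINT z|N. cmod (f z) powr p) + C * (LINT z|N. cmod (g z - G k z) powr q)"
      by blast
  qed auto
  have 2: "(\<lambda>k. cmod (LINT z|N. G k z * (f z - F k z))) \<longlonglongrightarrow> 0"
  proof (rule tendsto_zero_soft[OF _ f(3)])
    show "(\<lambda>k. LINT z|N. cmod (G k z) powr q) \<longlonglongrightarrow> (LINT z|N. cmod (g z) powr q)"
      using pq by (intro integral_powr_tendsto g) auto
    fix \<eta> :: real assume "0 < \<eta>"
    obtain C where "0 \<le> C" and C: "\<And>x y. 0 \<le> x \<Longrightarrow> 0 \<le> y \<Longrightarrow> x * y \<le> \<eta> * x powr q + C * y powr p"
      by (rule young_eps[OF pq(2,1) qp \<open>0 < \<eta>\<close>]) (rule that; blast)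
    from norm_integral_mult_le[OF pq(2,1) qp g(2) df C]
    show "\<exists>C. \<forall>k. cmod (LINT z|N. G k z * (f z - F k z)) \<le> \<eta> * (LINT z|N. cmod (G k z) powr q) + C * (LINT z|N. cmod (f z - F k z) powr p)"
      by blast
  qed auto
  have "(\<lambda>k. (LINT z|N. f z * g z) - (LINT z|N. f z * (g z - G k z)) - (LINT z|N. G k z * (f z - F k z)))
      \<longlonglongrightarrow> (LINT z|N. f z * g z) - 0 - 0"
    using 1 2 by (intro tendsto_intros) (simp_all add: tendsto_norm_zero_iff)
  moreover have "(LINT z|N. f z * g z) - (LINT z|N. f z * (g z - G k z)) - (LINT z|N. G k z * (f z - F k z)) = (LINT z|N. F k z * G k z)" for k
  proof -
    note i1 = Lp_mult_integrable[OF pq f(1) g(1)] and i2 = Lp_mult_integrable[OF pq f(1) dg]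
      and i3 = Lp_mult_integrable[OF pq(2,1) qp g(2) df]
    have "(LINT z|N. f z * g z) - (LINT z|N. f z * (g z - G k z)) - (LINT z|N. G k z * (f z - F k z))
       = (LINT z|N. f z * g z - f z * (g z - G k z) - G k z * (f z - F k z))"
      unfolding Bochner_Integration.integral_diff[OF Bochner_Integration.integrable_diff[OF i1 i2] i3]
        Bochner_Integration.integral_diff[OF i1 i2] ..
    also have "\<dots> = (LINT z|N. F k z * G k z)"
      by (intro Bochner_Integration.integral_cong) (auto simp: algebra_simps)
    finally show ?thesis .
  qed
  ultimately show ?thesis by simp
qed

lemma Lp_closure_sequence:
  assumes "f \<in> Lp_closure N p D"
  shows "\<exists>F. (\<forall>k. F k \<in> D) \<and> (\<forall>k. Lp N p (F k)) \<and> (\<lambda>k. LINT z|N. cmod (f z - F k z) powr p) \<longlonglongrightarrow> 0"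
proof -
  have "\<exists>d\<in>D. Lp N p d \<and> (LINT z|N. cmod (f z - d z) powr p) < inverse (real (Suc k))" for k
    using assms unfolding Lp_closure_def by simp
  then obtain F where F: "\<And>k. F k \<in> D" "\<And>k. Lp N p (F k)"
    "\<And>k. (LINT z|N. cmod (f z - F k z) powr p) < inverse (real (Suc k))"
    by metis
  have "(\<lambda>k. LINT z|N. cmod (f z - F k z) powr p) \<longlonglongrightarrow> 0"
    by (rule Lim_null_comparison[OF _ LIMSEQ_inverse_real_of_nat])
      (use less_imp_le[OF F(3)] in \<open>intro always_eventually allI, simp\<close>)
  then show ?thesis using F by blast
qed

lemma Lp_dual_element:
  assumes pq: "1 < p" "1 < q" "1 / p + 1 / q = 1" and f: "Lp N p f"
  obtains g where "Lp N q g" "\<And>z. f z * g z = of_real (cmod (f z) powr p)"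
    "\<And>z. cmod (g z) powr q = cmod (f z) powr p"
proof -
  define g where "g z = cnj (f z) * of_real (cmod (f z) powr (p - 2))" for z
  note [measurable] = LpD(1)[OF f]
  have q: "(p - 1) * q = p" using pq by (simp add: field_simps)
  \<comment> \<open>The exponent p - 2 may be negative; at c = 0 both sides are still 0, because
    \<open>0 powr _ = 0\<close>.\<close>
  have sq: "cmod c * cmod c powr (p - 2) = cmod c powr (p - 1)" for c
    by (cases "c = 0") (auto simp: powr_mult_base)
  have g1: "f z * g z = of_real (cmod (f z) powr p)" for z
  proof -
    have "f z * g z = of_real (cmod (f z) * (cmod (f z) * cmod (f z) powr (p - 2)))"
      unfolding g_def using complex_norm_square[of "f z"] by (simp add: power2_eq_square mult_ac)
    also have "cmod (f z) * (cmod (f z) * cmod (f z) powr (p - 2)) = cmod (f z) powr p"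
      unfolding sq by (cases "f z = 0") (auto simp: powr_mult_base)
    finally show ?thesis .
  qed
  have g2: "cmod (g z) powr q = cmod (f z) powr p" for z
  proof -
    have "cmod (g z) = cmod (f z) powr (p - 1)"
      unfolding g_def by (simp add: norm_mult sq)
    then show ?thesis by (simp add: powr_powr q)
  qed
  have [measurable]: "cnj \<in> borel_measurable borel"
    by (intro borel_measurable_continuous_onI continuous_intros)
  have "(\<lambda>z. cnj (f z)) \<in> borel_measurable N" "(\<lambda>z. cmod (f z) powr (p - 2)) \<in> borel_measurable N"
    by measurable
  then have "g \<in> borel_measurable N"
    unfolding g_def by (intro borel_measurable_times measurable_compose[OF _ borel_measurable_of_real])
  then have "Lp N q g"
    unfolding Lp_def g2 using LpD(2)[OF f] by simp
  then show thesis using that g1 g2 by blast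
qed

text \<open>The third bound is the limit form of the convexity defect of V and g, with the modular
  of their midpoint replaced by its Young lower bound through h. At g = V and h the dual element of
  V it equals m - p m + (p / q) m, where m is the modular of V; this is 0 since p / q = p - 1.
  Density and continuity in g and h do the rest.\<close>

lemma lower_semicontinuity_witness:
  assumes pq: "1 < p" "1 < q" "1 / p + 1 / q = 1" and V: "V \<in> Lp_closure N p D"
    and D': "{H. Lp N q H} \<subseteq> Lp_closure N q D'" and "0 < \<kappa>"
  shows "\<exists>g\<in>D. \<exists>h\<in>D'. Lp N p g \<and> Lp N q h \<and> (LINT z|N. cmod (V z - g z) powr p) < \<kappa> \<and>
    (LINT z|N. cmod (g z) powr p) < (LINT z|N. cmod (V z) powr p) + 1 \<and>
    ((LINT z|N. cmod (V z) powr p) + (LINT z|N. cmod (g z) powr p)) / 2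
      - p * Re (((LINT z|N. V z * h z) + (LINT z|N. g z * h z)) / 2) + p / q * (LINT z|N. cmod (h z) powr q) < \<kappa>"
proof -
  have LV: "Lp N p V" by (rule Lp_closureD[OF V])
  obtain H where H: "Lp N q H" "\<And>z. V z * H z = of_real (cmod (V z) powr p)"
    "\<And>z. cmod (H z) powr q = cmod (V z) powr p"
    by (rule Lp_dual_element[OF pq LV]) (rule that; blast)
  from Lp_closure_sequence[OF V]
  obtain g where gk: "\<forall>k. g k \<in> D" "\<forall>k. Lp N p (g k)" and glim: "(\<lambda>k. LINT z|N. cmod (V z - g k z) powr p) \<longlonglongrightarrow> 0"
    by (elim exE conjE)
  note g = gk[THEN spec] glim
  from Lp_closure_sequence[OF subsetD[OF D' CollectI[where P="Lp N q", OF H(1)]]]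
  obtain h where hk: "\<forall>k. h k \<in> D'" "\<forall>k. Lp N q (h k)" and hlim: "(\<lambda>k. LINT z|N. cmod (H z - h k z) powr q) \<longlonglongrightarrow> 0"
    by (elim exE conjE)
  note h = hk[THEN spec] hlim
  let ?m = "LINT z|N. cmod (V z) powr p"
  have l1: "(\<lambda>k. LINT z|N. cmod (g k z) powr p) \<longlonglongrightarrow> ?m"
    using pq by (intro integral_powr_tendsto LV g) auto
  have l2: "(\<lambda>k. LINT z|N. cmod (h k z) powr q) \<longlonglongrightarrow> ?m"
    using integral_powr_tendsto[OF _ H(1) h(2,3)] pq by (simp add: H(3))
  have VH: "(LINT z|N. V z * H z) = of_real ?m" unfolding H(2) by (rule integral_complex_of_real)
  have l3: "(\<lambda>k. LINT z|N. g k z * h k z) \<longlonglongrightarrow> of_real ?m"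
    using integral_mult_tendsto[OF pq LV g(2,3) H(1) h(2,3)] by (simp add: VH)
  have l4: "(\<lambda>k. LINT z|N. V z * h k z) \<longlonglongrightarrow> of_real ?m"
    using integral_mult_tendsto[OF pq LV LV _ H(1) h(2,3)] by (simp add: VH)
  have lim: "(\<lambda>k. (?m + (LINT z|N. cmod (g k z) powr p)) / 2
      - p * Re (((LINT z|N. V z * h k z) + (LINT z|N. g k z * h k z)) / 2) + p / q * (LINT z|N. cmod (h k z) powr q))
    \<longlonglongrightarrow> (?m + ?m) / 2 - p * Re ((of_real ?m + of_real ?m) / 2) + p / q * ?m"
    by (intro tendsto_intros l1 l2 l3 l4) auto
  have lim0: "(?m + ?m) / 2 - p * Re ((of_real ?m + of_real ?m) / 2) + p / q * ?m = 0"
  proof -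
    have "p / q = p - 1" using pq by (simp add: field_simps)
    then show ?thesis by (simp add: left_diff_distrib)
  qed
  have "\<forall>\<^sub>F k in sequentially. (?m + (LINT z|N. cmod (g k z) powr p)) / 2
      - p * Re (((LINT z|N. V z * h k z) + (LINT z|N. g k z * h k z)) / 2) + p / q * (LINT z|N. cmod (h k z) powr q) < \<kappa>"
    by (rule order_tendstoD(2)[OF lim]) (simp only: lim0 \<open>0 < \<kappa>\<close>)
  moreover have "\<forall>\<^sub>F k in sequentially. (LINT z|N. cmod (V z - g k z) powr p) < \<kappa>"
    using order_tendstoD(2)[OF g(3) \<open>0 < \<kappa>\<close>] .
  moreover have "\<forall>\<^sub>F k in sequentially. (LINT z|N. cmod (g k z) powr p) < ?m + 1"
    using l1 by (rule order_tendstoD) simp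
  ultimately have "\<forall>\<^sub>F k in sequentially. (LINT z|N. cmod (V z - g k z) powr p) < \<kappa> \<and>
    (LINT z|N. cmod (g k z) powr p) < ?m + 1 \<and>
    (?m + (LINT z|N. cmod (g k z) powr p)) / 2
      - p * Re (((LINT z|N. V z * h k z) + (LINT z|N. g k z * h k z)) / 2) + p / q * (LINT z|N. cmod (h k z) powr q) < \<kappa>"
    by eventually_elim (intro conjI)
  from eventually_happens'[OF sequentially_bot this] obtain k where
    "(LINT z|N. cmod (V z - g k z) powr p) < \<kappa> \<and>
    (LINT z|N. cmod (g k z) powr p) < ?m + 1 \<and>
    (?m + (LINT z|N. cmod (g k z) powr p)) / 2
      - p * Re (((LINT z|N. V z * h k z) + (LINT z|N. g k z * h k z)) / 2) + p / q * (LINT z|N. cmod (h k z) powr q) < \<kappa>"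
    by (elim exE)
  then show ?thesis
    by (intro bexI[OF _ g(1)[of k]] bexI[OF _ h(1)[of k]] conjI g(2) h(2)) auto
qed

text \<open>The p-th power of a nonnegative number is at most 1 plus its q-th power, and the finite
  measure of E pays for the 1. This is how a product in \<open>L\<^sup>q\<close> reaches the
  exponent dual to p.\<close>

lemma Lp_lower_exponent:
  assumes f: "Lp N q f" and p: "0 < p" "p \<le> q" and E: "E \<in> sets N" "emeasure N E < \<infinity>"
    and out: "\<And>z. z \<in> space N \<Longrightarrow> z \<notin> E \<Longrightarrow> f z = 0"
  shows "Lp N p f" "(LINT z|N. cmod (f z) powr p) \<le> measure N E + (LINT z|N. cmod (f z) powr q)"
proof -
  note [measurable] = LpD(1)[OF f]
  have int: "integrable N (\<lambda>z. indicator E z + cmod (f z) powr q)"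
    using E LpD(2)[OF f] by auto
  have le: "cmod (f z) powr p \<le> indicator E z + cmod (f z) powr q" if "z \<in> space N" for z
  proof (cases "z \<in> E")
    case True
    show ?thesis
    proof (cases "cmod (f z) \<le> 1")
      case True
      then have "cmod (f z) powr p \<le> 1" using p by (intro powr_le1) auto
      then show ?thesis using \<open>z \<in> E\<close> by (simp add: add_increasing2)
    next
      case False
      then have "cmod (f z) powr p \<le> cmod (f z) powr q" using p by (intro powr_mono) auto
      then show ?thesis by (simp add: add_increasing)
    qed
  next
    case False
    then show ?thesis using out[OF that] by simp
  qed
  have "integrable N (\<lambda>z. cmod (f z) powr p)"
    by (rule Bochner_Integration.integrable_bound[OF int])
      (use le in \<open>auto intro!: AE_I2 intro: order_trans[OF _ abs_ge_self]\<close>)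
  then show "Lp N p f" by (simp add: Lp_def)
  have "(LINT z|N. cmod (f z) powr p) \<le> (LINT z|N. indicator E z + cmod (f z) powr q)"
    using le \<open>integrable N (\<lambda>z. cmod (f z) powr p)\<close> int by (intro integral_mono) auto
  also have "\<dots> = measure N E + (LINT z|N. cmod (f z) powr q)"
    using E LpD(2)[OF f] by (simp add: sets.sets_into_space Int_absorb2)
  finally show "(LINT z|N. cmod (f z) powr p) \<le> measure N E + (LINT z|N. cmod (f z) powr q)" .
qed

section \<open>Oscillating functions\<close>

text \<open>The sequences a and b stand for the two scales eps_1 and eps_2 along the fundamental
  sequence.\<close>

locale oscillation = flow M T + gelfand A \<beta>
  for M :: "'w measure" and T :: "real^'n \<Rightarrow> 'w \<Rightarrow> 'w"
    and A :: "(real^'n \<Rightarrow> complex) set" and \<beta> +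
  fixes Q :: "(real^'n) set" and a b :: "nat \<Rightarrow> real"
  assumes open_Q: "open Q" and b: "filterlim b (at_right 0) sequentially"
begin

abbreviation N :: "((real^'n) \<times> 'w) measure" where "N \<equiv> QOm Q M"

lemma Q_borel [measurable]: "Q \<in> sets borel"
  using open_Q by auto

lemma sigma_finite_Q: "sigma_finite_measure (restrict_space lborel Q)"
  by (rule sigma_finite_measure_restrict_space) (auto intro: lborel.sigma_finite_measure_axioms)

sublocale QM: pair_sigma_finite "restrict_space lborel Q" M
  by (intro pair_sigma_finite.intro sigma_finite_Q sigma_finite_measure_axioms)

sublocale N: sigma_finite_measure N
  unfolding QOm_def by (rule QM.P.sigma_finite_measure_axioms)

sublocale NB: pair_sigma_finite N \<beta>
  by (intro pair_sigma_finite.intro N.sigma_finite_measure_axioms \<beta>.sigma_finite_measure_axioms)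

lemma space_N: "space N = Q \<times> space M"
  by (simp add: QOm_def space_pair_measure space_restrict_space)

lemma fst_N_Q [measurable]: "fst \<in> N \<rightarrow>\<^sub>M restrict_space lborel Q"
  and snd_N [measurable]: "snd \<in> N \<rightarrow>\<^sub>M M"
  unfolding QOm_def by measurable

lemma fst_N [measurable]: "fst \<in> borel_measurable N"
proof -
  have "(\<lambda>x. x) \<in> borel_measurable (restrict_space lborel Q)"
    by (rule measurable_restrict_space1) simp
  from measurable_compose[OF fst_N_Q this] show ?thesis by (simp add: id_def)
qed

definition shift :: "nat \<Rightarrow> (real^'n) \<times> 'w \<Rightarrow> (real^'n) \<times> 'w" where
  "shift n z = (fst z, T ((1 / a n) *\<^sub>R fst z) (snd z))"

lemma fst_shift [simp]: "fst (shift n z) = fst z"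
  by (simp add: shift_def)

lemma shift_measurable [measurable]: "shift n \<in> N \<rightarrow>\<^sub>M N"
proof -
  have "(\<lambda>z. T ((1 / a n) *\<^sub>R fst z) (snd z)) \<in> N \<rightarrow>\<^sub>M M"
    by (intro T_joint_compose snd_N) measurable
  then have "(\<lambda>z. (fst z, T ((1 / a n) *\<^sub>R fst z) (snd z))) \<in> N \<rightarrow>\<^sub>M restrict_space lborel Q \<Otimes>\<^sub>M M"
    by (rule measurable_Pair[OF fst_N_Q])
  moreover have "shift n = (\<lambda>z. (fst z, T ((1 / a n) *\<^sub>R fst z) (snd z)))"
    by (auto simp: shift_def)
  ultimately show ?thesis by (simp add: QOm_def)
qed

lemma shift_space: "z \<in> space N \<Longrightarrow> shift n z \<in> space N"
  using shift_measurable by (rule measurable_space)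

text \<open>Over a fixed x the map is the single measure-preserving map
  \<open>T ((1 / a n) *\<^sub>R x)\<close>, so all slices keep their measure.\<close>

lemma shift_distr: "distr N N (shift n) = N"
proof (rule measure_eqI)
  fix B assume "B \<in> sets (distr N N (shift n))"
  then have B [measurable]: "B \<in> sets (restrict_space lborel Q \<Otimes>\<^sub>M M)" by (simp add: QOm_def)
  have BN: "B \<in> sets N" using B by (simp add: QOm_def)
  let ?S = "shift n -` B \<inter> space N"
  have S: "?S \<in> sets (restrict_space lborel Q \<Otimes>\<^sub>M M)"
    using measurable_sets[OF shift_measurable BN] by (simp add: QOm_def)
  have "emeasure (distr N N (shift n)) B = emeasure (restrict_space lborel Q \<Otimes>\<^sub>M M) ?S"
    using BN by (subst emeasure_distr) (auto simp: QOm_def[symmetric])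
  also have "\<dots> = (\<integral>\<^sup>+x. emeasure M (Pair x -` ?S) \<partial>restrict_space lborel Q)"
    by (rule emeasure_pair_measure_alt[OF S])
  also have "\<dots> = (\<integral>\<^sup>+x. emeasure M (Pair x -` B) \<partial>restrict_space lborel Q)"
  proof (rule nn_integral_cong)
    fix x assume "x \<in> space (restrict_space lborel Q)"
    then have x: "x \<in> Q" by (simp add: space_restrict_space)
    have "Pair x -` ?S = T ((1 / a n) *\<^sub>R x) -` (Pair x -` B) \<inter> space M"
      using x by (auto simp: shift_def space_N)
    moreover have "Pair x -` B \<in> sets M" using B by (rule sets_Pair1)
    ultimately have "emeasure M (Pair x -` ?S) = emeasure (distr M M (T ((1 / a n) *\<^sub>R x))) (Pair x -` B)"
      by (simp add: emeasure_distr)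
    then show "emeasure M (Pair x -` ?S) = emeasure M (Pair x -` B)" by (simp add: T_distr)
  qed
  also have "\<dots> = emeasure N B"
    unfolding QOm_def by (rule emeasure_pair_measure_alt[OF B, symmetric])
  finally show "emeasure (distr N N (shift n)) B = emeasure N B" .
qed simp

lemma
  fixes f :: "_ \<Rightarrow> 'b::{banach, second_countable_topology}"
  assumes "f \<in> borel_measurable N"
  shows integral_shift: "(LINT z|N. f (shift n z)) = (LINT z|N. f z)"
    and integrable_shift: "integrable N (\<lambda>z. f (shift n z)) \<longleftrightarrow> integrable N f"
  using integral_distr[OF shift_measurable[of n] assms] integrable_distr_eq[OF shift_measurable[of n] assms]
  by (simp_all add: shift_distr)

lemma AE_shift: "AE z in N. R z \<Longrightarrow> AE z in N. R (shift n z)"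
  using AE_distrD[OF shift_measurable[of n], of R] unfolding shift_distr .

lemma Lp_shift:
  assumes "Lp N p f"
  shows "Lp N p (\<lambda>z. f (shift n z))" "(LINT z|N. cmod (f (shift n z)) powr p) = (LINT z|N. cmod (f z) powr p)"
proof -
  note [measurable] = LpD(1)[OF assms]
  have m: "(\<lambda>z. cmod (f z) powr p) \<in> borel_measurable N" by measurable
  show "Lp N p (\<lambda>z. f (shift n z))"
    using LpD(2)[OF assms] integrable_shift[OF m] measurable_compose[OF shift_measurable LpD(1)[OF assms]]
    by (simp add: Lp_def)
  show "(LINT z|N. cmod (f (shift n z)) powr p) = (LINT z|N. cmod (f z) powr p)"
    by (rule integral_shift[OF m])
qed

definition sample :: "nat \<Rightarrow> (real^'n \<Rightarrow> complex) \<Rightarrow> (real^'n) \<times> 'w \<Rightarrow> complex" where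
  "sample n u z = u ((1 / b n) *\<^sub>R fst z)"

lemma sample_measurable: "u \<in> A \<Longrightarrow> sample n u \<in> borel_measurable N"
  unfolding sample_def by (rule measurable_compose[OF _ A_measurable]) measurable

lemma sample_bounded: "u \<in> A \<Longrightarrow> cmod (sample n u z) \<le> sup_norm u"
  unfolding sample_def by (rule norm_le_sup_norm)

text \<open>Invariance of the measure removes the fast stochastic variable; what remains is the mean value
  property in the deterministic one.\<close>
lemma mean_value_tendsto:
  assumes \<Phi>: "integrable N \<Phi>" and u: "u \<in> A"
  shows "(\<lambda>n. LINT z|N. \<Phi> (shift n z) * sample n u z) \<longlonglongrightarrow> (LINT z|N. \<Phi> z) * (LINT s|\<beta>. s u)"
proof -
  note [measurable] = borel_measurable_integrable[OF \<Phi>] sample_measurable[OF u]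
  \<comment> \<open>The average over \<omega>, extended by 0 outside Q so that the mean value
    property on the whole space can be applied to it.\<close>
  define \<phi> where "\<phi> x = indicator Q x *\<^sub>R (LINT \<omega>|M. \<Phi> (x, \<omega>))" for x
  have \<Phi>': "integrable (restrict_space lborel Q \<Otimes>\<^sub>M M) \<Phi>" using \<Phi> by (simp add: QOm_def)
  have "integrable (restrict_space lborel Q) (\<lambda>x. LINT \<omega>|M. \<Phi> (x, \<omega>))"
    by (rule QM.integrable_fst'[OF \<Phi>'])
  then have int\<phi>: "integrable lborel \<phi>"
    unfolding \<phi>_def by (subst (asm) integrable_restrict_space) simp_all
  have "(LINT x|lborel. \<phi> x) = (LINT x|restrict_space lborel Q. LINT \<omega>|M. \<Phi> (x, \<omega>))"
    unfolding \<phi>_def by (subst integral_restrict_space) simp_all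
  also have "\<dots> = (LINT z|N. \<Phi> z)"
    unfolding QOm_def by (rule QM.integral_fst'[OF \<Phi>'])
  finally have I\<phi>: "(LINT x|lborel. \<phi> x) = (LINT z|N. \<Phi> z)" .
  have eq: "(LINT z|N. \<Phi> (shift n z) * sample n u z) = (LINT x|lborel. u ((1 / b n) *\<^sub>R x) * \<phi> x)" for n
  proof -
    let ?G = "\<lambda>z. \<Phi> z * sample n u z"
    have mG: "?G \<in> borel_measurable N" by measurable
    have "integrable N (\<lambda>z. sup_norm u * cmod (\<Phi> z))" using \<Phi> by simp
    then have "integrable N ?G"
    proof (rule Bochner_Integration.integrable_bound[OF _ mG], intro AE_I2)
      fix z
      have "cmod (\<Phi> z) * cmod (sample n u z) \<le> cmod (\<Phi> z) * sup_norm u"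
        by (intro mult_left_mono sample_bounded u) auto
      then show "norm (?G z) \<le> norm (sup_norm u * cmod (\<Phi> z))"
        using sup_norm_nonneg[OF u] by (simp add: norm_mult abs_mult mult.commute)
    qed
    then have intG: "integrable (restrict_space lborel Q \<Otimes>\<^sub>M M) ?G" by (simp add: QOm_def)
    \<comment> \<open>\<open>sample\<close> reads only the first component, which
      \<open>shift\<close> leaves alone; so the entire integrand is a composition with
      \<open>shift\<close>.\<close>
    have "(LINT z|N. \<Phi> (shift n z) * sample n u z) = (LINT z|N. ?G (shift n z))"
      by (simp add: sample_def)
    also have "\<dots> = (LINT z|N. ?G z)" by (rule integral_shift[OF mG])
    also have "\<dots> = (LINT x|restrict_space lborel Q. LINT \<omega>|M. ?G (x, \<omega>))"
      unfolding QOm_def by (rule QM.integral_fst'[OF intG, symmetric])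
    also have "\<dots> = (LINT x|restrict_space lborel Q. u ((1 / b n) *\<^sub>R x) * (LINT \<omega>|M. \<Phi> (x, \<omega>)))"
      by (simp add: sample_def mult.commute)
    also have "\<dots> = (LINT x|lborel. indicator Q x *\<^sub>R (u ((1 / b n) *\<^sub>R x) * (LINT \<omega>|M. \<Phi> (x, \<omega>))))"
      by (subst integral_restrict_space) simp_all
    also have "\<dots> = (LINT x|lborel. u ((1 / b n) *\<^sub>R x) * \<phi> x)"
      by (simp add: \<phi>_def)
    finally show ?thesis .
  qed
  have "((\<lambda>t. LINT x|lborel. u ((1 / t) *\<^sub>R x) * \<phi> x) \<longlongrightarrow> mean_value u * (LINT x|lborel. \<phi> x)) (at_right 0)"
    using has_mean_mean_value[OF u] int\<phi> unfolding has_mean_def by blast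
  from filterlim_compose[OF this b]
  show ?thesis unfolding eq I\<phi> integral_hat[OF u] by (simp add: mult.commute)
qed

section \<open>Density of tensor sums in \<open>L\<^sup>p(Q \<times> \<Omega>)\<close>\<close>

definition tensor_sums :: "((real^'n) \<times> 'w \<Rightarrow> complex) set" where
  "tensor_sums = {\<Theta>. \<exists>(m::nat) \<phi> \<psi>. (\<forall>k<m. smooth_compact_support Q (\<phi> k) \<and> stoch_smooth M T (\<psi> k)) \<and>
     \<Theta> = (\<lambda>(x, \<omega>). \<Sum>k<m. \<phi> k x * \<psi> k \<omega>)}"

lemma tensor_sumsI:
  assumes "smooth_compact_support Q \<phi>" "stoch_smooth M T \<psi>"
  shows "(\<lambda>(x, \<omega>). \<phi> x * \<psi> \<omega>) \<in> tensor_sums"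
  unfolding tensor_sums_def using assms
  by (intro CollectI exI[of _ 1] exI[of _ "\<lambda>_. \<phi>"] exI[of _ "\<lambda>_. \<psi>"]) auto

lemma lin_closed_tensor_sums: "lin_closed tensor_sums"
  unfolding lin_closed_def
proof (intro conjI ballI allI)
  show "(\<lambda>_. 0) \<in> tensor_sums"
    unfolding tensor_sums_def by (intro CollectI exI[of _ 0]) (auto simp: fun_eq_iff)
next
  fix f g assume f: "f \<in> tensor_sums" and g: "g \<in> tensor_sums"
  from f obtain m :: nat and \<phi> \<psi> where f: "\<forall>k<m. smooth_compact_support Q (\<phi> k) \<and> stoch_smooth M T (\<psi> k)"
      "f = (\<lambda>(x, \<omega>). \<Sum>k<m. \<phi> k x * \<psi> k \<omega>)"
    unfolding tensor_sums_def mem_Collect_eq by (elim exE conjE)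
  from g obtain m' :: nat and \<phi>' \<psi>' where g: "\<forall>k<m'. smooth_compact_support Q (\<phi>' k) \<and> stoch_smooth M T (\<psi>' k)"
      "g = (\<lambda>(x, \<omega>). \<Sum>k<m'. \<phi>' k x * \<psi>' k \<omega>)"
    unfolding tensor_sums_def mem_Collect_eq by (elim exE conjE)
  define \<phi>'' where "\<phi>'' k = (if k < m then \<phi> k else \<phi>' (k - m))" for k
  define \<psi>'' where "\<psi>'' k = (if k < m then \<psi> k else \<psi>' (k - m))" for k
  have split: "(\<Sum>k<m + m'. F k) = (\<Sum>k<m. F k) + (\<Sum>k<m'. F (m + k))" for F :: "nat \<Rightarrow> complex"
    by (induction m') (simp_all add: add.assoc)
  show "(\<lambda>z. f z + g z) \<in> tensor_sums"
    unfolding tensor_sums_def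
  proof (intro CollectI exI[of _ "m + m'"] exI[of _ \<phi>''] exI[of _ \<psi>''] conjI)
    show "\<forall>k<m + m'. smooth_compact_support Q (\<phi>'' k) \<and> stoch_smooth M T (\<psi>'' k)"
      using f(1) g(1) by (simp add: \<phi>''_def \<psi>''_def)
    show "(\<lambda>z. f z + g z) = (\<lambda>(x, \<omega>). \<Sum>k<m + m'. \<phi>'' k x * \<psi>'' k \<omega>)"
      unfolding split f(2) g(2) by (auto simp: \<phi>''_def \<psi>''_def fun_eq_iff)
  qed
next
  fix c f assume "f \<in> tensor_sums"
  then obtain m :: nat and \<phi> \<psi> where f: "\<forall>k<m. smooth_compact_support Q (\<phi> k) \<and> stoch_smooth M T (\<psi> k)"
      "f = (\<lambda>(x, \<omega>). \<Sum>k<m. \<phi> k x * \<psi> k \<omega>)"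
    unfolding tensor_sums_def mem_Collect_eq by (elim exE conjE)
  have sc: "smooth_compact_support Q (\<lambda>x. c * \<phi> k x)" if "k < m" for k
    using lin_closedD(3)[OF lin_closed_smooth_compact_support, of "\<phi> k" Q c] f(1) that by simp
  show "(\<lambda>z. c * f z) \<in> tensor_sums"
    unfolding tensor_sums_def using f sc
    by (intro CollectI exI[of _ m] exI[of _ "\<lambda>k x. c * \<phi> k x"] exI[of _ \<psi>])
      (auto simp: sum_distrib_left mult.assoc fun_eq_iff)
qed

lemma Lp_in_tensor_closure:
  assumes s: "1 \<le> s" and f: "Lp N s f"
  shows "f \<in> Lp_closure N s tensor_sums"
  unfolding QOm_def
proof (rule Lp_in_closure_pair[OF sigma_finite_Q finite_measure_axioms _ lin_closed_tensor_sums])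
  show "0 < s" using s by simp
  show "(\<lambda>(x, \<omega>). d1 x * d2 \<omega>) \<in> tensor_sums"
    if "d1 \<in> {\<phi>. smooth_compact_support Q \<phi>}" "d2 \<in> {\<psi>. stoch_smooth M T \<psi>}" for d1 d2
    using that by (intro tensor_sumsI) auto
  show "indicator B \<in> Lp_closure (restrict_space lborel Q) s {\<phi>. smooth_compact_support Q \<phi>}"
    if "B \<in> sets (restrict_space lborel Q)" "emeasure (restrict_space lborel Q) B < \<infinity>" for B
    using s that by (intro indicator_in_smooth_closure open_Q) auto
  show "indicator C \<in> Lp_closure M s {\<psi>. stoch_smooth M T \<psi>}" if "C \<in> sets M" for C
    by (rule indicator_in_stoch_smooth_closure[OF that s])
  show "Lp (restrict_space lborel Q \<Otimes>\<^sub>M M) s f" using f by (simp add: QOm_def)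
qed

lemma spec_sum:
  fixes m :: nat
  assumes s: "s \<in> spectrum_alg A" and u: "\<And>k. k < m \<Longrightarrow> u k \<in> A"
  shows "(\<lambda>y. \<Sum>k<m. c k * u k y) \<in> A \<and> s (\<lambda>y. \<Sum>k<m. c k * u k y) = (\<Sum>k<m. c k * s (u k))"
  using u
proof (induction m)
  case 0
  then show ?case using A_const[of 0] spec_const[OF s, of 0] by simp
next
  case (Suc m)
  then have IH: "(\<lambda>y. \<Sum>k<m. c k * u k y) \<in> A" "s (\<lambda>y. \<Sum>k<m. c k * u k y) = (\<Sum>k<m. c k * s (u k))"
    and um: "u m \<in> A" by auto
  show ?case
    using A_add[OF IH(1) A_scale[OF um, of "c m"]] spec_add[OF s IH(1) A_scale[OF um, of "c m"]]
      spec_scale[OF s um, of "c m"] IH(2) by simp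
qed

end

section \<open>Extension of the class of test functions\<close>

context oscillation
begin

text \<open>Weak stochastic Sigma-convergence at the scales a and b, with the bound on norms turned
  into a bound on modulars.\<close>

definition converges_against_tests ::
  "real \<Rightarrow> (nat \<Rightarrow> (real^'n) \<times> 'w \<Rightarrow> complex) \<Rightarrow> (((real^'n) \<times> 'w) \<times> ((real^'n \<Rightarrow> complex) \<Rightarrow> complex) \<Rightarrow> complex) \<Rightarrow> bool" where
  "converges_against_tests q u U \<longleftrightarrow> (\<forall>n. Lp N q (u n)) \<and> (\<exists>K. \<forall>n. (LINT z|N. cmod (u n z) powr q) \<le> K) \<and>
     Lp (N \<Otimes>\<^sub>M \<beta>) q U \<and>
     (\<forall>f. test_fun Q M T A f \<longrightarrow> (\<lambda>n. LINT z|N. u n z * osc T (a n) (b n) f z)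
        \<longlonglongrightarrow> (LINT w|(N \<Otimes>\<^sub>M \<beta>). U w * snd w (f (fst (fst w)) (snd (fst w)))))"

lemma converges_against_testsD:
  assumes "converges_against_tests q u U"
  shows "Lp N q (u n)" "\<exists>K. \<forall>n. (LINT z|N. cmod (u n z) powr q) \<le> K" "Lp (N \<Otimes>\<^sub>M \<beta>) q U"
    and "test_fun Q M T A f \<Longrightarrow> (\<lambda>n. LINT z|N. u n z * osc T (a n) (b n) f z)
        \<longlonglongrightarrow> (LINT w|(N \<Otimes>\<^sub>M \<beta>). U w * snd w (f (fst (fst w)) (snd (fst w))))"
proof -
  note * = assms[unfolded converges_against_tests_def]
  show "Lp N q (u n)" by (rule *[THEN conjunct1, THEN spec])
  show "\<exists>K. \<forall>n. (LINT z|N. cmod (u n z) powr q) \<le> K" by (rule *[THEN conjunct2, THEN conjunct1])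
  show "Lp (N \<Otimes>\<^sub>M \<beta>) q U" by (rule *[THEN conjunct2, THEN conjunct2, THEN conjunct1])
  show "test_fun Q M T A f \<Longrightarrow> (\<lambda>n. LINT z|N. u n z * osc T (a n) (b n) f z)
        \<longlonglongrightarrow> (LINT w|(N \<Otimes>\<^sub>M \<beta>). U w * snd w (f (fst (fst w)) (snd (fst w))))"
    by (rule *[THEN conjunct2, THEN conjunct2, THEN conjunct2, THEN spec, THEN mp])
qed

lemma NB_space:
  assumes "w \<in> space (N \<Otimes>\<^sub>M \<beta>)"
  shows "fst w \<in> space N" "snd w \<in> spectrum_alg A"
  using assms by (simp_all only: space_pair_measure space_\<beta> mem_Times_iff)

text \<open>The bound does not depend on n. \<open>Lp_tensor_hat\<close> has the same constant on
  the limit side, so one approximation of \<Phi> serves the sequence and its limit at once.\<close>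

lemma Lp_osc:
  assumes \<Phi>: "Lp N p \<Phi>" and c: "c \<in> A" and p: "0 \<le> p"
  shows "Lp N p (\<lambda>z. \<Phi> (shift n z) * sample n c z)"
    and "(LINT z|N. cmod (\<Phi> (shift n z) * sample n c z) powr p) \<le> sup_norm c powr p * (LINT z|N. cmod (\<Phi> z) powr p)"
proof -
  show L: "Lp N p (\<lambda>z. \<Phi> (shift n z) * sample n c z)"
    using p sample_bounded[OF c]
    by (intro Lp_mult_bounded[OF Lp_shift(1)[OF \<Phi>] sample_measurable[OF c], where C="sup_norm c"]) auto
  have "(LINT z|N. cmod (\<Phi> (shift n z) * sample n c z) powr p) \<le> (LINT z|N. sup_norm c powr p * cmod (\<Phi> (shift n z)) powr p)"
  proof (rule integral_mono[OF LpD(2)[OF L]])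
    show "integrable N (\<lambda>z. sup_norm c powr p * cmod (\<Phi> (shift n z)) powr p)"
      using LpD(2)[OF Lp_shift(1)[OF \<Phi>]] by simp
    fix z
    have "cmod (\<Phi> (shift n z) * sample n c z) \<le> sup_norm c * cmod (\<Phi> (shift n z))"
      unfolding norm_mult using sample_bounded[OF c, of n z]
      by (subst mult.commute) (intro mult_right_mono, auto)
    then have "cmod (\<Phi> (shift n z) * sample n c z) powr p \<le> (sup_norm c * cmod (\<Phi> (shift n z))) powr p"
      using p by (intro powr_mono2) auto
    also have "\<dots> = sup_norm c powr p * cmod (\<Phi> (shift n z)) powr p"
      using sup_norm_nonneg[OF c] by (simp add: powr_mult)
    finally show "cmod (\<Phi> (shift n z) * sample n c z) powr p \<le> sup_norm c powr p * cmod (\<Phi> (shift n z)) powr p" .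
  qed
  also have "\<dots> = sup_norm c powr p * (LINT z|N. cmod (\<Phi> z) powr p)"
    using Lp_shift(2)[OF \<Phi>, of n] by simp
  finally show "(LINT z|N. cmod (\<Phi> (shift n z) * sample n c z) powr p) \<le> sup_norm c powr p * (LINT z|N. cmod (\<Phi> z) powr p)" .
qed

lemma Lp_hat:
  assumes c: "c \<in> A" and p: "0 \<le> p"
  shows "Lp \<beta> p (\<lambda>s. s c)" "(LINT s|\<beta>. cmod (s c) powr p) \<le> sup_norm c powr p"
proof -
  have le: "cmod (s c) powr p \<le> sup_norm c powr p" if "s \<in> space \<beta>" for s
    using hat_bounded[OF c that] p by (intro powr_mono2) auto
  show L: "Lp \<beta> p (\<lambda>s. s c)"
  proof (rule Lp_bound[OF hat_measurable[OF c], where g="\<lambda>_. of_real (sup_norm c)"])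
    show "Lp \<beta> p (\<lambda>_. of_real (sup_norm c))" by (simp add: Lp_def)
    show "AE s in \<beta>. cmod (s c) \<le> cmod (of_real (sup_norm c))"
      using hat_bounded[OF c] by (auto intro: order_trans[OF _ abs_ge_self])
  qed (use p in auto)
  have "(LINT s|\<beta>. cmod (s c) powr p) \<le> (LINT s|\<beta>. sup_norm c powr p)"
    using le LpD(2)[OF L] by (intro integral_mono) auto
  then show "(LINT s|\<beta>. cmod (s c) powr p) \<le> sup_norm c powr p" by (simp add: \<beta>.prob_space)
qed

lemma Lp_tensor_hat:
  assumes \<Phi>: "Lp N p \<Phi>" and c: "c \<in> A" and p: "0 \<le> p"
  shows "Lp (N \<Otimes>\<^sub>M \<beta>) p (\<lambda>w. \<Phi> (fst w) * snd w c)"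
    and "(LINT w|(N \<Otimes>\<^sub>M \<beta>). cmod (\<Phi> (fst w) * snd w c) powr p) \<le> sup_norm c powr p * (LINT z|N. cmod (\<Phi> z) powr p)"
proof -
  note t = Lp_tensor[OF N.sigma_finite_measure_axioms \<beta>.sigma_finite_measure_axioms \<Phi> Lp_hat(1)[OF c p]]
  show "Lp (N \<Otimes>\<^sub>M \<beta>) p (\<lambda>w. \<Phi> (fst w) * snd w c)"
    using t(1) by (simp add: case_prod_beta')
  have "(LINT w|(N \<Otimes>\<^sub>M \<beta>). cmod (\<Phi> (fst w) * snd w c) powr p)
      = (LINT z|N. cmod (\<Phi> z) powr p) * (LINT s|\<beta>. cmod (s c) powr p)"
    using t(2) by (simp add: split_beta)
  also have "\<dots> \<le> (LINT z|N. cmod (\<Phi> z) powr p) * sup_norm c powr p"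
    using Lp_hat(2)[OF c p] by (intro mult_left_mono) auto
  finally show "(LINT w|(N \<Otimes>\<^sub>M \<beta>). cmod (\<Phi> (fst w) * snd w c) powr p) \<le> sup_norm c powr p * (LINT z|N. cmod (\<Phi> z) powr p)"
    by (simp add: mult.commute)
qed

lemma tendsto_tensor_sums:
  assumes u: "converges_against_tests q u U" and \<Theta>: "\<Theta> \<in> tensor_sums" and c: "c \<in> A"
  shows "(\<lambda>n. LINT z|N. u n z * (\<Theta> (shift n z) * sample n c z)) \<longlonglongrightarrow> (LINT w|(N \<Otimes>\<^sub>M \<beta>). U w * (\<Theta> (fst w) * snd w c))"
proof -
  from \<Theta> obtain m :: nat and \<phi> \<psi> where f: "\<forall>k<m. smooth_compact_support Q (\<phi> k) \<and> stoch_smooth M T (\<psi> k)"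
      "\<Theta> = (\<lambda>(x, \<omega>). \<Sum>k<m. \<phi> k x * \<psi> k \<omega>)"
    unfolding tensor_sums_def mem_Collect_eq by (elim exE conjE)
  define f where "f x \<omega> y = \<Theta> (x, \<omega>) * c y" for x \<omega> y
  have "test_fun Q M T A f"
    unfolding test_fun_def
    by (intro exI[of _ m] exI[of _ \<phi>] exI[of _ \<psi>] exI[of _ "\<lambda>_. c"])
      (use f c in \<open>auto simp: f_def sum_distrib_right\<close>)
  then have "(\<lambda>n. LINT z|N. u n z * osc T (a n) (b n) f z)
      \<longlonglongrightarrow> (LINT w|(N \<Otimes>\<^sub>M \<beta>). U w * snd w (f (fst (fst w)) (snd (fst w))))"
    by (rule converges_against_testsD(4)[OF u])
  moreover have "osc T (a n) (b n) f z = \<Theta> (shift n z) * sample n c z" for n z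
    by (simp add: osc_def f_def shift_def sample_def)
  moreover have "(LINT w|(N \<Otimes>\<^sub>M \<beta>). U w * snd w (f (fst (fst w)) (snd (fst w)))) = (LINT w|(N \<Otimes>\<^sub>M \<beta>). U w * (\<Theta> (fst w) * snd w c))"
  proof (rule Bochner_Integration.integral_cong)
    fix w assume "w \<in> space (N \<Otimes>\<^sub>M \<beta>)"
    then have "snd w \<in> spectrum_alg A" by (rule NB_space(2))
    from spec_scale[OF this c, of "\<Theta> (fst w)"]
    have "snd w (f (fst (fst w)) (snd (fst w))) = \<Theta> (fst w) * snd w c"
      unfolding f_def prod.collapse .
    then show "U w * snd w (f (fst (fst w)) (snd (fst w))) = U w * (\<Theta> (fst w) * snd w c)"
      by simp
  qed simp
  ultimately show ?thesis by simp
qed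

text \<open>\<Phi> is replaced by a tensor sum \<Theta> at the cost of an error uniform in n. By
  Young's inequality with weight \<eta> this error is split into a part carried by u, bounded
  through K', and a part carried by \<Phi> - \<Theta>.\<close>

lemma tendsto_Lp_tests:
  assumes pq: "1 < p" "1 < q" "1 / p + 1 / q = 1" and u: "converges_against_tests q u U"
    and \<Phi>: "Lp N p \<Phi>" and c: "c \<in> A"
  shows "(\<lambda>n. LINT z|N. u n z * (\<Phi> (shift n z) * sample n c z)) \<longlonglongrightarrow> (LINT w|(N \<Otimes>\<^sub>M \<beta>). U w * (\<Phi> (fst w) * snd w c))"
proof (rule tendsto_approx)
  fix \<epsilon> :: real assume "0 < \<epsilon>"
  have qp: "1 / q + 1 / p = 1" using pq by simp
  note Lu = converges_against_testsD(1)[OF u] and LU = converges_against_testsD(3)[OF u]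
  obtain K where K: "\<And>n. (LINT z|N. cmod (u n z) powr q) \<le> K"
    using converges_against_testsD(2)[OF u] by blast
  \<comment> \<open>One bound for the sequence and for its limit; the integral in the maximum also
    makes K' nonnegative.\<close>
  define K' where "K' = max K (LINT w|(N \<Otimes>\<^sub>M \<beta>). cmod (U w) powr q)"
  have K': "0 \<le> K'" "\<And>n. (LINT z|N. cmod (u n z) powr q) \<le> K'" "(LINT w|(N \<Otimes>\<^sub>M \<beta>). cmod (U w) powr q) \<le> K'"
    using K by (auto simp: K'_def le_max_iff_disj)
  define \<eta> where "\<eta> = \<epsilon> / (2 * (K' + 1))"
  have "0 < \<eta>" using \<open>0 < \<epsilon>\<close> K'(1) by (simp add: \<eta>_def)
  have \<eta>K: "\<eta> * K' \<le> \<epsilon> / 2" using \<open>0 < \<epsilon>\<close> K'(1) by (simp add: \<eta>_def field_simps)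
  obtain C where C0: "0 \<le> C" and C: "\<And>x y. 0 \<le> x \<Longrightarrow> 0 \<le> y \<Longrightarrow> x * y \<le> \<eta> * x powr q + C * y powr p"
    by (rule young_eps[OF pq(2,1) qp \<open>0 < \<eta>\<close>]) (rule that; blast)
  define \<alpha> where "\<alpha> = C * sup_norm c powr p + 1"
  have "0 < \<alpha>" using C0 by (simp add: \<alpha>_def add_nonneg_pos)
  have "\<Phi> \<in> Lp_closure N p tensor_sums" using pq \<Phi> by (intro Lp_in_tensor_closure) auto
  moreover have "0 < \<epsilon> / (2 * \<alpha>)" using \<open>0 < \<epsilon>\<close> \<open>0 < \<alpha>\<close> by simp
  ultimately obtain \<Theta> where \<Theta>: "\<Theta> \<in> tensor_sums" "Lp N p \<Theta>" "(LINT z|N. cmod (\<Phi> z - \<Theta> z) powr p) < \<epsilon> / (2 * \<alpha>)"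
    by (rule Lp_closureE)
  have D: "Lp N p (\<lambda>z. \<Phi> z - \<Theta> z)" using pq by (intro Lp_diff \<Phi> \<Theta>) auto
  have small: "\<eta> * x + C * y \<le> \<epsilon>" if "x \<le> K'" "y \<le> sup_norm c powr p * (LINT z|N. cmod (\<Phi> z - \<Theta> z) powr p)" for x y
  proof -
    have "C * y \<le> C * (sup_norm c powr p * (LINT z|N. cmod (\<Phi> z - \<Theta> z) powr p))"
      using that C0 by (intro mult_left_mono)
    also have "\<dots> \<le> \<alpha> * (LINT z|N. cmod (\<Phi> z - \<Theta> z) powr p)"
      unfolding mult.assoc[symmetric] by (intro mult_right_mono) (auto simp: \<alpha>_def)
    also have "\<dots> \<le> \<alpha> * (\<epsilon> / (2 * \<alpha>))" using \<Theta>(3) \<open>0 < \<alpha>\<close> by (intro mult_left_mono) auto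
    also have "\<dots> = \<epsilon> / 2" using \<open>0 < \<alpha>\<close> by simp
    finally have "C * y \<le> \<epsilon> / 2" .
    moreover have "\<eta> * x \<le> \<eta> * K'" using that \<open>0 < \<eta>\<close> by (intro mult_left_mono) auto
    ultimately show ?thesis using \<eta>K by linarith
  qed
  have p0: "0 \<le> p" using pq by simp
  let ?Y = "\<lambda>n. LINT z|N. u n z * (\<Theta> (shift n z) * sample n c z)"
  let ?m = "LINT w|(N \<Otimes>\<^sub>M \<beta>). U w * (\<Theta> (fst w) * snd w c)"
  have "norm ((LINT z|N. u n z * (\<Phi> (shift n z) * sample n c z)) - ?Y n) \<le> \<epsilon>" for n
  proof -
    have "(LINT z|N. u n z * (\<Phi> (shift n z) * sample n c z)) - ?Y n
        = (LINT z|N. u n z * (\<Phi> (shift n z) * sample n c z) - u n z * (\<Theta> (shift n z) * sample n c z))"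
      by (intro Bochner_Integration.integral_diff[symmetric] Lp_mult_integrable[OF pq(2,1) qp Lu] Lp_osc \<Phi> \<Theta> c p0)
    also have "\<dots> = (LINT z|N. u n z * ((\<Phi> (shift n z) - \<Theta> (shift n z)) * sample n c z))"
      by (intro Bochner_Integration.integral_cong) (auto simp: algebra_simps)
    also have "cmod \<dots> \<le> \<eta> * (LINT z|N. cmod (u n z) powr q) + C * (LINT z|N. cmod ((\<Phi> (shift n z) - \<Theta> (shift n z)) * sample n c z) powr p)"
      by (rule norm_integral_mult_le[OF pq(2,1) qp Lu Lp_osc(1)[OF D c p0] C])
    also have "\<dots> \<le> \<epsilon>" by (rule small[OF K'(2) Lp_osc(2)[OF D c p0]])
    finally show ?thesis .
  qed
  moreover have "norm ((LINT w|(N \<Otimes>\<^sub>M \<beta>). U w * (\<Phi> (fst w) * snd w c)) - ?m) \<le> \<epsilon>"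
  proof -
    have "(LINT w|(N \<Otimes>\<^sub>M \<beta>). U w * (\<Phi> (fst w) * snd w c)) - ?m
        = (LINT w|(N \<Otimes>\<^sub>M \<beta>). U w * (\<Phi> (fst w) * snd w c) - U w * (\<Theta> (fst w) * snd w c))"
      by (intro Bochner_Integration.integral_diff[symmetric] Lp_mult_integrable[OF pq(2,1) qp LU] Lp_tensor_hat \<Phi> \<Theta> c p0)
    also have "\<dots> = (LINT w|(N \<Otimes>\<^sub>M \<beta>). U w * ((\<Phi> (fst w) - \<Theta> (fst w)) * snd w c))"
      by (intro Bochner_Integration.integral_cong) (auto simp: algebra_simps)
    also have "cmod \<dots> \<le> \<eta> * (LINT w|(N \<Otimes>\<^sub>M \<beta>). cmod (U w) powr q) + C * (LINT w|(N \<Otimes>\<^sub>M \<beta>). cmod ((\<Phi> (fst w) - \<Theta> (fst w)) * snd w c) powr p)"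
      by (rule norm_integral_mult_le[OF pq(2,1) qp LU Lp_tensor_hat(1)[OF D c p0] C])
    also have "\<dots> \<le> \<epsilon>" by (rule small[OF K'(3) Lp_tensor_hat(2)[OF D c p0]])
    finally show ?thesis .
  qed
  moreover have "?Y \<longlonglongrightarrow> ?m" by (rule tendsto_tensor_sums[OF u \<Theta>(1) c])
  ultimately show "\<exists>Y m. Y \<longlonglongrightarrow> m \<and>
      (\<forall>\<^sub>F n in sequentially. norm ((LINT z|N. u n z * (\<Phi> (shift n z) * sample n c z)) - Y n) \<le> \<epsilon>) \<and>
      norm ((LINT w|(N \<Otimes>\<^sub>M \<beta>). U w * (\<Phi> (fst w) * snd w c)) - m) \<le> \<epsilon>"
    by (intro exI[of _ ?Y] exI[of _ ?m] conjI always_eventually allI)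
qed

end

section \<open>Step functions with values in the algebra\<close>

lemma Lp_sum:
  assumes "finite I" "\<And>i. i \<in> I \<Longrightarrow> Lp N p (f i)" "0 < p"
  shows "Lp N p (\<lambda>z. \<Sum>i\<in>I. f i z)"
  using assms(1,2)
proof (induction I rule: finite_induct)
  case empty
  then show ?case by (simp add: Lp_def)
next
  case (insert i I)
  then show ?case using assms(3) by (simp add: Lp_add)
qed

lemma Lp_cong:
  assumes "\<And>z. z \<in> space N \<Longrightarrow> f z = g z"
  shows "Lp N p f \<longleftrightarrow> Lp N p g"
proof -
  have "f \<in> borel_measurable N \<longleftrightarrow> g \<in> borel_measurable N"
    by (rule measurable_cong) (rule assms)
  moreover have "integrable N (\<lambda>z. cmod (f z) powr p) \<longleftrightarrow> integrable N (\<lambda>z. cmod (g z) powr p)"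
    by (rule Bochner_Integration.integrable_cong) (simp_all add: assms)
  ultimately show ?thesis by (simp add: Lp_def)
qed

context oscillation
begin

text \<open>Simple functions with values in \<open>A\<close>: unlike the test functions they are stable under
  \<open>g \<mapsto> |g|\<^sup>p\<close>, which gives the convergence of the norms of their oscillating versions.\<close>
definition step_fun :: "((real^'n) \<times> 'w \<Rightarrow> real^'n \<Rightarrow> complex) \<Rightarrow> bool" where
  "step_fun g \<longleftrightarrow> simple_function N g \<and> (\<forall>z\<in>space N. g z \<in> A) \<and>
     emeasure N {z \<in> space N. g z \<noteq> (\<lambda>_. 0)} < \<infinity>"

definition step_vals :: "((real^'n) \<times> 'w \<Rightarrow> real^'n \<Rightarrow> complex) \<Rightarrow> (real^'n \<Rightarrow> complex) set" where
  "step_vals g = g ` space N - {\<lambda>_. 0}"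

definition level :: "((real^'n) \<times> 'w \<Rightarrow> real^'n \<Rightarrow> complex) \<Rightarrow> (real^'n \<Rightarrow> complex) \<Rightarrow> ((real^'n) \<times> 'w) set" where
  "level g c = g -` {c} \<inter> space N"

definition osc_step :: "nat \<Rightarrow> ((real^'n) \<times> 'w \<Rightarrow> real^'n \<Rightarrow> complex) \<Rightarrow> (real^'n) \<times> 'w \<Rightarrow> complex" where
  "osc_step n g z = sample n (g (shift n z)) z"

definition hat_step :: "((real^'n) \<times> 'w \<Rightarrow> real^'n \<Rightarrow> complex)
    \<Rightarrow> ((real^'n) \<times> 'w) \<times> ((real^'n \<Rightarrow> complex) \<Rightarrow> complex) \<Rightarrow> complex" where
  "hat_step g w = snd w (g (fst w))"

lemma finite_step_vals: "step_fun g \<Longrightarrow> finite (step_vals g)"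
  by (simp add: step_fun_def step_vals_def simple_function_def)

lemma step_vals_A: "step_fun g \<Longrightarrow> c \<in> step_vals g \<Longrightarrow> c \<in> A"
  unfolding step_fun_def step_vals_def by blast

lemma level_sets: "step_fun g \<Longrightarrow> level g c \<in> sets N"
  unfolding level_def by (rule simple_functionD(2)) (simp add: step_fun_def)

lemma support_sets: "simple_function N g \<Longrightarrow> {z \<in> space N. g z \<noteq> (\<lambda>_. 0)} \<in> sets N"
  using simple_functionD(2)[of N g "- {\<lambda>_. 0}"] by (simp add: vimage_def Int_def conj_commute)

lemma level_finite:
  assumes g: "step_fun g" and c: "c \<in> step_vals g"
  shows "emeasure N (level g c) < \<infinity>"
proof -
  have "level g c \<subseteq> {z \<in> space N. g z \<noteq> (\<lambda>_. 0)}" using c by (auto simp: level_def step_vals_def)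
  moreover have "{z \<in> space N. g z \<noteq> (\<lambda>_. 0)} \<in> sets N"
    using g by (intro support_sets) (simp add: step_fun_def)
  ultimately have "emeasure N (level g c) \<le> emeasure N {z \<in> space N. g z \<noteq> (\<lambda>_. 0)}"
    by (rule emeasure_mono)
  also have "\<dots> < \<infinity>" using g by (simp add: step_fun_def)
  finally show ?thesis .
qed

text \<open>F will be the sampling at a point or the evaluation of a character. It must vanish at
  the zero function, whose level set is left out of the sum as its measure may be infinite.\<close>

lemma step_fun_expand:
  fixes F :: "(real^'n \<Rightarrow> complex) \<Rightarrow> complex"
  assumes g: "step_fun g" and z: "z \<in> space N" and F: "F (\<lambda>_. 0) = 0"
  shows "F (g z) = (\<Sum>c\<in>step_vals g. indicator (level g c) z * F c)"
proof (cases "g z = (\<lambda>_. 0)")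
  case True
  have "indicator (level g c) z * F c = 0" if "c \<in> step_vals g" for c
    using True that by (auto simp: level_def step_vals_def indicator_def)
  then have "(\<Sum>c\<in>step_vals g. indicator (level g c) z * F c) = 0" by (intro sum.neutral) blast
  then show ?thesis using True F by simp
next
  case False
  have "(\<Sum>c\<in>step_vals g. indicator (level g c) z * F c) = (\<Sum>c\<in>{g z}. indicator (level g c) z * F c)"
  proof (rule sum.mono_neutral_right[OF finite_step_vals[OF g]])
    show "{g z} \<subseteq> step_vals g" using False z by (simp add: step_vals_def)
    show "\<forall>c\<in>step_vals g - {g z}. indicator (level g c) z * F c = 0"
      by (simp add: level_def indicator_def)
  qed
  then show ?thesis using z by (simp add: level_def)
qed

lemma osc_step_expand:
  assumes g: "step_fun g" and z: "z \<in> space N"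
  shows "osc_step n g z = (\<Sum>c\<in>step_vals g. indicator (level g c) (shift n z) * sample n c z)"
  unfolding osc_step_def
  using step_fun_expand[OF g shift_space[OF z], where F="\<lambda>c. sample n c z"] by (simp add: sample_def)

lemma hat_step_expand:
  assumes g: "step_fun g" and w: "w \<in> space (N \<Otimes>\<^sub>M \<beta>)"
  shows "hat_step g w = (\<Sum>c\<in>step_vals g. indicator (level g c) (fst w) * snd w c)"
  unfolding hat_step_def
  by (rule step_fun_expand[OF g NB_space(1)[OF w]]) (rule spec_const[OF NB_space(2)[OF w]])

lemma Lp_level:
  assumes "step_fun g" "c \<in> step_vals g" "0 < p"
  shows "Lp N p (indicator (level g c))"
  using assms by (intro Lp_indicator level_sets level_finite)

lemma Lp_osc_step:
  assumes g: "step_fun g" and p: "0 < p"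
  shows "Lp N p (osc_step n g)"
proof -
  have "Lp N p (\<lambda>z. \<Sum>c\<in>step_vals g. indicator (level g c) (shift n z) * sample n c z)"
    using p by (intro Lp_sum finite_step_vals g Lp_osc(1) Lp_level step_vals_A[OF g]) auto
  moreover have "Lp N p (osc_step n g) \<longleftrightarrow> Lp N p (\<lambda>z. \<Sum>c\<in>step_vals g. indicator (level g c) (shift n z) * sample n c z)"
    by (rule Lp_cong) (rule osc_step_expand[OF g])
  ultimately show ?thesis by simp
qed

lemma Lp_hat_step:
  assumes g: "step_fun g" and p: "0 < p"
  shows "Lp (N \<Otimes>\<^sub>M \<beta>) p (hat_step g)"
proof -
  have "Lp (N \<Otimes>\<^sub>M \<beta>) p (\<lambda>w. \<Sum>c\<in>step_vals g. indicator (level g c) (fst w) * snd w c)"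
    using p by (intro Lp_sum finite_step_vals g Lp_tensor_hat(1) Lp_level step_vals_A[OF g]) auto
  moreover have "Lp (N \<Otimes>\<^sub>M \<beta>) p (hat_step g) \<longleftrightarrow> Lp (N \<Otimes>\<^sub>M \<beta>) p (\<lambda>w. \<Sum>c\<in>step_vals g. indicator (level g c) (fst w) * snd w c)"
    by (rule Lp_cong) (rule hat_step_expand[OF g])
  ultimately show ?thesis by simp
qed

lemma Lp_one_integrable: "Lp N' 1 f \<Longrightarrow> integrable N' f"
  by (simp add: Lp_def integrable_iff_bounded)

text \<open>A finite sum of instances of \<open>mean_value_tendsto\<close>, one for each value.
  Since products and powers of moduli of step functions are step functions again, it also gives the
  limits of pairings and of modulars.\<close>

lemma integral_osc_step_tendsto:
  assumes g: "step_fun g"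
  shows "(\<lambda>n. LINT z|N. osc_step n g z) \<longlonglongrightarrow> (LINT w|(N \<Otimes>\<^sub>M \<beta>). hat_step g w)"
proof -
  have L: "Lp N 1 (indicator (level g c))" if "c \<in> step_vals g" for c
    using that by (intro Lp_level g) auto
  have 1: "(LINT z|N. osc_step n g z) = (\<Sum>c\<in>step_vals g. LINT z|N. indicator (level g c) (shift n z) * sample n c z)" for n
  proof -
    have "(LINT z|N. osc_step n g z) = (LINT z|N. (\<Sum>c\<in>step_vals g. indicator (level g c) (shift n z) * sample n c z))"
      by (rule Bochner_Integration.integral_cong) (simp_all add: osc_step_expand[OF g])
    also have "\<dots> = (\<Sum>c\<in>step_vals g. LINT z|N. indicator (level g c) (shift n z) * sample n c z)"
      by (intro Bochner_Integration.integral_sum Lp_one_integrable Lp_osc(1) L step_vals_A[OF g]) auto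
    finally show ?thesis .
  qed
  have 2: "(LINT w|(N \<Otimes>\<^sub>M \<beta>). hat_step g w) = (\<Sum>c\<in>step_vals g. (LINT z|N. indicator (level g c) z) * (LINT s|\<beta>. s c))"
  proof -
    have "(LINT w|(N \<Otimes>\<^sub>M \<beta>). hat_step g w) = (LINT w|(N \<Otimes>\<^sub>M \<beta>). (\<Sum>c\<in>step_vals g. indicator (level g c) (fst w) * snd w c))"
      by (rule Bochner_Integration.integral_cong) (simp_all add: hat_step_expand[OF g])
    also have "\<dots> = (\<Sum>c\<in>step_vals g. LINT w|(N \<Otimes>\<^sub>M \<beta>). indicator (level g c) (fst w) * snd w c)"
      by (intro Bochner_Integration.integral_sum Lp_one_integrable Lp_tensor_hat(1) L step_vals_A[OF g]) auto
    also have "\<dots> = (\<Sum>c\<in>step_vals g. (LINT z|N. indicator (level g c) z) * (LINT s|\<beta>. s c))"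
    proof (rule sum.cong[OF refl])
      fix c assume c: "c \<in> step_vals g"
      have "integrable (N \<Otimes>\<^sub>M \<beta>) (\<lambda>w. indicator (level g c) (fst w) * snd w c)"
        using c by (intro Lp_one_integrable Lp_tensor_hat(1) L step_vals_A[OF g]) auto
      from NB.integral_fst'[OF this]
      show "(LINT w|(N \<Otimes>\<^sub>M \<beta>). indicator (level g c) (fst w) * snd w c) = (LINT z|N. indicator (level g c) z) * (LINT s|\<beta>. s c)"
        by simp
    qed
    finally show ?thesis .
  qed
  show ?thesis
    unfolding 1 2
    by (intro tendsto_sum mean_value_tendsto Lp_one_integrable L step_vals_A[OF g])
qed

text \<open>The factors \<Psi> and c come from a test function. They are absorbed level by level:
  the indicator of a level times \<Psi> is in \<open>L\<^sup>p\<close>, and the product of the value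
  d with c stays in A.\<close>

lemma tendsto_step_tests:
  assumes pq: "1 < p" "1 < q" "1 / p + 1 / q = 1" and u: "converges_against_tests q u U"
    and g: "step_fun g" and \<Psi>: "\<Psi> \<in> borel_measurable N" "AE z in N. cmod (\<Psi> z) \<le> C" and c: "c \<in> A"
  shows "(\<lambda>n. LINT z|N. u n z * (osc_step n g z * (\<Psi> (shift n z) * sample n c z)))
    \<longlonglongrightarrow> (LINT w|(N \<Otimes>\<^sub>M \<beta>). U w * (hat_step g w * (\<Psi> (fst w) * snd w c)))"
proof -
  have qp: "1 / q + 1 / p = 1" and p0: "0 \<le> p" "0 < p" using pq by simp_all
  note Lu = converges_against_testsD(1)[OF u] and LU = converges_against_testsD(3)[OF u]
  define \<Phi> where "\<Phi> d z = indicator (level g d) z * \<Psi> z" for d z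
  have L: "Lp N p (\<Phi> d)" if "d \<in> step_vals g" for d
    unfolding \<Phi>_def using that by (intro Lp_mult_bounded[OF Lp_level[OF g] \<Psi>] p0)
  define dc where "dc d y = d y * c y" for d y
  have dA: "dc d \<in> A" if "d \<in> step_vals g" for d
    unfolding dc_def by (intro A_mult step_vals_A[OF g that] c)
  have 1: "(LINT z|N. u n z * (osc_step n g z * (\<Psi> (shift n z) * sample n c z)))
      = (\<Sum>d\<in>step_vals g. LINT z|N. u n z * (\<Phi> d (shift n z) * sample n (dc d) z))" for n
  proof -
    have "(LINT z|N. u n z * (osc_step n g z * (\<Psi> (shift n z) * sample n c z)))
      = (LINT z|N. (\<Sum>d\<in>step_vals g. u n z * (\<Phi> d (shift n z) * sample n (dc d) z)))"
      by (rule Bochner_Integration.integral_cong)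
        (simp_all add: osc_step_expand[OF g] sum_distrib_left sum_distrib_right \<Phi>_def sample_def dc_def mult_ac)
    also have "\<dots> = (\<Sum>d\<in>step_vals g. LINT z|N. u n z * (\<Phi> d (shift n z) * sample n (dc d) z))"
      by (intro Bochner_Integration.integral_sum Lp_mult_integrable[OF pq(2,1) qp Lu] Lp_osc(1) L dA p0)
    finally show ?thesis .
  qed
  have 2: "(LINT w|(N \<Otimes>\<^sub>M \<beta>). U w * (hat_step g w * (\<Psi> (fst w) * snd w c)))
      = (\<Sum>d\<in>step_vals g. LINT w|(N \<Otimes>\<^sub>M \<beta>). U w * (\<Phi> d (fst w) * snd w (dc d)))"
  proof -
    have "(LINT w|(N \<Otimes>\<^sub>M \<beta>). U w * (hat_step g w * (\<Psi> (fst w) * snd w c)))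
      = (LINT w|(N \<Otimes>\<^sub>M \<beta>). (\<Sum>d\<in>step_vals g. U w * (\<Phi> d (fst w) * snd w (dc d))))"
    proof (rule Bochner_Integration.integral_cong[OF refl])
      fix w assume w: "w \<in> space (N \<Otimes>\<^sub>M \<beta>)"
      have "snd w (dc d) = snd w d * snd w c" if "d \<in> step_vals g" for d
        unfolding dc_def by (rule spec_mult[OF NB_space(2)[OF w] step_vals_A[OF g that] c])
      then have "(\<Sum>d\<in>step_vals g. U w * (\<Phi> d (fst w) * snd w (dc d)))
          = (\<Sum>d\<in>step_vals g. U w * (indicator (level g d) (fst w) * snd w d * (\<Psi> (fst w) * snd w c)))"
        by (intro sum.cong refl) (simp add: \<Phi>_def)
      then show "U w * (hat_step g w * (\<Psi> (fst w) * snd w c)) = (\<Sum>d\<in>step_vals g. U w * (\<Phi> d (fst w) * snd w (dc d)))"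
        by (simp add: hat_step_expand[OF g w] sum_distrib_left sum_distrib_right)
    qed
    also have "\<dots> = (\<Sum>d\<in>step_vals g. LINT w|(N \<Otimes>\<^sub>M \<beta>). U w * (\<Phi> d (fst w) * snd w (dc d)))"
      by (intro Bochner_Integration.integral_sum Lp_mult_integrable[OF pq(2,1) qp LU] Lp_tensor_hat(1) L dA p0)
    finally show ?thesis .
  qed
  show ?thesis
    unfolding 1 2 by (intro tendsto_sum tendsto_Lp_tests[OF pq u] L dA)
qed

lemma tendsto_step_tests':
  assumes pq: "1 < p" "1 < q" "1 / p + 1 / q = 1" and u: "converges_against_tests q u U" and g: "step_fun g"
  shows "(\<lambda>n. LINT z|N. u n z * osc_step n g z) \<longlonglongrightarrow> (LINT w|(N \<Otimes>\<^sub>M \<beta>). U w * hat_step g w)"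
proof -
  have "(\<lambda>n. LINT z|N. u n z * (osc_step n g z * (1 * sample n (\<lambda>_. 1) z)))
    \<longlonglongrightarrow> (LINT w|(N \<Otimes>\<^sub>M \<beta>). U w * (hat_step g w * (1 * snd w (\<lambda>_. 1))))"
    by (rule tendsto_step_tests[OF pq u g, where \<Psi>="\<lambda>_. 1" and C=1]) (auto intro: A_const)
  moreover have "(LINT w|(N \<Otimes>\<^sub>M \<beta>). U w * (hat_step g w * (1 * snd w (\<lambda>_. 1)))) = (LINT w|(N \<Otimes>\<^sub>M \<beta>). U w * hat_step g w)"
    by (rule Bochner_Integration.integral_cong) (simp_all add: spec_one[OF NB_space(2)])
  ultimately show ?thesis by (simp add: sample_def)
qed

text \<open>Binary, so as to cover sums and products; operations on one step function, such as
  powers of the modulus, use it with g = h.\<close>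

lemma step_fun_combine:
  assumes g: "step_fun g" and h: "step_fun h" and F: "F (\<lambda>_. 0) (\<lambda>_. 0) = (\<lambda>_. 0)"
    and FA: "\<And>c d. c \<in> A \<Longrightarrow> d \<in> A \<Longrightarrow> F c d \<in> A"
  shows "step_fun (\<lambda>z. F (g z) (h z))"
  unfolding step_fun_def
proof (intro conjI ballI)
  have sg: "simple_function N g" and sh: "simple_function N h" using g h by (simp_all add: step_fun_def)
  show sF: "simple_function N (\<lambda>z. F (g z) (h z))" by (rule simple_function_compose2[OF sg sh])
  show "F (g z) (h z) \<in> A" if "z \<in> space N" for z
    using g h that unfolding step_fun_def by (intro FA) blast+
  have "emeasure N {z \<in> space N. F (g z) (h z) \<noteq> (\<lambda>_. 0)}
      \<le> emeasure N ({z \<in> space N. g z \<noteq> (\<lambda>_. 0)} \<union> {z \<in> space N. h z \<noteq> (\<lambda>_. 0)})"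
  proof (rule emeasure_mono)
    show "{z \<in> space N. F (g z) (h z) \<noteq> (\<lambda>_. 0)} \<subseteq> {z \<in> space N. g z \<noteq> (\<lambda>_. 0)} \<union> {z \<in> space N. h z \<noteq> (\<lambda>_. 0)}"
    proof
      fix z assume "z \<in> {z \<in> space N. F (g z) (h z) \<noteq> (\<lambda>_. 0)}"
      then have z: "z \<in> space N" "F (g z) (h z) \<noteq> (\<lambda>_. 0)" by simp_all
      have "g z \<noteq> (\<lambda>_. 0) \<or> h z \<noteq> (\<lambda>_. 0)"
      proof (rule ccontr)
        assume "\<not> ?thesis"
        then have "g z = (\<lambda>_. 0)" "h z = (\<lambda>_. 0)" by simp_all
        then show False using z(2) F by simp
      qed
      then show "z \<in> {z \<in> space N. g z \<noteq> (\<lambda>_. 0)} \<union> {z \<in> space N. h z \<noteq> (\<lambda>_. 0)}" using z(1) by simp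
    qed
    show "{z \<in> space N. g z \<noteq> (\<lambda>_. 0)} \<union> {z \<in> space N. h z \<noteq> (\<lambda>_. 0)} \<in> sets N"
      by (intro sets.Un support_sets sg sh)
  qed
  also have "\<dots> \<le> emeasure N {z \<in> space N. g z \<noteq> (\<lambda>_. 0)} + emeasure N {z \<in> space N. h z \<noteq> (\<lambda>_. 0)}"
    by (intro emeasure_subadditive support_sets sg sh)
  also have "\<dots> < \<infinity>" using g h by (simp add: step_fun_def)
  finally show "emeasure N {z \<in> space N. F (g z) (h z) \<noteq> (\<lambda>_. 0)} < \<infinity>" .
qed

lemma step_fun_mult:
  assumes "step_fun g" "step_fun h"
  shows "step_fun (\<lambda>z y. g z y * h z y)"
  using step_fun_combine[OF assms, of "\<lambda>c d y. c y * d y"] by (simp add: A_mult)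

lemma step_fun_norm_powr:
  assumes "step_fun g" "0 < p"
  shows "step_fun (\<lambda>z y. of_real (cmod (g z y) powr p))"
  using step_fun_combine[OF assms(1,1), of "\<lambda>c d y. of_real (cmod (c y) powr p)"] A_norm_powr(1)[OF _ assms(2)]
  by simp

lemma hat_step_mult:
  assumes "step_fun g" "step_fun h" "w \<in> space (N \<Otimes>\<^sub>M \<beta>)"
  shows "hat_step (\<lambda>z y. g z y * h z y) w = hat_step g w * hat_step h w"
  unfolding hat_step_def using assms NB_space[OF assms(3)]
  by (intro spec_mult) (simp_all add: step_fun_def)

lemma integral_norm_powr_tendsto:
  assumes g: "step_fun g" and p: "0 < p"
  shows "(\<lambda>n. LINT z|N. cmod (osc_step n g z) powr p) \<longlonglongrightarrow> (LINT w|(N \<Otimes>\<^sub>M \<beta>). cmod (hat_step g w) powr p)"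
proof -
  let ?g = "\<lambda>z y. complex_of_real (cmod (g z y) powr p)"
  have "(LINT z|N. osc_step n ?g z) = of_real (LINT z|N. cmod (osc_step n g z) powr p)" for n
    unfolding osc_step_def sample_def by (rule integral_complex_of_real)
  moreover have "(LINT w|(N \<Otimes>\<^sub>M \<beta>). hat_step ?g w) = of_real (LINT w|(N \<Otimes>\<^sub>M \<beta>). cmod (hat_step g w) powr p)"
  proof -
    have "(LINT w|(N \<Otimes>\<^sub>M \<beta>). hat_step ?g w) = (LINT w|(N \<Otimes>\<^sub>M \<beta>). complex_of_real (cmod (hat_step g w) powr p))"
    proof (rule Bochner_Integration.integral_cong[OF refl])
      fix w assume w: "w \<in> space (N \<Otimes>\<^sub>M \<beta>)"
      have "g (fst w) \<in> A" using g NB_space(1)[OF w] by (simp add: step_fun_def)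
      from A_norm_powr(2)[OF this p NB_space(2)[OF w]]
      show "hat_step ?g w = complex_of_real (cmod (hat_step g w) powr p)" unfolding hat_step_def .
    qed
    then show ?thesis by (simp add: integral_complex_of_real)
  qed
  ultimately have "(\<lambda>n. complex_of_real (LINT z|N. cmod (osc_step n g z) powr p))
      \<longlonglongrightarrow> of_real (LINT w|(N \<Otimes>\<^sub>M \<beta>). cmod (hat_step g w) powr p)"
    using integral_osc_step_tendsto[OF step_fun_norm_powr[OF g p]] by simp
  then show ?thesis by (simp only: tendsto_of_real_iff)
qed

text \<open>Agreement is required only on the space of the product measure: elsewhere
  \<open>snd w\<close> need not be a character, hence need not be linear, and closure under sums
  would fail.\<close>

definition step_hats :: "(((real^'n) \<times> 'w) \<times> ((real^'n \<Rightarrow> complex) \<Rightarrow> complex) \<Rightarrow> complex) set" where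
  "step_hats = {f. \<exists>g. step_fun g \<and> (\<forall>w\<in>space (N \<Otimes>\<^sub>M \<beta>). f w = hat_step g w)}"

lemma step_fun_piece:
  assumes "B \<in> sets N" "emeasure N B < \<infinity>" "c \<in> A"
  shows "step_fun (\<lambda>z. if z \<in> B then c else (\<lambda>_. 0))"
  unfolding step_fun_def
proof (intro conjI ballI)
  show "simple_function N (\<lambda>z. if z \<in> B then c else (\<lambda>_. 0))"
    using assms(1) by (intro simple_function_If simple_function_const) simp_all
  show "(if z \<in> B then c else (\<lambda>_. 0)) \<in> A" for z using assms(3) A_const by simp
  have "emeasure N {z \<in> space N. (if z \<in> B then c else (\<lambda>_. 0)) \<noteq> (\<lambda>_. 0)} \<le> emeasure N B"
    using assms(1) by (intro emeasure_mono) (auto split: if_splits)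
  then show "emeasure N {z \<in> space N. (if z \<in> B then c else (\<lambda>_. 0)) \<noteq> (\<lambda>_. 0)} < \<infinity>"
    using assms(2) by (rule le_less_trans)
qed

lemma lin_closed_step_hats: "lin_closed step_hats"
  unfolding lin_closed_def
proof (intro conjI ballI allI)
  have "step_fun (\<lambda>z. if z \<in> {} then (\<lambda>_. 0) else (\<lambda>_. 0))"
    by (rule step_fun_piece) (simp_all add: A_const)
  then have "step_fun (\<lambda>z _. 0)" by simp
  then show "(\<lambda>_. 0) \<in> step_hats"
    unfolding step_hats_def
    by (intro CollectI exI[of _ "\<lambda>z _. 0"]) (simp add: hat_step_def spec_const[OF NB_space(2)])
next
  fix f f' assume f: "f \<in> step_hats" and f': "f' \<in> step_hats"
  from f obtain g where g: "step_fun g" "\<forall>w\<in>space (N \<Otimes>\<^sub>M \<beta>). f w = hat_step g w"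
    unfolding step_hats_def mem_Collect_eq by (elim exE conjE)
  from f' obtain g' where g': "step_fun g'" "\<forall>w\<in>space (N \<Otimes>\<^sub>M \<beta>). f' w = hat_step g' w"
    unfolding step_hats_def mem_Collect_eq by (elim exE conjE)
  have s: "step_fun (\<lambda>z y. g z y + g' z y)"
    using step_fun_combine[OF g(1) g'(1), of "\<lambda>c d y. c y + d y"] by (simp add: A_add)
  show "(\<lambda>w. f w + f' w) \<in> step_hats"
    unfolding step_hats_def
  proof (intro CollectI exI[of _ "\<lambda>z y. g z y + g' z y"] conjI ballI s)
    fix w assume w: "w \<in> space (N \<Otimes>\<^sub>M \<beta>)"
    have "g (fst w) \<in> A" "g' (fst w) \<in> A" using g(1) g'(1) NB_space(1)[OF w] by (simp_all add: step_fun_def)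
    from spec_add[OF NB_space(2)[OF w] this]
    show "f w + f' w = hat_step (\<lambda>z y. g z y + g' z y) w"
      using bspec[OF g(2) w] bspec[OF g'(2) w] by (simp add: hat_step_def)
  qed
next
  fix c f assume f: "f \<in> step_hats"
  from f obtain g where g: "step_fun g" "\<forall>w\<in>space (N \<Otimes>\<^sub>M \<beta>). f w = hat_step g w"
    unfolding step_hats_def mem_Collect_eq by (elim exE conjE)
  have s: "step_fun (\<lambda>z y. c * g z y)"
    using step_fun_combine[OF g(1) g(1), of "\<lambda>d _ y. c * d y"] by (simp add: A_scale)
  show "(\<lambda>w. c * f w) \<in> step_hats"
    unfolding step_hats_def
  proof (intro CollectI exI[of _ "\<lambda>z y. c * g z y"] conjI ballI s)
    fix w assume w: "w \<in> space (N \<Otimes>\<^sub>M \<beta>)"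
    have "g (fst w) \<in> A" using g(1) NB_space(1)[OF w] by (simp add: step_fun_def)
    from spec_scale[OF NB_space(2)[OF w] this]
    show "c * f w = hat_step (\<lambda>z y. c * g z y) w"
      using bspec[OF g(2) w] by (simp add: hat_step_def)
  qed
qed

lemma Lp_in_step_closure:
  assumes p: "1 \<le> p" and V: "Lp (N \<Otimes>\<^sub>M \<beta>) p V"
  shows "V \<in> Lp_closure (N \<Otimes>\<^sub>M \<beta>) p step_hats"
proof (rule Lp_in_closure_pair[OF N.sigma_finite_measure_axioms \<beta>.finite_measure_axioms _ lin_closed_step_hats _ _ _ V,
      where ?D1.0="{indicator B |B. B \<in> sets N \<and> emeasure N B < \<infinity>}" and ?D2.0="{\<lambda>s. s u |u. u \<in> A}"])
  show "0 < p" using p by simp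
  show "indicator B \<in> Lp_closure N p {indicator B |B. B \<in> sets N \<and> emeasure N B < \<infinity>}"
    if B: "B \<in> sets N" "emeasure N B < \<infinity>" for B
  proof (rule Lp_closure_base)
    show "indicator B \<in> {indicator B |B. B \<in> sets N \<and> emeasure N B < \<infinity>}" using B by blast
    show "Lp N p (indicator B)" using B p by (intro Lp_indicator) simp_all
  qed
  show "indicator C \<in> Lp_closure \<beta> p {\<lambda>s. s u |u. u \<in> A}" if "C \<in> sets \<beta>" for C
    by (rule indicator_in_hat_closure[OF that p])
next
  fix d1 :: "(real^'n) \<times> 'w \<Rightarrow> complex" and d2 :: "((real^'n \<Rightarrow> complex) \<Rightarrow> complex) \<Rightarrow> complex"
  assume "d1 \<in> {indicator B |B. B \<in> sets N \<and> emeasure N B < \<infinity>}" and d2: "d2 \<in> {\<lambda>s. s u |u. u \<in> A}"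
  then obtain B where B: "d1 = indicator B" "B \<in> sets N" "emeasure N B < \<infinity>" by blast
  from d2 obtain c where c: "d2 = (\<lambda>s. s c)" "c \<in> A"
    unfolding mem_Collect_eq by (elim exE conjE)
  show "(\<lambda>(z, s). d1 z * d2 s) \<in> step_hats"
    unfolding step_hats_def
  proof (intro CollectI exI[of _ "\<lambda>z. if z \<in> B then c else (\<lambda>_. 0)"] conjI ballI step_fun_piece[OF B(2,3) c(2)])
    fix w assume w: "w \<in> space (N \<Otimes>\<^sub>M \<beta>)"
    show "(case w of (z, s) \<Rightarrow> d1 z * d2 s) = hat_step (\<lambda>z. if z \<in> B then c else (\<lambda>_. 0)) w"
      by (simp add: B(1) c(1) hat_step_def split_beta spec_const[OF NB_space(2)[OF w]])
  qed
qed

end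

section \<open>The product theorem\<close>

text \<open>The convexity inequality is integrated, and the modular of the midpoint w is bounded
  below by p Re (\<integral> w h) - (p / q) \<integral> |h|^q, which is Young's inequality. The
  right-hand side then contains only modulars and pairings, whose limits along step functions are
  known.\<close>

lemma norm_diff_powr_le:
  assumes pq: "1 < p" "1 < q" "1 / p + 1 / q = 1" and v: "Lp N p v" and g: "Lp N p g" and h: "Lp N q h"
    and "0 \<le> C" and C: "\<And>a b. cmod (a - b) powr p \<le> \<eta> * (cmod a powr p + cmod b powr p)
    + C * ((cmod a powr p + cmod b powr p) / 2 - cmod ((a + b) / 2) powr p)"
  shows "(LINT z|N. cmod (v z - g z) powr p) \<le> \<eta> * ((LINT z|N. cmod (v z) powr p) + (LINT z|N. cmod (g z) powr p))
    + C * (((LINT z|N. cmod (v z) powr p) + (LINT z|N. cmod (g z) powr p)) / 2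
      - p * Re (((LINT z|N. v z * h z) + (LINT z|N. g z * h z)) / 2) + p / q * (LINT z|N. cmod (h z) powr q))"
proof -
  let ?w = "\<lambda>z. (v z + g z) / 2"
  have w: "Lp N p ?w"
    using Lp_cmult[OF Lp_add[OF v g], of "1 / 2"] pq by simp
  note iv = LpD(2)[OF v] and ig = LpD(2)[OF g] and ih = LpD(2)[OF h] and iw = LpD(2)[OF w]
  have ivg: "integrable N (\<lambda>z. cmod (v z - g z) powr p)" using pq by (intro LpD(2) Lp_diff v g) simp
  note ivh = Lp_mult_integrable[OF pq v h] and igh = Lp_mult_integrable[OF pq g h] and iwh = Lp_mult_integrable[OF pq w h]
  have "(LINT z|N. cmod (v z - g z) powr p) \<le> (LINT z|N. \<eta> * (cmod (v z) powr p + cmod (g z) powr p)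
      + C * ((cmod (v z) powr p + cmod (g z) powr p) / 2 - cmod (?w z) powr p))"
    using iv ig iw by (intro integral_mono ivg C) (auto intro!: Bochner_Integration.integrable_add Bochner_Integration.integrable_diff)
  also have "\<dots> = \<eta> * ((LINT z|N. cmod (v z) powr p) + (LINT z|N. cmod (g z) powr p))
      + C * (((LINT z|N. cmod (v z) powr p) + (LINT z|N. cmod (g z) powr p)) / 2 - (LINT z|N. cmod (?w z) powr p))"
    using iv ig iw by simp
  finally have main: "(LINT z|N. cmod (v z - g z) powr p) \<le> \<eta> * ((LINT z|N. cmod (v z) powr p) + (LINT z|N. cmod (g z) powr p))
      + C * (((LINT z|N. cmod (v z) powr p) + (LINT z|N. cmod (g z) powr p)) / 2 - (LINT z|N. cmod (?w z) powr p))" .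
  have low: "(LINT z|N. cmod (?w z) powr p) \<ge> p * Re (LINT z|N. ?w z * h z) - p / q * (LINT z|N. cmod (h z) powr q)"
  proof -
    have "p * Re (LINT z|N. ?w z * h z) = (LINT z|N. p * Re (?w z * h z))"
      by (simp only: integral_mult_right_zero integral_Re[OF iwh])
    also have "\<dots> \<le> (LINT z|N. cmod (?w z) powr p + p / q * cmod (h z) powr q)"
    proof (rule integral_mono)
      show "integrable N (\<lambda>z. p * Re (?w z * h z))" using iwh by (intro integrable_mult_right integrable_Re)
      show "integrable N (\<lambda>z. cmod (?w z) powr p + p / q * cmod (h z) powr q)" using iw ih by auto
      fix z
      have "Re (?w z * h z) \<le> cmod (?w z) * cmod (h z)"
        using complex_Re_le_cmod[of "?w z * h z"] by (simp add: norm_mult)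
      also have "\<dots> \<le> cmod (?w z) powr p / p + cmod (h z) powr q / q"
        by (rule Youngs_inequality[OF pq]) auto
      finally have "p * Re (?w z * h z) \<le> p * (cmod (?w z) powr p / p + cmod (h z) powr q / q)"
        using pq by (intro mult_left_mono) auto
      also have "\<dots> = cmod (?w z) powr p + p / q * cmod (h z) powr q"
        using pq by (simp add: distrib_left)
      finally show "p * Re (?w z * h z) \<le> cmod (?w z) powr p + p / q * cmod (h z) powr q" .
    qed
    also have "\<dots> = (LINT z|N. cmod (?w z) powr p) + p / q * (LINT z|N. cmod (h z) powr q)"
      using iw ih by simp
    finally show ?thesis by simp
  qed
  have wh: "(LINT z|N. ?w z * h z) = ((LINT z|N. v z * h z) + (LINT z|N. g z * h z)) / 2"
  proof -
    have "(LINT z|N. ?w z * h z) = (LINT z|N. (v z * h z + g z * h z) / 2)"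
      by (intro Bochner_Integration.integral_cong) (auto simp: algebra_simps)
    also have "\<dots> = (LINT z|N. v z * h z + g z * h z) / 2" by (rule integral_divide_zero)
    also have "(LINT z|N. v z * h z + g z * h z) = (LINT z|N. v z * h z) + (LINT z|N. g z * h z)"
      by (rule Bochner_Integration.integral_add[OF ivh igh])
    finally show ?thesis .
  qed
  have "C * (((LINT z|N. cmod (v z) powr p) + (LINT z|N. cmod (g z) powr p)) / 2 - (LINT z|N. cmod (?w z) powr p))
    \<le> C * (((LINT z|N. cmod (v z) powr p) + (LINT z|N. cmod (g z) powr p)) / 2
      - p * Re (((LINT z|N. v z * h z) + (LINT z|N. g z * h z)) / 2) + p / q * (LINT z|N. cmod (h z) powr q))"
    using low[unfolded wh] \<open>0 \<le> C\<close> by (intro mult_left_mono) linarith+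
  with main show ?thesis by linarith
qed

context oscillation
begin

lemma strong_approximation:
  assumes pq: "1 < p" "1 < q" "1 / p + 1 / q = 1" and v: "converges_against_tests p v V"
    and norms: "(\<lambda>n. LINT z|N. cmod (v n z) powr p) \<longlonglongrightarrow> (LINT w|(N \<Otimes>\<^sub>M \<beta>). cmod (V w) powr p)"
    and "0 < \<epsilon>"
  shows "\<exists>g. step_fun g \<and> (\<forall>\<^sub>F n in sequentially. (LINT z|N. cmod (v n z - osc_step n g z) powr p) \<le> \<epsilon>) \<and>
    (LINT w|(N \<Otimes>\<^sub>M \<beta>). cmod (V w - hat_step g w) powr p) \<le> \<epsilon>"
proof -
  let ?P = "N \<Otimes>\<^sub>M \<beta>"
  define m where "m = (LINT w|?P. cmod (V w) powr p)"
  have m0: "0 \<le> m" by (simp add: m_def)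
  have qp: "1 / q + 1 / p = 1" and p0: "0 < p" "0 < q" using pq by simp_all
  note Lv = converges_against_testsD(1)[OF v] and LV = converges_against_testsD(3)[OF v]
  \<comment> \<open>Eventually the modulars of v n and of the oscillating g are below m + 1 and m +
    2, the latter because g' has modular below m + 1. Their sum is below 2 m + 3, and \<eta> times
    this is \<epsilon>/4.\<close>
  define \<eta> where "\<eta> = \<epsilon> / (4 * (2 * m + 3))"
  have "0 < \<eta>" using \<open>0 < \<epsilon>\<close> m0 by (simp add: \<eta>_def)
  obtain C where C: "0 \<le> C" "\<And>a b. cmod (a - b) powr p \<le> \<eta> * (cmod a powr p + cmod b powr p)
    + C * ((cmod a powr p + cmod b powr p) / 2 - cmod ((a + b) / 2) powr p)"
    by (rule uniform_convexity_pointwise[OF pq(1) \<open>0 < \<eta>\<close>]) (rule that; blast)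
  \<comment> \<open>\<kappa> has two duties: to bound the distance from V by \<epsilon>, and to
    bound the convexity defect after multiplication by C, which is known only now.\<close>
  define \<kappa> where "\<kappa> = min \<epsilon> (\<epsilon> / (4 * (C + 1)))"
  have \<kappa>: "0 < \<kappa>" "\<kappa> \<le> \<epsilon>" "C * \<kappa> \<le> \<epsilon> / 4"
  proof -
    show "0 < \<kappa>" "\<kappa> \<le> \<epsilon>" using \<open>0 < \<epsilon>\<close> C(1) by (auto simp: \<kappa>_def)
    have "C * \<kappa> \<le> C * (\<epsilon> / (4 * (C + 1)))" using C(1) by (intro mult_left_mono) (auto simp: \<kappa>_def)
    also have "\<dots> \<le> \<epsilon> / 4" using C(1) \<open>0 < \<epsilon>\<close> by (simp add: field_simps)
    finally show "C * \<kappa> \<le> \<epsilon> / 4" .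
  qed
  have dense: "{H. Lp ?P q H} \<subseteq> Lp_closure ?P q step_hats"
    using pq by (auto intro!: Lp_in_step_closure)
  have "V \<in> Lp_closure ?P p step_hats" using pq LV by (intro Lp_in_step_closure) auto
  from lower_semicontinuity_witness[OF pq this dense \<kappa>(1)]
  obtain g' h' where g': "g' \<in> step_hats" and h': "h' \<in> step_hats"
    and 1: "(LINT w|?P. cmod (V w - g' w) powr p) < \<kappa>"
    and 2: "(LINT w|?P. cmod (g' w) powr p) < (LINT w|?P. cmod (V w) powr p) + 1"
    and 3: "((LINT w|?P. cmod (V w) powr p) + (LINT w|?P. cmod (g' w) powr p)) / 2
      - p * Re (((LINT w|?P. V w * h' w) + (LINT w|?P. g' w * h' w)) / 2) + p / q * (LINT w|?P. cmod (h' w) powr q) < \<kappa>"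
    by (elim bexE conjE)
  from g' obtain g where g: "step_fun g" and gw: "\<forall>w\<in>space ?P. g' w = hat_step g w"
    unfolding step_hats_def mem_Collect_eq by (elim exE conjE)
  from h' obtain h where h: "step_fun h" and hw: "\<forall>w\<in>space ?P. h' w = hat_step h w"
    unfolding step_hats_def mem_Collect_eq by (elim exE conjE)
  have e1: "(LINT w|?P. cmod (V w - g' w) powr p) = (LINT w|?P. cmod (V w - hat_step g w) powr p)"
    and e2: "(LINT w|?P. cmod (g' w) powr p) = (LINT w|?P. cmod (hat_step g w) powr p)"
    and e3: "(LINT w|?P. V w * h' w) = (LINT w|?P. V w * hat_step h w)"
    and e4: "(LINT w|?P. g' w * h' w) = (LINT w|?P. hat_step g w * hat_step h w)"
    and e5: "(LINT w|?P. cmod (h' w) powr q) = (LINT w|?P. cmod (hat_step h w) powr q)"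
    by (rule Bochner_Integration.integral_cong[OF refl]; simp only: bspec[OF gw] bspec[OF hw])+
  note 1 = 1[unfolded e1] and 2 = 2[unfolded e2, folded m_def] and 3 = 3[unfolded e2 e3 e4 e5, folded m_def]
  define G where "G = (LINT w|?P. cmod (hat_step g w) powr p)"
  have lv: "(\<lambda>n. LINT z|N. cmod (v n z) powr p) \<longlonglongrightarrow> m" using norms by (simp add: m_def)
  have lg: "(\<lambda>n. LINT z|N. cmod (osc_step n g z) powr p) \<longlonglongrightarrow> G"
    unfolding G_def by (rule integral_norm_powr_tendsto[OF g p0(1)])
  have lh: "(\<lambda>n. LINT z|N. cmod (osc_step n h z) powr q) \<longlonglongrightarrow> (LINT w|?P. cmod (hat_step h w) powr q)"
    by (rule integral_norm_powr_tendsto[OF h p0(2)])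
  have lvh: "(\<lambda>n. LINT z|N. v n z * osc_step n h z) \<longlonglongrightarrow> (LINT w|?P. V w * hat_step h w)"
    by (rule tendsto_step_tests'[OF pq(2,1) qp v h])
  have lgh: "(\<lambda>n. LINT z|N. osc_step n g z * osc_step n h z) \<longlonglongrightarrow> (LINT w|?P. hat_step g w * hat_step h w)"
  proof -
    have "(LINT w|?P. hat_step g w * hat_step h w) = (LINT w|?P. hat_step (\<lambda>z y. g z y * h z y) w)"
      by (rule Bochner_Integration.integral_cong[OF refl]) (simp only: hat_step_mult[OF g h])
    moreover have "osc_step n g z * osc_step n h z = osc_step n (\<lambda>z y. g z y * h z y) z" for n z
      by (simp add: osc_step_def sample_def)
    ultimately show ?thesis using integral_osc_step_tendsto[OF step_fun_mult[OF g h]] by simp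
  qed
  \<comment> \<open>The defect term of \<open>norm_diff_powr_le\<close> for v n. Its limit is the
    expression that the witnesses g and h keep below \<kappa>.\<close>
  define J where "J n = ((LINT z|N. cmod (v n z) powr p) + (LINT z|N. cmod (osc_step n g z) powr p)) / 2
      - p * Re (((LINT z|N. v n z * osc_step n h z) + (LINT z|N. osc_step n g z * osc_step n h z)) / 2)
      + p / q * (LINT z|N. cmod (osc_step n h z) powr q)" for n
  have lJ: "J \<longlonglongrightarrow> (m + G) / 2
      - p * Re (((LINT w|?P. V w * hat_step h w) + (LINT w|?P. hat_step g w * hat_step h w)) / 2)
      + p / q * (LINT w|?P. cmod (hat_step h w) powr q)"
    unfolding J_def by (intro tendsto_intros lv lg lh lvh lgh) simp_all
  have ev1: "\<forall>\<^sub>F n in sequentially. J n < \<kappa>"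
    by (rule order_tendstoD(2)[OF lJ]) (rule 3[folded G_def])
  have ev2: "\<forall>\<^sub>F n in sequentially. (LINT z|N. cmod (v n z) powr p) < m + 1"
    by (rule order_tendstoD(2)[OF lv]) simp
  have ev3: "\<forall>\<^sub>F n in sequentially. (LINT z|N. cmod (osc_step n g z) powr p) < m + 2"
    by (rule order_tendstoD(2)[OF lg]) (use 2 in \<open>simp add: G_def\<close>)
  have "\<forall>\<^sub>F n in sequentially. (LINT z|N. cmod (v n z - osc_step n g z) powr p) \<le> \<epsilon>"
    using ev1 ev2 ev3
  proof eventually_elim
    case (elim n)
    have "(LINT z|N. cmod (v n z - osc_step n g z) powr p)
      \<le> \<eta> * ((LINT z|N. cmod (v n z) powr p) + (LINT z|N. cmod (osc_step n g z) powr p)) + C * J n"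
      unfolding J_def by (rule norm_diff_powr_le[OF pq Lv Lp_osc_step[OF g p0(1)] Lp_osc_step[OF h p0(2)] C])
    also have "\<dots> \<le> \<eta> * (2 * m + 3) + C * \<kappa>"
    proof (rule add_mono)
      show "\<eta> * ((LINT z|N. cmod (v n z) powr p) + (LINT z|N. cmod (osc_step n g z) powr p)) \<le> \<eta> * (2 * m + 3)"
        using elim \<open>0 < \<eta>\<close> by (intro mult_left_mono) linarith+
      show "C * J n \<le> C * \<kappa>" using elim C(1) by (intro mult_left_mono) linarith+
    qed
    also have "\<eta> * (2 * m + 3) = \<epsilon> / 4" using m0 by (simp add: \<eta>_def field_simps)
    also have "\<epsilon> / 4 + C * \<kappa> \<le> \<epsilon>" using \<kappa>(3) \<open>0 < \<epsilon>\<close> by linarith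
    finally show ?case .
  qed
  moreover have "(LINT w|?P. cmod (V w - hat_step g w) powr p) \<le> \<epsilon>" using 1 \<kappa>(2) by linarith
  ultimately show ?thesis using g by blast
qed

text \<open>The integrand is regrouped as t v, where t is u times the oscillating test function.
  Since t is bounded in the exponent p' dual to p, replacing v by its step approximation costs
  little; what remains is u against a step function times a test function, paired in the exponents q
  and q'.\<close>

lemma product_tendsto:
  assumes pq: "1 < p" "1 < q" "1 / p + 1 / q \<le> 1"
    and u: "converges_against_tests q u U" and v: "converges_against_tests p v V"
    and norms: "(\<lambda>n. LINT z|N. cmod (v n z) powr p) \<longlonglongrightarrow> (LINT w|(N \<Otimes>\<^sub>M \<beta>). cmod (V w) powr p)"
    and \<Phi>: "\<Phi> \<in> borel_measurable N" "AE z in N. cmod (\<Phi> z) \<le> B"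
    and E: "E \<in> sets N" "emeasure N E < \<infinity>" "\<And>z. z \<in> space N \<Longrightarrow> z \<notin> E \<Longrightarrow> \<Phi> z = 0" and c: "c \<in> A"
  shows "integrable N (\<lambda>z. u n z * v n z * (\<Phi> (shift n z) * sample n c z))"
    and "integrable (N \<Otimes>\<^sub>M \<beta>) (\<lambda>w. U w * V w * (\<Phi> (fst w) * snd w c))"
    and "(\<lambda>n. LINT z|N. u n z * v n z * (\<Phi> (shift n z) * sample n c z))
      \<longlonglongrightarrow> (LINT w|(N \<Otimes>\<^sub>M \<beta>). U w * V w * (\<Phi> (fst w) * snd w c))"
proof -
  let ?P = "N \<Otimes>\<^sub>M \<beta>"
  note Lu = converges_against_testsD(1)[OF u] and LU = converges_against_testsD(3)[OF u]
  note Lv = converges_against_testsD(1)[OF v] and LV = converges_against_testsD(3)[OF v]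
  define p' where "p' = p / (p - 1)"
  define q' where "q' = q / (q - 1)"
  \<comment> \<open>The assumption 1/p + 1/q \<le> 1 enters through p' \<le> q, which lets the
    exponent of t be lowered.\<close>
  have p': "1 < p'" "1 / p' + 1 / p = 1" "p' \<le> q"
  proof -
    show "1 < p'" "1 / p' + 1 / p = 1" using pq by (simp_all add: p'_def field_simps)
    have "1 / q \<le> 1 / p'" using pq(3) \<open>1 / p' + 1 / p = 1\<close> by linarith
    then show "p' \<le> q" using \<open>1 < p'\<close> pq by (simp add: field_simps)
  qed
  have q': "1 < q'" "1 / q' + 1 / q = 1" using pq by (simp_all add: q'_def field_simps)
  define B' where "B' = \<bar>B\<bar> * sup_norm c"
  have B': "0 \<le> B'" using sup_norm_nonneg[OF c] by (simp add: B'_def)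
  define t where "t n z = u n z * (\<Phi> (shift n z) * sample n c z)" for n z
  define t0 where "t0 w = U w * (\<Phi> (fst w) * snd w c)" for w
  have mt: "(\<lambda>z. \<Phi> (shift n z) * sample n c z) \<in> borel_measurable N" for n
    by (intro borel_measurable_times measurable_compose[OF shift_measurable \<Phi>(1)] sample_measurable[OF c])
  have bt: "AE z in N. cmod (\<Phi> (shift n z) * sample n c z) \<le> B'" for n
    using AE_shift[OF \<Phi>(2), of n]
  proof eventually_elim
    case (elim z)
    then have "cmod (\<Phi> (shift n z)) \<le> \<bar>B\<bar>" by linarith
    then show ?case unfolding norm_mult B'_def by (intro mult_mono sample_bounded[OF c]) auto
  qed
  have Lt: "Lp N q (t n)" for n
    unfolding t_def using pq by (intro Lp_mult_bounded[OF Lu mt bt]) simp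
  have mt0: "(\<lambda>w. \<Phi> (fst w) * snd w c) \<in> borel_measurable ?P"
    by (intro borel_measurable_times measurable_compose[OF measurable_fst \<Phi>(1)]
        measurable_compose[OF measurable_snd hat_measurable[OF c]])
  have bt0: "AE w in ?P. cmod (\<Phi> (fst w) * snd w c) \<le> B'"
  proof -
    have "AE w in ?P. cmod (\<Phi> (fst w)) \<le> B"
    proof (rule NB.AE_pair_measure)
      have [measurable]: "(\<lambda>w. \<Phi> (fst w)) \<in> borel_measurable ?P"
        by (rule measurable_compose[OF measurable_fst \<Phi>(1)])
      show "{w \<in> space ?P. cmod (\<Phi> (fst w)) \<le> B} \<in> sets ?P" by measurable
      show "AE z in N. AE s in \<beta>. cmod (\<Phi> (fst (z, s))) \<le> B"
        using \<Phi>(2) by eventually_elim simp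
    qed
    then show ?thesis
      using AE_space
    proof eventually_elim
      case (elim w)
      then have "cmod (\<Phi> (fst w)) \<le> \<bar>B\<bar>" by linarith
      moreover have "cmod (snd w c) \<le> sup_norm c" by (rule spec_contractive[OF NB_space(2)[OF elim(2)] c])
      ultimately show ?case unfolding norm_mult B'_def by (intro mult_mono) auto
    qed
  qed
  have Lt0: "Lp ?P q t0"
    unfolding t0_def using pq by (intro Lp_mult_bounded[OF LU mt0 bt0]) simp
  obtain K where K: "\<And>n. (LINT z|N. cmod (u n z) powr q) \<le> K"
    using converges_against_testsD(2)[OF u] by blast
  have It: "(LINT z|N. cmod (t n z) powr q) \<le> B' powr q * K" for n
  proof -
    have "(LINT z|N. cmod (t n z) powr q) \<le> (LINT z|N. B' powr q * cmod (u n z) powr q)"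
    proof (rule integral_mono_AE[OF LpD(2)[OF Lt]])
      show "integrable N (\<lambda>z. B' powr q * cmod (u n z) powr q)" using LpD(2)[OF Lu] by simp
      show "AE z in N. cmod (t n z) powr q \<le> B' powr q * cmod (u n z) powr q"
        using bt[of n]
      proof eventually_elim
        case (elim z)
        have "cmod (t n z) \<le> B' * cmod (u n z)"
          unfolding t_def norm_mult[of "u n z"] using elim by (subst mult.commute) (rule mult_right_mono, auto)
        then have "cmod (t n z) powr q \<le> (B' * cmod (u n z)) powr q" using pq by (intro powr_mono2) auto
        then show ?case using B' by (simp add: powr_mult)
      qed
    qed
    also have "\<dots> = B' powr q * (LINT z|N. cmod (u n z) powr q)" by simp
    also have "\<dots> \<le> B' powr q * K" using K by (intro mult_left_mono) auto
    finally show ?thesis .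
  qed
  \<comment> \<open>t n vanishes outside the preimage of E under \<open>shift n\<close>. All these
    preimages have the measure of E, so the bound in the lower exponent is uniform in n.\<close>
  have shE: "shift n -` E \<inter> space N \<in> sets N" "emeasure N (shift n -` E \<inter> space N) = emeasure N E" for n
    using measurable_sets[OF shift_measurable E(1)] emeasure_distr[OF shift_measurable E(1), of n]
    by (simp_all add: shift_distr)
  have lt: "Lp N p' (t n)" "(LINT z|N. cmod (t n z) powr p') \<le> measure N E + B' powr q * K" for n
  proof -
    have out: "t n z = 0" if "z \<in> space N" "z \<notin> shift n -` E \<inter> space N" for z
      using E(3)[OF shift_space[OF that(1)]] that by (simp add: t_def)
    have fin: "emeasure N (shift n -` E \<inter> space N) < \<infinity>" using shE(2) E(2) by simp
    have "0 < p'" using p'(1) by simp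
    note le = Lp_lower_exponent[OF Lt \<open>0 < p'\<close> p'(3) shE(1) fin out]
    show "Lp N p' (t n)" by (rule le(1))
    have "(LINT z|N. cmod (t n z) powr p') \<le> measure N (shift n -` E \<inter> space N) + (LINT z|N. cmod (t n z) powr q)"
      by (rule le(2))
    also have "measure N (shift n -` E \<inter> space N) = measure N E" using shE(2) by (simp add: measure_def)
    finally show "(LINT z|N. cmod (t n z) powr p') \<le> measure N E + B' powr q * K" using It[of n] by linarith
  qed
  have lt0: "Lp ?P p' t0"
  proof (rule Lp_lower_exponent(1)[OF Lt0 _ p'(3)])
    show "0 < p'" using p'(1) by simp
    show "E \<times> space \<beta> \<in> sets ?P" using E(1) by simp
    show "emeasure ?P (E \<times> space \<beta>) < \<infinity>"
      using E(1,2) by (simp add: \<beta>.emeasure_pair_measure_Times \<beta>.emeasure_space_1)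
    show "t0 w = 0" if w: "w \<in> space ?P" "w \<notin> E \<times> space \<beta>" for w
    proof -
      have "fst w \<notin> E" using w NB_space(2)[OF w(1)] space_\<beta> by (simp add: mem_Times_iff)
      then show ?thesis using E(3)[OF NB_space(1)[OF w(1)]] by (simp add: t0_def)
    qed
  qed
  have X: "u n z * v n z * (\<Phi> (shift n z) * sample n c z) = t n z * v n z" for n z
    by (simp add: t_def mult_ac)
  have X0: "U w * V w * (\<Phi> (fst w) * snd w c) = t0 w * V w" for w
    by (simp add: t0_def mult_ac)
  show "integrable N (\<lambda>z. u n z * v n z * (\<Phi> (shift n z) * sample n c z))"
    unfolding X by (rule Lp_mult_integrable[OF p'(1) pq(1) p'(2) lt(1) Lv])
  show "integrable ?P (\<lambda>w. U w * V w * (\<Phi> (fst w) * snd w c))"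
    unfolding X0 by (rule Lp_mult_integrable[OF p'(1) pq(1) p'(2) lt0 LV])
  show "(\<lambda>n. LINT z|N. u n z * v n z * (\<Phi> (shift n z) * sample n c z))
      \<longlonglongrightarrow> (LINT w|?P. U w * V w * (\<Phi> (fst w) * snd w c))"
    unfolding X X0
  proof (rule tendsto_approx)
    fix \<epsilon> :: real assume "0 < \<epsilon>"
    define K' where "K' = max (measure N E + B' powr q * K) (LINT w|?P. cmod (t0 w) powr p')"
    have K': "0 \<le> K'" "\<And>n. (LINT z|N. cmod (t n z) powr p') \<le> K'" "(LINT w|?P. cmod (t0 w) powr p') \<le> K'"
      using lt(2) by (auto simp: K'_def le_max_iff_disj)
    define \<eta> where "\<eta> = \<epsilon> / (2 * (K' + 1))"
    have "0 < \<eta>" using \<open>0 < \<epsilon>\<close> K'(1) by (simp add: \<eta>_def)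
    have \<eta>K: "\<eta> * K' \<le> \<epsilon> / 2" using \<open>0 < \<epsilon>\<close> K'(1) by (simp add: \<eta>_def field_simps)
    obtain C where C0: "0 \<le> C" and C: "\<And>x y. 0 \<le> x \<Longrightarrow> 0 \<le> y \<Longrightarrow> x * y \<le> \<eta> * x powr p' + C * y powr p"
      by (rule young_eps[OF p'(1) pq(1) p'(2) \<open>0 < \<eta>\<close>]) (rule that; blast)
    define \<delta> where "\<delta> = \<epsilon> / (2 * (C + 1))"
    have "0 < \<delta>" using \<open>0 < \<epsilon>\<close> C0 by (simp add: \<delta>_def)
    have C\<delta>: "C * \<delta> \<le> \<epsilon> / 2" using \<open>0 < \<epsilon>\<close> C0 by (simp add: \<delta>_def field_simps)
    have small: "\<eta> * x + C * y \<le> \<epsilon>" if "x \<le> K'" "y \<le> \<delta>" for x y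
      using mult_left_mono[OF that(1), of \<eta>] mult_left_mono[OF that(2) C0] \<open>0 < \<eta>\<close> \<eta>K C\<delta> by linarith
    have pp': "1 / p + 1 / p' = 1" using p'(2) by simp
    from strong_approximation[OF pq(1) p'(1) pp' v norms \<open>0 < \<delta>\<close>]
    obtain g where g: "step_fun g"
      and g1: "\<forall>\<^sub>F n in sequentially. (LINT z|N. cmod (v n z - osc_step n g z) powr p) \<le> \<delta>"
      and g2: "(LINT w|?P. cmod (V w - hat_step g w) powr p) \<le> \<delta>"
      by (elim exE conjE)
    have p0: "0 < p" "0 \<le> p" using pq by simp_all
    note Lg = Lp_osc_step[OF g p0(1)] and Lh = Lp_hat_step[OF g p0(1)]
    note Ld = Lp_diff[OF Lv Lg p0(2)] and Ld0 = Lp_diff[OF LV Lh p0(2)]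
    note hoelder = Lp_mult_integrable[OF p'(1) pq(1) p'(2)]
    have "(\<lambda>n. LINT z|N. u n z * (osc_step n g z * (\<Phi> (shift n z) * sample n c z)))
        \<longlonglongrightarrow> (LINT w|?P. U w * (hat_step g w * (\<Phi> (fst w) * snd w c)))"
      by (rule tendsto_step_tests[OF q'(1) pq(2) q'(2) u g \<Phi> c])
    then have lim: "(\<lambda>n. LINT z|N. t n z * osc_step n g z) \<longlonglongrightarrow> (LINT w|?P. t0 w * hat_step g w)"
      by (simp add: t_def t0_def mult_ac)
    have "\<forall>\<^sub>F n in sequentially. norm ((LINT z|N. t n z * v n z) - (LINT z|N. t n z * osc_step n g z)) \<le> \<epsilon>"
      using g1
    proof eventually_elim
      case (elim n)
      have "(LINT z|N. t n z * v n z) - (LINT z|N. t n z * osc_step n g z) = (LINT z|N. t n z * (v n z - osc_step n g z))"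
        unfolding right_diff_distrib
        by (rule Bochner_Integration.integral_diff[symmetric]) (rule hoelder[OF lt(1) Lv], rule hoelder[OF lt(1) Lg])
      also have "cmod \<dots> \<le> \<eta> * (LINT z|N. cmod (t n z) powr p') + C * (LINT z|N. cmod (v n z - osc_step n g z) powr p)"
        by (rule norm_integral_mult_le[OF p'(1) pq(1) p'(2) lt(1) Ld C])
      also have "\<dots> \<le> \<epsilon>" by (rule small[OF K'(2) elim])
      finally show ?case .
    qed
    moreover have "norm ((LINT w|?P. t0 w * V w) - (LINT w|?P. t0 w * hat_step g w)) \<le> \<epsilon>"
    proof -
      have "(LINT w|?P. t0 w * V w) - (LINT w|?P. t0 w * hat_step g w) = (LINT w|?P. t0 w * (V w - hat_step g w))"
        unfolding right_diff_distrib
        by (rule Bochner_Integration.integral_diff[symmetric]) (rule hoelder[OF lt0 LV], rule hoelder[OF lt0 Lh])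
      also have "cmod \<dots> \<le> \<eta> * (LINT w|?P. cmod (t0 w) powr p') + C * (LINT w|?P. cmod (V w - hat_step g w) powr p)"
        by (rule norm_integral_mult_le[OF p'(1) pq(1) p'(2) lt0 Ld0 C])
      also have "\<dots> \<le> \<epsilon>" by (rule small[OF K'(3) g2])
      finally show ?thesis .
    qed
    ultimately show "\<exists>Y m. Y \<longlonglongrightarrow> m \<and> (\<forall>\<^sub>F n in sequentially. norm ((LINT z|N. t n z * v n z) - Y n) \<le> \<epsilon>) \<and>
        norm ((LINT w|?P. t0 w * V w) - m) \<le> \<epsilon>"
      using lim by (intro exI conjI)
  qed
qed

end

text \<open>Young's inequality with exponents q / r and p / r for the r-th powers of |f| and |g|;
  the factors r / q and r / p are below 1 and are dropped.\<close>

lemma Lp_mult: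
  assumes pq: "0 < p" "0 < q" "0 < r" "1 / r = 1 / p + 1 / q" and f: "Lp N q f" and g: "Lp N p g"
  shows "Lp N r (\<lambda>z. f z * g z)"
    and "(LINT z|N. cmod (f z * g z) powr r) \<le> (LINT z|N. cmod (f z) powr q) + (LINT z|N. cmod (g z) powr p)"
proof -
  note [measurable] = LpD(1)[OF f] LpD(1)[OF g]
  have sum1: "r / p + r / q = 1"
  proof -
    have "r / p + r / q = r * (1 / p + 1 / q)" by (simp add: distrib_left)
    also have "\<dots> = 1" unfolding pq(4)[symmetric] using pq(3) by simp
    finally show ?thesis .
  qed
  have "r / p > 0" "r / q > 0" using pq by simp_all
  then have "r / p < 1" "r / q < 1" using sum1 by linarith+
  then have gt: "1 < p / r" "1 < q / r" using pq by (simp_all add: field_simps)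
  have le: "cmod (f z * g z) powr r \<le> cmod (f z) powr q + cmod (g z) powr p" for z
  proof -
    have "cmod (f z * g z) powr r = cmod (f z) powr r * cmod (g z) powr r"
      by (simp add: norm_mult powr_mult)
    also have "\<dots> \<le> (cmod (f z) powr r) powr (q / r) / (q / r) + (cmod (g z) powr r) powr (p / r) / (p / r)"
      using gt sum1 by (intro Youngs_inequality) (auto simp: add.commute)
    also have "\<dots> = cmod (f z) powr q / (q / r) + cmod (g z) powr p / (p / r)"
      using pq by (simp add: powr_powr)
    also have "\<dots> \<le> cmod (f z) powr q + cmod (g z) powr p"
    proof (rule add_mono)
      show "cmod (f z) powr q / (q / r) \<le> cmod (f z) powr q"
        using divide_left_mono[of 1 "q / r" "cmod (f z) powr q"] gt by simp
      show "cmod (g z) powr p / (p / r) \<le> cmod (g z) powr p"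
        using divide_left_mono[of 1 "p / r" "cmod (g z) powr p"] gt by simp
    qed
    finally show ?thesis .
  qed
  have int: "integrable N (\<lambda>z. cmod (f z) powr q + cmod (g z) powr p)"
    using LpD(2)[OF f] LpD(2)[OF g] by simp
  have m: "(\<lambda>z. f z * g z) \<in> borel_measurable N" by measurable
  have i: "integrable N (\<lambda>z. cmod (f z * g z) powr r)"
  proof (rule Bochner_Integration.integrable_bound[OF int])
    show "(\<lambda>z. cmod (f z * g z) powr r) \<in> borel_measurable N" by measurable
    show "AE z in N. norm (cmod (f z * g z) powr r) \<le> norm (cmod (f z) powr q + cmod (g z) powr p)"
      using le by simp
  qed
  then show "Lp N r (\<lambda>z. f z * g z)" using m by (simp add: Lp_def)
  have "(LINT z|N. cmod (f z * g z) powr r) \<le> (LINT z|N. cmod (f z) powr q + cmod (g z) powr p)"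
    by (rule integral_mono[OF i int le])
  then show "(LINT z|N. cmod (f z * g z) powr r) \<le> (LINT z|N. cmod (f z) powr q) + (LINT z|N. cmod (g z) powr p)"
    using LpD(2)[OF f] LpD(2)[OF g] by simp
qed

lemma integral_eq_Lp_norm_powr:
  assumes "0 < p"
  shows "(LINT z|N. cmod (f z) powr p) = Lp_norm N p f powr p"
  using assms by (simp add: Lp_norm_def powr_powr)

lemma smooth_compact_support_bounded:
  assumes "smooth_compact_support Q \<phi>"
  obtains B where "\<And>x. cmod (\<phi> x) \<le> B"
proof -
  let ?K = "closure {x. \<phi> x \<noteq> 0}"
  have "compact ?K" using assms by (simp add: smooth_compact_support_def)
  then have "compact (\<phi> ` ?K)"
    using smooth_compact_support_continuous[OF assms] by (intro compact_continuous_image) (auto intro: continuous_on_subset)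
  then have "bounded (\<phi> ` ?K)" by (rule compact_imp_bounded)
  then obtain B where B: "0 < B" "\<And>z. z \<in> \<phi> ` ?K \<Longrightarrow> cmod z \<le> B"
    unfolding bounded_pos by blast
  have "cmod (\<phi> x) \<le> B" for x
  proof (cases "\<phi> x = 0")
    case False
    then have "x \<in> ?K" using closure_subset[of "{x. \<phi> x \<noteq> 0}"] by blast
    then show ?thesis by (intro B(2) imageI)
  qed (use B(1) in simp)
  then show thesis by (rule that)
qed

lemma stoch_smooth_Linf: "stoch_smooth M T \<psi> \<Longrightarrow> Linf M \<psi>"
  unfolding stoch_smooth_def by auto

section \<open>From bounded factors to test functions\<close>

context oscillation
begin

text \<open>Supplies what \<open>product_tendsto\<close> requires of \<Phi>. The bound holds only
  almost everywhere because \<psi> is merely in L^infinity. The set E is the support of \<phi> times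
  Omega, of finite measure since M is a probability.\<close>

lemma test_factor:
  assumes \<phi>: "smooth_compact_support Q \<phi>" and \<psi>: "stoch_smooth M T \<psi>"
  shows "(\<lambda>z. \<phi> (fst z) * \<psi> (snd z)) \<in> borel_measurable N"
    and "\<exists>B. AE z in N. cmod (\<phi> (fst z) * \<psi> (snd z)) \<le> B"
    and "\<exists>E\<in>sets N. emeasure N E < \<infinity> \<and> (\<forall>z\<in>space N. z \<notin> E \<longrightarrow> \<phi> (fst z) * \<psi> (snd z) = 0)"
proof -
  have m\<phi>: "\<phi> \<in> borel_measurable borel"
    by (rule borel_measurable_continuous_onI[OF smooth_compact_support_continuous[OF \<phi>]])
  from stoch_smooth_Linf[OF \<psi>] obtain C where m\<psi>: "\<psi> \<in> borel_measurable M" and C: "AE \<omega> in M. cmod (\<psi> \<omega>) \<le> C"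
    unfolding Linf_def by blast
  show m: "(\<lambda>z. \<phi> (fst z) * \<psi> (snd z)) \<in> borel_measurable N"
    by (intro borel_measurable_times measurable_compose[OF fst_N m\<phi>] measurable_compose[OF snd_N m\<psi>])
  obtain B where B: "\<And>x. cmod (\<phi> x) \<le> B"
    by (rule smooth_compact_support_bounded[OF \<phi>]) (rule that; blast)
  have "AE z in restrict_space lborel Q \<Otimes>\<^sub>M M. cmod (\<phi> (fst z) * \<psi> (snd z)) \<le> B * C"
  proof (rule QM.AE_pair_measure)
    have [measurable]: "(\<lambda>z. \<phi> (fst z) * \<psi> (snd z)) \<in> borel_measurable (restrict_space lborel Q \<Otimes>\<^sub>M M)"
      using m by (simp add: QOm_def)
    show "{z \<in> space (restrict_space lborel Q \<Otimes>\<^sub>M M). cmod (\<phi> (fst z) * \<psi> (snd z)) \<le> B * C} \<in> sets (restrict_space lborel Q \<Otimes>\<^sub>M M)"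
      by measurable
    show "AE x in restrict_space lborel Q. AE \<omega> in M. cmod (\<phi> (fst (x, \<omega>)) * \<psi> (snd (x, \<omega>))) \<le> B * C"
    proof (rule AE_I2)
      fix x
      show "AE \<omega> in M. cmod (\<phi> (fst (x, \<omega>)) * \<psi> (snd (x, \<omega>))) \<le> B * C"
        using C
      proof eventually_elim
        case (elim \<omega>)
        show ?case unfolding norm_mult fst_conv snd_conv
          using B[of x] elim by (intro mult_mono) (auto intro: order_trans[OF norm_ge_zero])
      qed
    qed
  qed
  then show "\<exists>B. AE z in N. cmod (\<phi> (fst z) * \<psi> (snd z)) \<le> B" unfolding QOm_def by blast
  let ?K = "closure {x. \<phi> x \<noteq> 0}"
  have K: "compact ?K" "?K \<subseteq> Q" using \<phi> by (simp_all add: smooth_compact_support_def)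
  have KQ: "?K \<in> sets (restrict_space lborel Q)"
    using K(2) by (simp add: sets_restrict_space_iff)
  have "emeasure (restrict_space lborel Q) ?K = emeasure lborel ?K"
    using K(2) by (intro emeasure_restrict_space) auto
  also have "\<dots> < \<infinity>" by (intro emeasure_bounded_finite compact_imp_bounded K)
  finally have "emeasure N (?K \<times> space M) < \<infinity>"
    unfolding QOm_def using KQ by (simp add: emeasure_pair_measure_Times emeasure_space_1)
  moreover have "?K \<times> space M \<in> sets N" unfolding QOm_def using KQ by simp
  moreover have "\<phi> (fst z) * \<psi> (snd z) = 0" if "z \<in> space N" "z \<notin> ?K \<times> space M" for z
  proof -
    have "fst z \<notin> ?K" using that by (simp add: space_N mem_Times_iff)
    then have "\<phi> (fst z) = 0" using closure_subset[of "{x. \<phi> x \<noteq> 0}"] by blast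
    then show ?thesis by simp
  qed
  ultimately show "\<exists>E\<in>sets N. emeasure N E < \<infinity> \<and> (\<forall>z\<in>space N. z \<notin> E \<longrightarrow> \<phi> (fst z) * \<psi> (snd z) = 0)"
    by (intro bexI[of _ "?K \<times> space M"]) simp_all
qed

lemma product_tendsto_test_fun:
  assumes pq: "1 < p" "1 < q" "1 / p + 1 / q \<le> 1"
    and u: "converges_against_tests q u U" and v: "converges_against_tests p v V"
    and norms: "(\<lambda>n. LINT z|N. cmod (v n z) powr p) \<longlonglongrightarrow> (LINT w|(N \<Otimes>\<^sub>M \<beta>). cmod (V w) powr p)"
    and f: "test_fun Q M T A f"
  shows "(\<lambda>n. LINT z|N. u n z * v n z * osc T (a n) (b n) f z)
    \<longlonglongrightarrow> (LINT w|(N \<Otimes>\<^sub>M \<beta>). U w * V w * snd w (f (fst (fst w)) (snd (fst w))))"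
proof -
  from f obtain m :: nat and \<phi> \<psi> c
    where mk: "\<forall>k<m. smooth_compact_support Q (\<phi> k) \<and> stoch_smooth M T (\<psi> k) \<and> c k \<in> A"
      and fe: "\<forall>x \<omega> y. f x \<omega> y = (\<Sum>k<m. \<phi> k x * \<psi> k \<omega> * c k y)"
    unfolding test_fun_def by (elim exE conjE)
  define \<Phi> where "\<Phi> k z = \<phi> k (fst z) * \<psi> k (snd z)" for k z
  have cA: "c k \<in> A" if "k < m" for k using mk that by simp
  have conv: "integrable N (\<lambda>z. u n z * v n z * (\<Phi> k (shift n z) * sample n (c k) z))"
      "integrable (N \<Otimes>\<^sub>M \<beta>) (\<lambda>w. U w * V w * (\<Phi> k (fst w) * snd w (c k)))"
      "(\<lambda>n. LINT z|N. u n z * v n z * (\<Phi> k (shift n z) * sample n (c k) z))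
        \<longlonglongrightarrow> (LINT w|(N \<Otimes>\<^sub>M \<beta>). U w * V w * (\<Phi> k (fst w) * snd w (c k)))" if "k < m" for k n
  proof -
    have \<phi>: "smooth_compact_support Q (\<phi> k)" and \<psi>: "stoch_smooth M T (\<psi> k)" using mk that by simp_all
    note tf = test_factor[OF \<phi> \<psi>, folded \<Phi>_def]
    from tf(2) obtain B where B: "AE z in N. cmod (\<Phi> k z) \<le> B" by blast
    from tf(3) obtain E where E: "E \<in> sets N" "emeasure N E < \<infinity>" "\<forall>z\<in>space N. z \<notin> E \<longrightarrow> \<Phi> k z = 0"
      by blast
    have out: "\<And>z. z \<in> space N \<Longrightarrow> z \<notin> E \<Longrightarrow> \<Phi> k z = 0" using E(3) by blast
    note pt = product_tendsto[OF pq u v norms tf(1) B E(1,2) out cA[OF that]]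
    show "integrable N (\<lambda>z. u n z * v n z * (\<Phi> k (shift n z) * sample n (c k) z))" by (rule pt(1))
    show "integrable (N \<Otimes>\<^sub>M \<beta>) (\<lambda>w. U w * V w * (\<Phi> k (fst w) * snd w (c k)))" by (rule pt(2))
    show "(\<lambda>n. LINT z|N. u n z * v n z * (\<Phi> k (shift n z) * sample n (c k) z))
        \<longlonglongrightarrow> (LINT w|(N \<Otimes>\<^sub>M \<beta>). U w * V w * (\<Phi> k (fst w) * snd w (c k)))" by (rule pt(3))
  qed
  have 1: "(LINT z|N. u n z * v n z * osc T (a n) (b n) f z)
      = (\<Sum>k<m. LINT z|N. u n z * v n z * (\<Phi> k (shift n z) * sample n (c k) z))" for n
  proof -
    have "osc T (a n) (b n) f z = (\<Sum>k<m. \<Phi> k (shift n z) * sample n (c k) z)" for z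
      by (simp add: osc_def fe \<Phi>_def shift_def sample_def)
    then have "(LINT z|N. u n z * v n z * osc T (a n) (b n) f z)
        = (LINT z|N. (\<Sum>k<m. u n z * v n z * (\<Phi> k (shift n z) * sample n (c k) z)))"
      by (simp add: sum_distrib_left)
    also have "\<dots> = (\<Sum>k<m. LINT z|N. u n z * v n z * (\<Phi> k (shift n z) * sample n (c k) z))"
      by (rule Bochner_Integration.integral_sum) (simp add: conv(1))
    finally show ?thesis .
  qed
  have 2: "(LINT w|(N \<Otimes>\<^sub>M \<beta>). U w * V w * snd w (f (fst (fst w)) (snd (fst w))))
      = (\<Sum>k<m. LINT w|(N \<Otimes>\<^sub>M \<beta>). U w * V w * (\<Phi> k (fst w) * snd w (c k)))"
  proof -
    have "(LINT w|(N \<Otimes>\<^sub>M \<beta>). U w * V w * snd w (f (fst (fst w)) (snd (fst w))))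
        = (LINT w|(N \<Otimes>\<^sub>M \<beta>). (\<Sum>k<m. U w * V w * (\<Phi> k (fst w) * snd w (c k))))"
    proof (rule Bochner_Integration.integral_cong[OF refl])
      fix w assume w: "w \<in> space (N \<Otimes>\<^sub>M \<beta>)"
      have "f (fst (fst w)) (snd (fst w)) = (\<lambda>y. \<Sum>k<m. \<Phi> k (fst w) * c k y)"
        by (rule ext) (simp add: fe \<Phi>_def)
      moreover have "snd w (\<lambda>y. \<Sum>k<m. \<Phi> k (fst w) * c k y) = (\<Sum>k<m. \<Phi> k (fst w) * snd w (c k))"
        using spec_sum[OF NB_space(2)[OF w] cA] by simp
      ultimately show "U w * V w * snd w (f (fst (fst w)) (snd (fst w))) = (\<Sum>k<m. U w * V w * (\<Phi> k (fst w) * snd w (c k)))"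
        by (simp add: sum_distrib_left)
    qed
    also have "\<dots> = (\<Sum>k<m. LINT w|(N \<Otimes>\<^sub>M \<beta>). U w * V w * (\<Phi> k (fst w) * snd w (c k)))"
      by (rule Bochner_Integration.integral_sum) (simp add: conv(2))
    finally show ?thesis .
  qed
  show ?thesis unfolding 1 2 by (intro tendsto_sum conv(3)) simp
qed

end

theorem theorem3p2:
  fixes Q :: "(real^'n) set" and M :: "'w measure" and T :: "real^'n \<Rightarrow> 'w \<Rightarrow> 'w"
    and A :: "(real^'n \<Rightarrow> complex) set" and \<beta> :: "((real^'n \<Rightarrow> complex) \<Rightarrow> complex) measure"
    and e :: "nat \<Rightarrow> real" and e1 e2 :: "real \<Rightarrow> real" and p q r :: real
    and u v :: "nat \<Rightarrow> (real^'n) \<times> 'w \<Rightarrow> complex"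
    and U0 V0 :: "((real^'n) \<times> 'w) \<times> ((real^'n \<Rightarrow> complex) \<Rightarrow> complex) \<Rightarrow> complex"
  assumes "open Q"
    and "dynamical_system M T"
    and "H_supralgebra A"
    and "gelfand_measure A \<beta>"
    and "fundamental_seq e"
    and "\<forall>t>0. e1 t > 0 \<and> e2 t > 0"
    and "(e1 \<longlongrightarrow> 0) (at_right 0)" and "(e2 \<longlongrightarrow> 0) (at_right 0)"
    and "((\<lambda>t. e2 t / e1 t) \<longlongrightarrow> 0) (at_right 0)"
    and "1 < p" and "1 < q" and "r \<ge> 1" and "1 / r = 1 / p + 1 / q" and "1 / p + 1 / q \<le> 1"
    and "weak_stoch_sigma_conv Q M T A \<beta> e e1 e2 q u U0"
    and "strong_stoch_sigma_conv Q M T A \<beta> e e1 e2 p v V0"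
  shows "weak_stoch_sigma_conv Q M T A \<beta> e e1 e2 r (\<lambda>n z. u n z * v n z) (\<lambda>w. U0 w * V0 w)"
proof -
  define a where "a n = e1 (e n)" for n
  define b where "b n = e2 (e n)" for n
  have e: "\<And>n. 0 < e n" "e \<longlonglongrightarrow> 0" using assms(5) by (auto simp: fundamental_seq_def)
  have e_right: "filterlim e (at_right 0) sequentially"
    by (rule tendsto_imp_filterlim_at_right[OF e(2)]) (simp add: e(1))
  have "filterlim b (at_right 0) sequentially"
    unfolding b_def
    by (rule tendsto_imp_filterlim_at_right[OF filterlim_compose[OF assms(8) e_right]])
      (use assms(6) e(1) in simp)
  then interpret oscillation M T A \<beta> Q a b
    using assms(1-4) by unfold_locales
  \<comment> \<open>Passes from bounds on norms to bounds on modulars: a norm bound C becomes the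
    modular bound \<open>C powr s\<close>.\<close>
  have conv: "converges_against_tests s w W" if w: "weak_stoch_sigma_conv Q M T A \<beta> e e1 e2 s w W" and s: "1 < s" for s w W
  proof -
    note * = w[unfolded weak_stoch_sigma_conv_def, folded a_def b_def]
    from *[THEN conjunct2, THEN conjunct1] obtain C where C: "\<And>n. Lp_norm N s (w n) \<le> C" by blast
    have "(LINT z|N. cmod (w n z) powr s) \<le> C powr s" for n
    proof -
      have "(LINT z|N. cmod (w n z) powr s) = Lp_norm N s (w n) powr s"
        using s by (intro integral_eq_Lp_norm_powr) simp
      also have "\<dots> \<le> C powr s" using C[of n] s by (intro powr_mono2) (auto simp: Lp_norm_def)
      finally show ?thesis .
    qed
    then have "\<exists>K. \<forall>n. (LINT z|N. cmod (w n z) powr s) \<le> K" by blast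
    with * show ?thesis unfolding converges_against_tests_def by (elim conjE) (intro conjI)
  qed
  have strong: "weak_stoch_sigma_conv Q M T A \<beta> e e1 e2 p v V0"
      "(\<lambda>n. Lp_norm N p (v n)) \<longlonglongrightarrow> Lp_norm (N \<Otimes>\<^sub>M \<beta>) p V0"
    using assms(16) unfolding strong_stoch_sigma_conv_def by simp_all
  note p = assms(10) and q = assms(11)
  note cu = conv[OF assms(15) q] and cv = conv[OF strong(1) p]
  have norms: "(\<lambda>n. LINT z|N. cmod (v n z) powr p) \<longlonglongrightarrow> (LINT w|(N \<Otimes>\<^sub>M \<beta>). cmod (V0 w) powr p)"
  proof -
    have "(\<lambda>n. Lp_norm N p (v n) powr p) \<longlonglongrightarrow> Lp_norm (N \<Otimes>\<^sub>M \<beta>) p V0 powr p"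
      using p by (intro tendsto_powr' strong(2) tendsto_const) (auto simp: Lp_norm_def)
    then show ?thesis using p by (simp add: integral_eq_Lp_norm_powr)
  qed
  have pqr: "0 < p" "0 < q" "0 < r" "1 / r = 1 / p + 1 / q" using assms(10-13) by simp_all
  note Lu = converges_against_testsD(1)[OF cu] and Lv = converges_against_testsD(1)[OF cv]
  obtain K where K: "\<And>n. (LINT z|N. cmod (u n z) powr q) \<le> K"
    using converges_against_testsD(2)[OF cu] by blast
  obtain K' where K': "\<And>n. (LINT z|N. cmod (v n z) powr p) \<le> K'"
    using converges_against_testsD(2)[OF cv] by blast
  have bound: "Lp_norm N r (\<lambda>z. u n z * v n z) \<le> (K + K') powr (1 / r)" for n
    unfolding Lp_norm_def
  proof (rule powr_mono2)
    show "(LINT z|N. cmod (u n z * v n z) powr r) \<le> K + K'"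
      using Lp_mult(2)[OF pqr Lu Lv, of n n] K[of n] K'[of n] by linarith
  qed (use pqr in simp_all)
  show ?thesis
    unfolding weak_stoch_sigma_conv_def a_def[symmetric] b_def[symmetric]
  proof (intro conjI allI impI)
    show "Lp N r (\<lambda>z. u n z * v n z)" for n by (rule Lp_mult(1)[OF pqr Lu Lv])
    show "\<exists>C. \<forall>n. Lp_norm N r (\<lambda>z. u n z * v n z) \<le> C" using bound by blast
    show "Lp (N \<Otimes>\<^sub>M \<beta>) r (\<lambda>w. U0 w * V0 w)"
      by (rule Lp_mult(1)[OF pqr converges_against_testsD(3)[OF cu] converges_against_testsD(3)[OF cv]])
    show "(\<lambda>n. LINT z|N. u n z * v n z * osc T (a n) (b n) f z)
        \<longlonglongrightarrow> (LINT w|(N \<Otimes>\<^sub>M \<beta>). U0 w * V0 w * snd w (f (fst (fst w)) (snd (fst w))))"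
      if "test_fun Q M T A f" for f
      by (rule product_tendsto_test_fun[OF p q assms(14) cu cv norms that])
  qed
qed

end
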